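(* Suppose that $W$ is a simply-laced Coxeter group, i.e., $m_{ij}\in\{0,2,3\}$ for all distinct $i,j\in I$. Then the algebra $\mathbf{D}(W)$ is generated by $D_s$, $s\in\mathcal{S}$, subject to the (defining) relations: - $D_s^2=D_s$ for all $s\in\mathcal{S}$; - $D_sD_{s'}=D_{s'}D_s$ for all compatible pairs $(s,s')\in\mathcal{S}\times\mathcal{S}$ with $m_{s,s'}=2$; - $D_sD_{s'}=D_{ss's}D_s+D_{s'}D_{ss's}-D_{ss's}$ for all compatible pairs $(s,s')\in\mathcal{S}\times\mathcal{S}$ with $m_{s,s'}=3$.
   Context: A Coxeter group $W$ is generated by $s_i$, $i\in I$, subject to relations $(s_is_j)^{m_{ij}}=1$, where $m_{ij}=m_{ji}\in\mathbb{Z}_{\ge 0}$ are such that $m_{ij}=1$ iff $i=j$ ($m_{ij}=0$ imposes no relation). $\ell$ is the length function, and $\mathcal{S}:=\{ws_iw^{-1}\mid w\in W,i\in I\}$ is the set of reflections. For $w,w'\in W$, $m_{w,w'}\in\mathbb{Z}_{\ge 0}$ is the order of $ww'$ in $W$ ($0$ if infinite). A pair $(s,s')$ of distinct reflections is compatible if there are $i,j\in I$ and $w\in W$ such that $s=ws_iw^{-1}$, $s'=ws_jw^{-1}$, $\ell(ws_i)=\ell(w)+1$, $\ell(ws_j)=\ell(w)+1$. $\hat{\mathbf{H}}(W)$ is the (unital associative) $\mathbb{Z}$-algebra generated by $s_i,D_i$, $i\in I$, subject to relations: (i) $s_i^2=1$, $D_i^2=D_i$, $s_iD_i+D_is_i=s_i-1$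 for $i\in I$; (ii) $(s_is_j)^{m_{ij}}=1$; (iii) $\underbrace{D_is_js_i\cdots s_{j'}}_{m_{ij}}=\underbrace{s_j\cdots s_{i'}s_{j'}D_{i'}}_{m_{ij}}$ for all distinct $i,j\in I$ with $m_{ij}\ne 0$, where $i'=i$ if $m_{ij}$ is even, $i'=j$ if $m_{ij}$ is odd, and $\{i',j'\}=\{i,j\}$ (each side has $m_{ij}$ factors with indices alternating between $i$ and $j$). It is a Hopf algebra over $\mathbb{Z}$ with $\Delta(s_i)=s_i\otimes s_i$, $\Delta(D_i)=D_i\otimes 1+s_i\otimes D_i$, $\varepsilon(s_i)=1$, $\varepsilon(D_i)=0$. For each $s\in\mathcal{S}$ there is a unique $D_s\in\hat{\mathbf{H}}(W)$ such that $D_{s_i}=D_i$ for $i\in I$ and $D_{s_iss_i}=s_iD_ss_i$ for any $i\in I$, $s\in\mathcal{S}\setminus\{s_i\}$. $\hat{\mathbf{D}}(W)$ is the subalgebra of $\hat{\mathbf{H}}(W)$ generated by all $D_s$, $s\in\mathcal{S}$, and $\mathbf{K}(W):=\bigcap_{w\in W}w\hat{\mathbf{D}}(W)w^{-1}$. For $J\subset I$, $W_J$ is the (Coxeter) subgroup generated by $s_j$, $j\in J$; $\hat{\mathbf{D}}(W_J)$ is identified with the subalgebra of $\hat{\mathbf{D}}(W)$ generated by all $D_s$ with $s\in\mathcal{S}\cap W_J$. $\hat{\mathbf{D}}(W)$ is filtered by $\deg D_s=1$ (degree at most $r$ means: lies in the $\mathbb{Z}$-span of products of at most $r$ of the $D_s$).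 For distinct $i,j\in I$, $\mathbf{K}_{ij}(W)$ is the set of all elements of $\mathbf{K}(W_{\{i,j\}})\cap\operatorname{Ker}\varepsilon$ having degree at most $m_{ij}$. $\mathbf{H}(W)=\hat{\mathbf{H}}(W)/\underline{\mathbf{J}}(W)$, where $\underline{\mathbf{J}}(W)$ is the ideal generated by all $\mathbf{K}_{ij}(W)$, $i\ne j$. $\mathbf{D}(W)$ is the image of $\hat{\mathbf{D}}(W)$ under the projection $\hat{\mathbf{H}}(W)\twoheadrightarrow\mathbf{H}(W)$; the images of $D_s$ are denoted by the same symbols. *)

theory Defs
  imports "HOL-Algebra.Algebra" "HOL-Library.Poly_Mapping"
begin

section \<open>Rings given by generators and relations\<close>

text \<open>
  With lists as an additive monoid under concatenation, the type \<open>'x list \<Rightarrow>\<^sub>0 int\<close> with the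
  convolution product of \<open>Poly_Mapping\<close> is the free unital associative ring
  on the letters of type \<open>'x\<close>.
\<close>

instantiation list :: (type) monoid_add
begin

definition zero_list :: "'a list" where "zero_list = []"

definition plus_list :: "'a list \<Rightarrow> 'a list \<Rightarrow> 'a list" where "plus_list u v = u @ v"

instance
  by standard (simp_all add: zero_list_def plus_list_def)

end

definition free_ring :: "'x set \<Rightarrow> ('x list \<Rightarrow>\<^sub>0 int) ring" where
  "free_ring A =
    \<lparr>carrier = {p. Poly_Mapping.keys p \<subseteq> lists A}, monoid.mult = (*), one = 1, 
     ring.zero = 0, add = (+)\<rparr>"

definition fword :: "'x list \<Rightarrow> ('x list \<Rightarrow>\<^sub>0 int)" where
  "fword u = Poly_Mapping.single u 1"

text \<open>A relation \<open>p = q\<close> is represented by the element \<open>p - q\<close> of the free ring.\<close>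

definition relator_ideal :: "'x set \<Rightarrow> ('x list \<Rightarrow>\<^sub>0 int) set \<Rightarrow> ('x list \<Rightarrow>\<^sub>0 int) set" where
  "relator_ideal A rels = Idl\<^bsub>free_ring A\<^esub> rels"

definition presented_ring :: "'x set \<Rightarrow> ('x list \<Rightarrow>\<^sub>0 int) set \<Rightarrow> ('x list \<Rightarrow>\<^sub>0 int) set ring" where
  "presented_ring A rels = free_ring A Quot relator_ideal A rels"

definition presented_class ::
    "'x set \<Rightarrow> ('x list \<Rightarrow>\<^sub>0 int) set \<Rightarrow> ('x list \<Rightarrow>\<^sub>0 int) \<Rightarrow> ('x list \<Rightarrow>\<^sub>0 int) set" where
  "presented_class A rels p = relator_ideal A rels +>\<^bsub>free_ring A\<^esub> p"

text \<open>\<open>R\<close> is generated by the \<open>g x\<close>, \<open>x \<in> A\<close>, subject to the defining relations \<open>rels\<close>.\<close>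

definition has_presentation ::
    "('r, 'z) ring_scheme \<Rightarrow> 'x set \<Rightarrow> ('x \<Rightarrow> 'r) \<Rightarrow> ('x list \<Rightarrow>\<^sub>0 int) set \<Rightarrow> bool" where
  "has_presentation R A g rels \<longleftrightarrow>
    (\<exists>\<phi> \<in> ring_iso (presented_ring A rels) R.
       \<forall>x \<in> A. \<phi> (presented_class A rels (fword [x])) = g x)"


section \<open>Coxeter groups\<close>

definition coxeter_matrix :: "'i set \<Rightarrow> ('i \<Rightarrow> 'i \<Rightarrow> nat) \<Rightarrow> bool" where
  "coxeter_matrix I m \<longleftrightarrow>
    (\<forall>i \<in> I. \<forall>j \<in> I. m i j = m j i \<and> (m i j = 1 \<longleftrightarrow> i = j))"

text \<open>
  Since \<open>m i i = 1\<close>, the relations \<open>(s\<^sub>i s\<^sub>j)^m\<^sub>i\<^sub>j = 1\<close> include \<open>s\<^sub>i s\<^sub>i = 1\<close>. Formal inverses of the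
  generators are therefore not needed, and the group with the given presentation
  is the quotient of the word monoid \<open>lists I\<close> by the congruence generated by the relations.
\<close>

inductive cox_eq :: "'i set \<Rightarrow> ('i \<Rightarrow> 'i \<Rightarrow> nat) \<Rightarrow> 'i list \<Rightarrow> 'i list \<Rightarrow> bool"
  for I m where
  rel: "i \<in> I \<Longrightarrow> j \<in> I \<Longrightarrow> cox_eq I m (concat (replicate (m i j) [i, j])) []"
| refl: "u \<in> lists I \<Longrightarrow> cox_eq I m u u"
| sym: "cox_eq I m u v \<Longrightarrow> cox_eq I m v u"
| trans: "cox_eq I m u v \<Longrightarrow> cox_eq I m v w \<Longrightarrow> cox_eq I m u w"
| append: "cox_eq I m u u' \<Longrightarrow> cox_eq I m v v' \<Longrightarrow> cox_eq I m (u @ v) (u' @ v')"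

definition cox_class :: "'i set \<Rightarrow> ('i \<Rightarrow> 'i \<Rightarrow> nat) \<Rightarrow> 'i list \<Rightarrow> 'i list set" where
  "cox_class I m u = {v. cox_eq I m u v}"

definition cox_group :: "'i set \<Rightarrow> ('i \<Rightarrow> 'i \<Rightarrow> nat) \<Rightarrow> 'i list set monoid" where
  "cox_group I m =
    \<lparr>carrier = lists I // {(u, v). cox_eq I m u v},
     monoid.mult = (\<lambda>A B. \<Union>u \<in> A. \<Union>v \<in> B. cox_class I m (u @ v)),
     one = cox_class I m []\<rparr>"

definition cox_gen :: "'i set \<Rightarrow> ('i \<Rightarrow> 'i \<Rightarrow> nat) \<Rightarrow> 'i \<Rightarrow> 'i list set" where
  "cox_gen I m i = cox_class I m [i]"

text \<open>An element of the group is the set of all words representing it.\<close>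

definition cox_length :: "'i list set \<Rightarrow> nat" where
  "cox_length w = (LEAST n. \<exists>u \<in> w. length u = n)"

definition reflections :: "'i set \<Rightarrow> ('i \<Rightarrow> 'i \<Rightarrow> nat) \<Rightarrow> 'i list set set" where
  "reflections I m =
    {w \<otimes>\<^bsub>cox_group I m\<^esub> cox_gen I m i \<otimes>\<^bsub>cox_group I m\<^esub> inv\<^bsub>cox_group I m\<^esub> w | w i.
       w \<in> carrier (cox_group I m) \<and> i \<in> I}"

definition cox_order ::
    "'i set \<Rightarrow> ('i \<Rightarrow> 'i \<Rightarrow> nat) \<Rightarrow> 'i list set \<Rightarrow> 'i list set \<Rightarrow> nat" where
  "cox_order I m w w' = group.ord (cox_group I m) (w \<otimes>\<^bsub>cox_group I m\<^esub> w')"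

definition compatible ::
    "'i set \<Rightarrow> ('i \<Rightarrow> 'i \<Rightarrow> nat) \<Rightarrow> 'i list set \<Rightarrow> 'i list set \<Rightarrow> bool" where
  "compatible I m s s' \<longleftrightarrow>
    s \<in> reflections I m \<and> s' \<in> reflections I m \<and> s \<noteq> s' \<and>
    (\<exists>i \<in> I. \<exists>j \<in> I. \<exists>w \<in> carrier (cox_group I m).
       s = w \<otimes>\<^bsub>cox_group I m\<^esub> cox_gen I m i \<otimes>\<^bsub>cox_group I m\<^esub> inv\<^bsub>cox_group I m\<^esub> w \<and>
       s' = w \<otimes>\<^bsub>cox_group I m\<^esub> cox_gen I m j \<otimes>\<^bsub>cox_group I m\<^esub> inv\<^bsub>cox_group I m\<^esub> w \<and>
       cox_length (w \<otimes>\<^bsub>cox_group I m\<^esub> cox_gen I m i) = cox_length w + 1 \<and>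
       cox_length (w \<otimes>\<^bsub>cox_group I m\<^esub> cox_gen I m j) = cox_length w + 1)"

definition parabolic :: "'i set \<Rightarrow> ('i \<Rightarrow> 'i \<Rightarrow> nat) \<Rightarrow> 'i set \<Rightarrow> 'i list set set" where
  "parabolic I m J = generate (cox_group I m) (cox_gen I m ` J)"


section \<open>The algebra \<open>Hhat(W)\<close>\<close>

datatype 'i gen = SGen 'i | DGen 'i

definition gens :: "'i set \<Rightarrow> 'i gen set" where
  "gens I = SGen ` I \<union> DGen ` I"

definition alternating :: "'i \<Rightarrow> 'i \<Rightarrow> nat \<Rightarrow> 'i list" where
  "alternating i j n = map (\<lambda>k. if even k then i else j) [0..<n]"

text \<open>
  In the braid relation both sides have \<open>m i j\<close> factors. The letters \<open>s\<close> on either side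
  form the same alternating word of length \<open>m i j - 1\<close> starting with \<open>j\<close>.
\<close>

definition Hhat_relators :: "'i set \<Rightarrow> ('i \<Rightarrow> 'i \<Rightarrow> nat) \<Rightarrow> ('i gen list \<Rightarrow>\<^sub>0 int) set" where
  "Hhat_relators I m =
     {fword [SGen i, SGen i] - 1 | i. i \<in> I} \<union>
     {fword [DGen i, DGen i] - fword [DGen i] | i. i \<in> I} \<union>
     {(fword [SGen i, DGen i] + fword [DGen i, SGen i]) - (fword [SGen i] - 1) | i. i \<in> I} \<union>
     {fword (concat (replicate (m i j) [SGen i, SGen j])) - 1 | i j. i \<in> I \<and> j \<in> I} \<union>
     {fword (DGen i # map SGen (alternating j i (m i j - 1)))
        - fword (map SGen (alternating j i (m i j - 1)) @ [DGen (if even (m i j) then i else j)])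
       | i j. i \<in> I \<and> j \<in> I \<and> i \<noteq> j \<and> m i j \<noteq> 0}"

definition Hhat :: "'i set \<Rightarrow> ('i \<Rightarrow> 'i \<Rightarrow> nat) \<Rightarrow> ('i gen list \<Rightarrow>\<^sub>0 int) set ring" where
  "Hhat I m = presented_ring (gens I) (Hhat_relators I m)"

definition Hhat_word ::
    "'i set \<Rightarrow> ('i \<Rightarrow> 'i \<Rightarrow> nat) \<Rightarrow> 'i gen list \<Rightarrow> ('i gen list \<Rightarrow>\<^sub>0 int) set" where
  "Hhat_word I m u = presented_class (gens I) (Hhat_relators I m) (fword u)"

text \<open>
  The map \<open>W \<rightarrow> Hhat(W)\<close>, \<open>s\<^sub>i \<mapsto> s\<^sub>i\<close>. By the relations of \<open>Hhat(W)\<close> all words representing \<open>w\<close>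
  have the same image.
\<close>

definition W_to_Hhat ::
    "'i set \<Rightarrow> ('i \<Rightarrow> 'i \<Rightarrow> nat) \<Rightarrow> 'i list set \<Rightarrow> ('i gen list \<Rightarrow>\<^sub>0 int) set" where
  "W_to_Hhat I m w = the_elem ((\<lambda>u. Hhat_word I m (map SGen u)) ` w)"

text \<open>
  The counit, first as the ring homomorphism on the free ring with
  \<open>\<epsilon>(s\<^sub>i) = 1\<close> and \<open>\<epsilon>(D\<^sub>i) = 0\<close>, then as the induced map on the quotient.
\<close>

definition free_counit :: "('i gen list \<Rightarrow>\<^sub>0 int) \<Rightarrow> int" where
  "free_counit p =
    (\<Sum>u \<in> Poly_Mapping.keys p.
       Poly_Mapping.lookup p u * (\<Prod>g\<leftarrow>u. case g of SGen i \<Rightarrow> 1 | DGen i \<Rightarrow> 0))"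

definition counit :: "('i gen list \<Rightarrow>\<^sub>0 int) set \<Rightarrow> int" where
  "counit x = the_elem (free_counit ` x)"

definition D_family ::
    "'i set \<Rightarrow> ('i \<Rightarrow> 'i \<Rightarrow> nat) \<Rightarrow> ('i list set \<Rightarrow> ('i gen list \<Rightarrow>\<^sub>0 int) set) \<Rightarrow> bool" where
  "D_family I m D \<longleftrightarrow>
    D \<in> reflections I m \<rightarrow>\<^sub>E carrier (Hhat I m) \<and>
    (\<forall>i \<in> I. D (cox_gen I m i) = Hhat_word I m [DGen i]) \<and>
    (\<forall>i \<in> I. \<forall>s \<in> reflections I m - {cox_gen I m i}.
       D (cox_gen I m i \<otimes>\<^bsub>cox_group I m\<^esub> s \<otimes>\<^bsub>cox_group I m\<^esub> cox_gen I m i) =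
       Hhat_word I m [SGen i] \<otimes>\<^bsub>Hhat I m\<^esub> D s \<otimes>\<^bsub>Hhat I m\<^esub> Hhat_word I m [SGen i])"

definition D_hat :: "'i set \<Rightarrow> ('i \<Rightarrow> 'i \<Rightarrow> nat) \<Rightarrow> 'i list set \<Rightarrow> ('i gen list \<Rightarrow>\<^sub>0 int) set" where
  "D_hat I m = (THE D. D_family I m D)"

definition Dhat_algebra :: "'i set \<Rightarrow> ('i \<Rightarrow> 'i \<Rightarrow> nat) \<Rightarrow> ('i gen list \<Rightarrow>\<^sub>0 int) set set" where
  "Dhat_algebra I m = generate_ring (Hhat I m) (D_hat I m ` reflections I m)"


section \<open>The quotient \<open>H(W)\<close> and its subalgebra \<open>D(W)\<close>\<close>

text \<open>
  The objects attached to \<open>W\<^sub>J\<close> are realised inside \<open>Hhat(W)\<close>: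
  \<open>Dhat_parabolic I m J\<close> is \<open>Dhat(W\<^sub>J)\<close>, the filtration
  uses the generators \<open>D\<^sub>s\<close> with \<open>s\<close> a reflection in \<open>W\<^sub>J\<close>,
  and \<open>K_parabolic I m J\<close> is the intersection over \<open>w \<in> W\<^sub>J\<close>.
\<close>

definition Dhat_parabolic ::
    "'i set \<Rightarrow> ('i \<Rightarrow> 'i \<Rightarrow> nat) \<Rightarrow> 'i set \<Rightarrow> ('i gen list \<Rightarrow>\<^sub>0 int) set set" where
  "Dhat_parabolic I m J =
    generate_ring (Hhat I m) (D_hat I m ` (reflections I m \<inter> parabolic I m J))"

definition Dhat_parabolic_deg_le ::
    "'i set \<Rightarrow> ('i \<Rightarrow> 'i \<Rightarrow> nat) \<Rightarrow> 'i set \<Rightarrow> nat \<Rightarrow> ('i gen list \<Rightarrow>\<^sub>0 int) set set" where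
  "Dhat_parabolic_deg_le I m J r =
    generate (add_monoid (Hhat I m))
      {foldr (\<lambda>s x. D_hat I m s \<otimes>\<^bsub>Hhat I m\<^esub> x) ss \<one>\<^bsub>Hhat I m\<^esub> | ss.
         ss \<in> lists (reflections I m \<inter> parabolic I m J) \<and> length ss \<le> r}"

definition K_parabolic ::
    "'i set \<Rightarrow> ('i \<Rightarrow> 'i \<Rightarrow> nat) \<Rightarrow> 'i set \<Rightarrow> ('i gen list \<Rightarrow>\<^sub>0 int) set set" where
  "K_parabolic I m J =
    (\<Inter>w \<in> parabolic I m J.
       {W_to_Hhat I m w \<otimes>\<^bsub>Hhat I m\<^esub> x \<otimes>\<^bsub>Hhat I m\<^esub> W_to_Hhat I m (inv\<^bsub>cox_group I m\<^esub> w) | x.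
          x \<in> Dhat_parabolic I m J})"

definition K_pair ::
    "'i set \<Rightarrow> ('i \<Rightarrow> 'i \<Rightarrow> nat) \<Rightarrow> 'i \<Rightarrow> 'i \<Rightarrow> ('i gen list \<Rightarrow>\<^sub>0 int) set set" where
  "K_pair I m i j =
    {x \<in> K_parabolic I m {i, j}. counit x = 0 \<and> x \<in> Dhat_parabolic_deg_le I m {i, j} (m i j)}"

definition J_ideal :: "'i set \<Rightarrow> ('i \<Rightarrow> 'i \<Rightarrow> nat) \<Rightarrow> ('i gen list \<Rightarrow>\<^sub>0 int) set set" where
  "J_ideal I m = Idl\<^bsub>Hhat I m\<^esub> (\<Union>i \<in> I. \<Union>j \<in> I - {i}. K_pair I m i j)"

definition H_algebra :: "'i set \<Rightarrow> ('i \<Rightarrow> 'i \<Rightarrow> nat) \<Rightarrow> ('i gen list \<Rightarrow>\<^sub>0 int) set set ring" where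
  "H_algebra I m = Hhat I m Quot J_ideal I m"

definition H_proj ::
    "'i set \<Rightarrow> ('i \<Rightarrow> 'i \<Rightarrow> nat) \<Rightarrow> ('i gen list \<Rightarrow>\<^sub>0 int) set \<Rightarrow> ('i gen list \<Rightarrow>\<^sub>0 int) set set" where
  "H_proj I m x = J_ideal I m +>\<^bsub>Hhat I m\<^esub> x"

definition D_algebra :: "'i set \<Rightarrow> ('i \<Rightarrow> 'i \<Rightarrow> nat) \<Rightarrow> ('i gen list \<Rightarrow>\<^sub>0 int) set set ring" where
  "D_algebra I m = (H_algebra I m) \<lparr>carrier := H_proj I m ` Dhat_algebra I m\<rparr>"

definition D_refl ::
    "'i set \<Rightarrow> ('i \<Rightarrow> 'i \<Rightarrow> nat) \<Rightarrow> 'i list set \<Rightarrow> ('i gen list \<Rightarrow>\<^sub>0 int) set set" where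
  "D_refl I m s = H_proj I m (D_hat I m s)"

end

theory Submission
  imports Defs
begin

text \<open>
  All elements \<open>D\<^sub>s\<close> exist because an element of \<open>W\<close> carrying one simple root to another is
  a product of rank two moves, each of which is matched by a braid relation of \<open>Hhat(W)\<close>. For two
  simple reflections the relators lie in \<open>K\<^sub>i\<^sub>j\<close>, and conjugation by \<open>W\<close> carries them to all
  compatible pairs, so the relations hold in \<open>D(W)\<close>.

  Conversely, \<open>s\<^sub>i D\<^sub>t = D\<^bsub>s\<^sub>i t s\<^sub>i\<^esub> s\<^sub>i\<close> for \<open>t \<noteq> s\<^sub>i\<close> and \<open>s\<^sub>i D\<^sub>i = s\<^sub>i - 1 - D\<^sub>i s\<^sub>i\<close> prescribe an action of
  \<open>Hhat(W)\<close> on the algebra \<open>P\<close> presented by the relations, once the value of \<open>s\<^sub>i\<close> on \<open>1\<close> is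
  chosen to be \<open>e = 1\<close> or \<open>e = -1\<close>; the elements of \<open>Dhat(W)\<close> act by left multiplication. If \<open>x\<close> lies
  in \<open>K\<^sub>i\<^sub>j\<close>, then \<open>s\<^sub>i x s\<^sub>i\<close> and its further conjugates lie in \<open>Dhat(W)\<close> again; comparing the two actions,
  this says that the coefficients of \<open>x\<close> in a rank two normal form satisfy linear relations in \<open>P\<close>.
  The characters of \<open>P\<close> that send all \<open>D\<^sub>s\<close> to \<open>0\<close>, or all to \<open>1\<close>, make these coefficients vanish.
  Hence the ideal defining \<open>H(W)\<close> acts by zero on \<open>P\<close>, and no further relations hold in \<open>D(W)\<close>.
\<close>

section \<open>Free rings and their quotients\<close>

text \<open>The rank two argument is shaped by an obstacle: no basis of \<open>P\<close> is at hand.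
  Normal forms are shown to span, but their monomials are not known to be independent modulo the
  relations, and torsion in \<open>P\<close> is not excluded. What can be read off is the value of a
  character, and sending every \<open>D_s\<close> to one integer z respects the relations only for z
  = 0 and z = 1.

  The remedy is degree reduction. Write s_i x = x' s_i + x'' with x', x'' polynomials in the
  \<open>D_t\<close>. If s_i acts on 1 by e, then s_i x sends 1 to e x' + x''; adding both signs
  leaves 2 x'', which is of smaller degree than x. Repeating this leaves so few monomials that two
  characters separate their coefficients, and the powers of 2 are cancelled only in the integers.
  Conjugation by a single generator does not see \<open>D_r\<close> for r = s_i s_j s_i, because s_i
  and s_j merely move it; two successive conjugations do.

  Roots are not constructed either: the signs needed to define \<open>D_s\<close> are carried by
  \<open>nu\<close>, a parity cocycle on words.\<close>

lemma fword_mult: "fword u * fword v = fword (u @ v)"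
  by (simp add: fword_def mult_single plus_list_def)

lemma fword_Nil: "fword [] = 1"
  by (simp add: fword_def zero_list_def[symmetric])

lemma fword_split: "fword (x # u) = fword [x] * fword u"
  by (simp add: fword_mult)

text \<open>Closure under differences covers sums and negatives in one case, so additive maps and
  additive subgroups are tested on words alone.\<close>

lemma fword_induct [consumes 1, case_names zero word diff]:
  assumes "Poly_Mapping.keys p \<subseteq> L" "P 0" "\<And>u. u \<in> L \<Longrightarrow> P (fword u)"
    "\<And>p q. P p \<Longrightarrow> P q \<Longrightarrow> P (p - q)"
  shows "P p"
  using assms unfolding fword_def by (induction p rule: frag_induction) auto

lemma frag_extend_fword [simp]: "frag_extend f (fword u) = f u"
  by (simp add: fword_def)

lemma frag_extend_1 [simp]: "frag_extend f 1 = f []"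
  by (simp flip: fword_Nil)

lemma frag_extend_mult:
  assumes "\<And>u v. f (u @ v) = f u * f v"
  shows "frag_extend f (p * q) = frag_extend f p * frag_extend f q"
proof (induction p rule: fword_induct[OF subset_UNIV])
  case (2 u)
  show ?case
    by (induction q rule: fword_induct[OF subset_UNIV])
      (auto simp: fword_mult assms frag_extend_diff algebra_simps)
qed (auto simp: frag_extend_diff left_diff_distrib)

lemma frag_extend_of_int: "frag_extend f (of_int n * p) = of_int n * frag_extend f p"
proof (induction n rule: int_induct[where k = 0])
  case (step1 i)
  then show ?case by (simp add: distrib_right frag_extend_add)
next
  case (step2 i)
  then show ?case by (simp add: left_diff_distrib frag_extend_diff)
qed auto

lemma keys_fword [simp]: "Poly_Mapping.keys (fword u) = {u}"
  by (simp add: fword_def)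

lemma carrier_free_ring: "p \<in> carrier (free_ring A) \<longleftrightarrow> Poly_Mapping.keys p \<subseteq> lists A"
  by (simp add: free_ring_def)

lemma free_ring_simps:
  "x \<otimes>\<^bsub>free_ring A\<^esub> y = x * y" "\<one>\<^bsub>free_ring A\<^esub> = 1" "\<zero>\<^bsub>free_ring A\<^esub> = 0" "x \<oplus>\<^bsub>free_ring A\<^esub> y = x + y"
  by (simp_all add: free_ring_def)

lemma free_ring_closed [simp, intro]:
  "0 \<in> carrier (free_ring A)" "1 \<in> carrier (free_ring A)"
  "x \<in> carrier (free_ring A) \<Longrightarrow> - x \<in> carrier (free_ring A)"
  "x \<in> carrier (free_ring A) \<Longrightarrow> y \<in> carrier (free_ring A) \<Longrightarrow> x + y \<in> carrier (free_ring A)"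
  "x \<in> carrier (free_ring A) \<Longrightarrow> y \<in> carrier (free_ring A) \<Longrightarrow> x - y \<in> carrier (free_ring A)"
  "u \<in> lists A \<Longrightarrow> fword u \<in> carrier (free_ring A)"
  using keys_add[of x y] keys_diff[of x y]
  by (auto simp: carrier_free_ring zero_list_def simp del: lists_eq_set)

lemma free_ring_mult_closed [simp, intro]:
  "x \<in> carrier (free_ring A) \<Longrightarrow> y \<in> carrier (free_ring A) \<Longrightarrow> x * y \<in> carrier (free_ring A)"
  using keys_mult[of x y] by (fastforce simp: carrier_free_ring plus_list_def)

lemma free_ring_of_int [simp, intro]: "of_int n \<in> carrier (free_ring A)"
  by (induction n rule: int_induct[where k = 0]) auto

lemma free_ring_ring: "ring (free_ring A)"
proof (rule ringI)
  show "abelian_group (free_ring A)"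
  proof (rule abelian_groupI)
    show "\<exists>y\<in>carrier (free_ring A). y \<oplus>\<^bsub>free_ring A\<^esub> x = \<zero>\<^bsub>free_ring A\<^esub>"
      if "x \<in> carrier (free_ring A)" for x
      using that by (intro bexI[of _ "- x"]) (auto simp: free_ring_simps)
  qed (auto simp: free_ring_simps)
  show "monoid (free_ring A)"
    by (rule monoidI) (auto simp: free_ring_simps mult.assoc)
qed (auto simp: free_ring_simps algebra_simps)

lemma free_ring_uminus:
  assumes "x \<in> carrier (free_ring A)"
  shows "\<ominus>\<^bsub>free_ring A\<^esub> x = - x"
proof -
  interpret ring "free_ring A" by (rule free_ring_ring)
  show ?thesis by (rule minus_equality) (use assms in \<open>auto simp: free_ring_simps\<close>)
qed

lemma free_ring_additive_subgroupI:
  assumes "N \<subseteq> carrier (free_ring A)" "0 \<in> N" "\<And>x y. x \<in> N \<Longrightarrow> y \<in> N \<Longrightarrow> x - y \<in> N"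
  shows "subgroup N (add_monoid (free_ring A))"
proof -
  have neg: "- x \<in> N" if "x \<in> N" for x using assms(3)[OF assms(2) that] by simp
  have "x + y \<in> N" if "x \<in> N" "y \<in> N" for x y
    using assms(3)[OF that(1) neg[OF that(2)]] by simp
  then show ?thesis
    using assms neg free_ring_uminus[of _ A]
    by unfold_locales (auto simp: free_ring_simps a_inv_def)
qed

lemma free_ring_idealI:
  assumes "N \<subseteq> carrier (free_ring A)" "0 \<in> N" "\<And>x y. x \<in> N \<Longrightarrow> y \<in> N \<Longrightarrow> x - y \<in> N"
    "\<And>x y. x \<in> N \<Longrightarrow> y \<in> carrier (free_ring A) \<Longrightarrow> y * x \<in> N"
    "\<And>x y. x \<in> N \<Longrightarrow> y \<in> carrier (free_ring A) \<Longrightarrow> x * y \<in> N"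
  shows "ideal N (free_ring A)"
  using assms by (intro idealI free_ring_ring free_ring_additive_subgroupI) (auto simp: free_ring_simps)

text \<open>The ideal as an additive span of two-sided translates of relators. This form yields the
  induction rule \<open>N_induct\<close>: an additive map respects the ideal once it does so on
  translates of single relators.\<close>

inductive_set relator_span :: "'x set \<Rightarrow> ('x list \<Rightarrow>\<^sub>0 int) set \<Rightarrow> ('x list \<Rightarrow>\<^sub>0 int) set"
  for A rels where
  zero: "0 \<in> relator_span A rels"
| rel: "u \<in> lists A \<Longrightarrow> v \<in> lists A \<Longrightarrow> r \<in> rels \<Longrightarrow> fword u * r * fword v \<in> relator_span A rels"
| diff: "x \<in> relator_span A rels \<Longrightarrow> y \<in> relator_span A rels \<Longrightarrow> x - y \<in> relator_span A rels"

lemma relator_span_ideal: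
  assumes "rels \<subseteq> carrier (free_ring A)"
  shows "ideal (relator_span A rels) (free_ring A)"
proof (rule free_ring_idealI)
  have "x \<in> carrier (free_ring A)" if "x \<in> relator_span A rels" for x
    using that assms by induction blast+
  then show "relator_span A rels \<subseteq> carrier (free_ring A)" by blast
next
  fix x y assume x: "x \<in> relator_span A rels" and y: "y \<in> carrier (free_ring A)"
  have l: "fword w * x \<in> relator_span A rels" if "w \<in> lists A" for w
    using x that
  proof induction
    case (rel u v r)
    then have "fword (w @ u) * r * fword v \<in> relator_span A rels"
      by (intro relator_span.rel) auto
    then show ?case by (simp add: mult.assoc flip: fword_mult)
  qed (auto simp: right_diff_distrib intro: relator_span.zero relator_span.diff)
  have r: "x * fword w \<in> relator_span A rels" if "w \<in> lists A" for w
    using x that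
  proof induction
    case (rel u v r)
    then have "fword u * r * fword (v @ w) \<in> relator_span A rels"
      by (intro relator_span.rel) auto
    then show ?case by (simp add: mult.assoc flip: fword_mult)
  qed (auto simp: left_diff_distrib intro: relator_span.zero relator_span.diff)
  from y have y': "Poly_Mapping.keys y \<subseteq> lists A" by (simp add: carrier_free_ring)
  show "y * x \<in> relator_span A rels"
    using y' by (induction y rule: fword_induct)
      (auto simp: left_diff_distrib l intro: relator_span.zero relator_span.diff)
  show "x * y \<in> relator_span A rels"
    using y' by (induction y rule: fword_induct)
      (auto simp: right_diff_distrib r intro: relator_span.zero relator_span.diff)
qed (auto intro: relator_span.zero relator_span.diff)

lemma relator_ideal_eq_span:
  assumes "rels \<subseteq> carrier (free_ring A)"
  shows "relator_ideal A rels = relator_span A rels"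
proof -
  interpret R: ring "free_ring A" by (rule free_ring_ring)
  interpret ideal "Idl\<^bsub>free_ring A\<^esub> rels" "free_ring A"
    using assms by (rule R.genideal_ideal)
  have "r \<in> relator_span A rels" if "r \<in> rels" for r
    using relator_span.rel[of "[]" A "[]" r rels] that by (simp add: fword_Nil)
  then have "Idl\<^bsub>free_ring A\<^esub> rels \<subseteq> relator_span A rels"
    using R.genideal_minimal[OF relator_span_ideal[OF assms]] by blast
  moreover have "x \<in> Idl\<^bsub>free_ring A\<^esub> rels" if "x \<in> relator_span A rels" for x
    using that
  proof induction
    case zero
    show ?case using zero_closed by (simp add: free_ring_simps)
  next
    case (rel u v r)
    then have "r \<in> Idl\<^bsub>free_ring A\<^esub> rels" using R.genideal_self[OF assms] by blast
    then show ?case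
      using rel I_l_closed[of r "fword u"] I_r_closed[of "fword u * r" "fword v"]
      by (auto simp: free_ring_simps)
  next
    case (diff x y)
    then have "\<ominus>\<^bsub>free_ring A\<^esub> y = - y" by (intro free_ring_uminus) (auto intro: a_subset[THEN subsetD])
    then show ?case
      using a_closed[OF diff.IH(1) a_inv_closed[OF diff.IH(2)]] by (simp add: free_ring_simps)
  qed
  ultimately show ?thesis by (auto simp: relator_ideal_def)
qed

section \<open>Calculation modulo the relator ideal of a presented ring\<close>

locale presentation =
  fixes A :: "'x set" and rels :: "('x list \<Rightarrow>\<^sub>0 int) set"
  assumes rels: "rels \<subseteq> carrier (free_ring A)"
begin

abbreviation "N \<equiv> relator_ideal A rels"
abbreviation "F \<equiv> carrier (free_ring A)"
abbreviation "Q \<equiv> presented_ring A rels"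
abbreviation "cls \<equiv> presented_class A rels"

lemma N_ideal: "ideal N (free_ring A)"
  using relator_span_ideal[OF rels] relator_ideal_eq_span[OF rels] by simp

lemma N_induct [consumes 1, case_names zero rel diff]:
  assumes "x \<in> N" "P 0" "\<And>u v r. u \<in> lists A \<Longrightarrow> v \<in> lists A \<Longrightarrow> r \<in> rels \<Longrightarrow> P (fword u * r * fword v)"
    "\<And>x y. P x \<Longrightarrow> P y \<Longrightarrow> P (x - y)"
  shows "P x"
  using assms(1) unfolding relator_ideal_eq_span[OF rels]
  by (induction rule: relator_span.induct) (use assms(2-) in auto)

lemma N_sub: "x \<in> N \<Longrightarrow> x \<in> F"
  using ideal.Icarr[OF N_ideal] by blast

lemma N_zero: "0 \<in> N"
  and N_diff: "x \<in> N \<Longrightarrow> y \<in> N \<Longrightarrow> x - y \<in> N"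
  unfolding relator_ideal_eq_span[OF rels] by (auto intro: relator_span.zero relator_span.diff)

lemma N_uminus: "x \<in> N \<Longrightarrow> - x \<in> N"
  using N_diff[OF N_zero] by fastforce

lemma N_add: "x \<in> N \<Longrightarrow> y \<in> N \<Longrightarrow> x + y \<in> N"
  using N_diff[OF _ N_uminus[of y], of x] by simp

lemma N_l: "x \<in> N \<Longrightarrow> y \<in> F \<Longrightarrow> y * x \<in> N"
  and N_r: "x \<in> N \<Longrightarrow> y \<in> F \<Longrightarrow> x * y \<in> N"
  using ideal.I_l_closed[OF N_ideal] ideal.I_r_closed[OF N_ideal] by (auto simp: free_ring_simps)

lemma N_rel: "r \<in> rels \<Longrightarrow> r \<in> N"
  using ring.genideal_self[OF free_ring_ring rels] by (auto simp: relator_ideal_def)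

lemma N_trans: "x - y \<in> N \<Longrightarrow> y - z \<in> N \<Longrightarrow> x - z \<in> N"
  using N_add[of "x - y" "y - z"] by simp

lemma N_sym: "x - y \<in> N \<Longrightarrow> y - x \<in> N"
  using N_uminus[of "x - y"] by simp

lemma N_mult_cong:
  assumes "x - x' \<in> N" "y - y' \<in> N" "x' \<in> F" "y \<in> F"
  shows "x * y - x' * y' \<in> N"
proof -
  have "x * y - x' * y' = (x - x') * y + x' * (y - y')" by (simp add: algebra_simps)
  then show ?thesis using assms by (auto intro: N_add N_l N_r)
qed

lemma Q_ring: "ring Q"
  unfolding presented_ring_def by (rule ideal.quotient_is_ring[OF N_ideal])

lemma mem_cls: "p \<in> F \<Longrightarrow> x \<in> cls p \<longleftrightarrow> x - p \<in> N"
  by (force simp: presented_class_def a_r_coset_def' free_ring_simps algebra_simps)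

lemma cls_eq: "p \<in> F \<Longrightarrow> q \<in> F \<Longrightarrow> cls p = cls q \<longleftrightarrow> p - q \<in> N"
proof
  assume *: "p \<in> F" "q \<in> F" "cls p = cls q"
  have "p \<in> cls p" using *(1) N_zero by (simp add: mem_cls)
  then show "p - q \<in> N" using * mem_cls[of q p] by simp
next
  assume *: "p \<in> F" "q \<in> F" "p - q \<in> N"
  show "cls p = cls q"
    using * mem_cls N_trans[of _ p q] N_trans[OF _ N_sym[of p q]] by blast
qed

lemma carrier_Q: "carrier Q = cls ` F"
  by (auto simp: presented_ring_def presented_class_def FactRing_def A_RCOSETS_def' a_r_coset_def)

lemma cls_closed [simp, intro]: "p \<in> F \<Longrightarrow> cls p \<in> carrier Q"
  by (simp add: carrier_Q)

lemma cls_mult: "p \<in> F \<Longrightarrow> q \<in> F \<Longrightarrow> cls p \<otimes>\<^bsub>Q\<^esub> cls q = cls (p * q)"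
  and cls_add: "p \<in> F \<Longrightarrow> q \<in> F \<Longrightarrow> cls p \<oplus>\<^bsub>Q\<^esub> cls q = cls (p + q)"
  and cls_one: "\<one>\<^bsub>Q\<^esub> = cls 1"
  using ideal.rcoset_mult_add[OF N_ideal] ideal.a_rcos_sum[OF N_ideal]
  by (auto simp: presented_ring_def presented_class_def FactRing_def free_ring_simps)

lemma cls_zero: "\<zero>\<^bsub>Q\<^esub> = cls 0"
  using mem_cls[of 0] by (auto simp: presented_ring_def FactRing_def)

lemma cls_eq_zero: "p \<in> F \<Longrightarrow> cls p = \<zero>\<^bsub>Q\<^esub> \<longleftrightarrow> p \<in> N"
  using cls_eq[of p 0] by (simp add: cls_zero)

lemma cls_uminus:
  assumes "p \<in> F" shows "\<ominus>\<^bsub>Q\<^esub> cls p = cls (- p)"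
proof -
  interpret ring Q by (rule Q_ring)
  show ?thesis
    by (rule minus_equality) (use assms in \<open>auto simp: cls_add cls_zero\<close>)
qed

end

section \<open>Simply-laced Coxeter groups\<close>

lemma cox_eq_lists: "cox_eq I m u v \<Longrightarrow> u \<in> lists I \<and> v \<in> lists I"
proof (induction rule: cox_eq.induct)
  case (rel i j)
  then have "set (concat (replicate (m i j) [i, j])) \<subseteq> I" by auto
  then show ?case by (auto simp: subset_iff)
qed auto

locale simply_laced =
  fixes I :: "'i set" and m :: "'i \<Rightarrow> 'i \<Rightarrow> nat"
  assumes matrix: "coxeter_matrix I m"
    and laced: "\<forall>i \<in> I. \<forall>j \<in> I. i \<noteq> j \<longrightarrow> m i j \<in> {0, 2, 3}"
begin

abbreviation "W \<equiv> cox_group I m"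
abbreviation "cl \<equiv> cox_class I m"
abbreviation "g \<equiv> cox_gen I m"
abbreviation "R \<equiv> reflections I m"
definition "L = lists I"

lemma L_simps [simp]:
  "[] \<in> L" "i # u \<in> L \<longleftrightarrow> i \<in> I \<and> u \<in> L" "u @ v \<in> L \<longleftrightarrow> u \<in> L \<and> v \<in> L" "rev u \<in> L \<longleftrightarrow> u \<in> L"
  by (auto simp: L_def)

lemma L_subset: "i \<in> I \<Longrightarrow> k \<in> I \<Longrightarrow> x \<in> lists {i, k} \<Longrightarrow> x \<in> L"
  by (auto simp: L_def)

lemma cox_eq_L: "cox_eq I m u v \<Longrightarrow> u \<in> L \<and> v \<in> L"
  unfolding L_def by (rule cox_eq_lists)

lemma concat_replicate_L [simp]: "u \<in> L \<Longrightarrow> concat (replicate n u) \<in> L"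
  by (induction n) auto

lemma m_sym: "i \<in> I \<Longrightarrow> j \<in> I \<Longrightarrow> m i j = m j i"
  and m_one: "i \<in> I \<Longrightarrow> m i i = 1"
  using bspec[OF bspec[OF matrix[unfolded coxeter_matrix_def]]] by simp_all

lemma m_cases:
  assumes "i \<in> I" "j \<in> I" "i \<noteq> j"
  obtains "m i j = 0" | "m i j = 2" | "m i j = 3"
  using bspec[OF bspec[OF laced assms(1)] assms(2)] assms(3) by auto

lemma mem_cl: "v \<in> cl u \<longleftrightarrow> cox_eq I m u v"
  by (simp add: cox_class_def)

lemma cl_eq:
  assumes "u \<in> L" "v \<in> L"
  shows "cl u = cl v \<longleftrightarrow> cox_eq I m u v"
proof
  assume "cl u = cl v"
  moreover have "v \<in> cl v" using cox_eq.refl assms by (simp add: mem_cl L_def)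
  ultimately show "cox_eq I m u v" using mem_cl by blast
next
  assume uv: "cox_eq I m u v"
  have "x \<in> cl u \<longleftrightarrow> x \<in> cl v" for x
    unfolding mem_cl using cox_eq.trans[OF uv, of x] cox_eq.trans[OF cox_eq.sym[OF uv], of x] by iprover
  then show "cl u = cl v" by blast
qed

lemma carrier_W: "carrier W = cl ` L"
  by (auto simp: cox_group_def quotient_def cox_class_def L_def)

lemma cl_closed [simp, intro]: "u \<in> L \<Longrightarrow> cl u \<in> carrier W"
  by (simp add: carrier_W)

lemma one_W: "\<one>\<^bsub>W\<^esub> = cl []"
  by (simp add: cox_group_def)

lemma mult_W:
  assumes "u \<in> L" "v \<in> L"
  shows "cl u \<otimes>\<^bsub>W\<^esub> cl v = cl (u @ v)"
proof -
  have "cl (u' @ v') = cl (u @ v)" if "u' \<in> cl u" "v' \<in> cl v" for u' v'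
  proof -
    have "cox_eq I m (u' @ v') (u @ v)"
      using that by (intro cox_eq.append cox_eq.sym[of I m u] cox_eq.sym[of I m v]) (simp_all add: mem_cl)
    with cox_eq_L[OF this] show ?thesis by (subst cl_eq) auto
  qed
  then have "cl u \<otimes>\<^bsub>W\<^esub> cl v = (\<Union>u' \<in> cl u. \<Union>v' \<in> cl v. cl (u @ v))"
    unfolding cox_group_def monoid.simps by (intro SUP_cong refl) auto
  moreover have "u \<in> cl u" "v \<in> cl v" using assms by (simp_all add: mem_cl L_def cox_eq.refl)
  ultimately show ?thesis by auto
qed

lemma cl_cong:
  assumes "cl u = cl u'" "u \<in> L" "u' \<in> L" "x \<in> L" "y \<in> L"
  shows "cl (x @ u @ y) = cl (x @ u' @ y)"
  using mult_W[of x "u @ y"] mult_W[of u y] mult_W[of x "u' @ y"] mult_W[of u' y] assms by auto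

lemma cl_rel: "i \<in> I \<Longrightarrow> j \<in> I \<Longrightarrow> cl (concat (replicate (m i j) [i, j])) = cl []"
  using cox_eq.rel[of i I j m] cox_eq_L[OF cox_eq.rel[of i I j m]] by (subst cl_eq) auto

lemma cl_square: "i \<in> I \<Longrightarrow> cl [i, i] = cl []"
  using cl_rel[of i i] by (simp add: m_one)

lemma cl_rev: "u \<in> L \<Longrightarrow> cl (u @ rev u) = cl []"
proof (induction u)
  case (Cons i u)
  then have "cl ([i] @ (u @ rev u) @ [i]) = cl ([i] @ [] @ [i])"
    by (intro cl_cong) auto
  then show ?case using Cons by (simp add: cl_square)
qed simp

lemma group_W: "group W"
proof (rule groupI)
  fix x assume "x \<in> carrier W"
  then obtain u where u: "x = cl u" "u \<in> L" by (auto simp: carrier_W)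
  then have "cl (rev u) \<otimes>\<^bsub>W\<^esub> x = \<one>\<^bsub>W\<^esub>"
    using cl_rev[of "rev u"] by (simp add: mult_W one_W)
  then show "\<exists>y\<in>carrier W. y \<otimes>\<^bsub>W\<^esub> x = \<one>\<^bsub>W\<^esub>"
    using u by (intro bexI[of _ "cl (rev u)"]) auto
next
  show "x \<otimes>\<^bsub>W\<^esub> y \<otimes>\<^bsub>W\<^esub> z = x \<otimes>\<^bsub>W\<^esub> (y \<otimes>\<^bsub>W\<^esub> z)"
    if "x \<in> carrier W" "y \<in> carrier W" "z \<in> carrier W" for x y z
    using that by (auto simp: carrier_W mult_W)
qed (auto simp: carrier_W one_W mult_W)

sublocale W: group W by (rule group_W)

lemma inv_W: "u \<in> L \<Longrightarrow> inv\<^bsub>W\<^esub> cl u = cl (rev u)"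
  using cl_rev[of "rev u"] by (intro W.inv_equality) (auto simp: mult_W one_W)

lemma g_cl: "g i = cl [i]"
  by (simp add: cox_gen_def)

lemma g_closed [simp, intro]: "i \<in> I \<Longrightarrow> g i \<in> carrier W"
  by (simp add: g_cl)

section \<open>Conjugation by words and the set of reflections\<close>

definition c :: "'i \<Rightarrow> 'i list set \<Rightarrow> 'i list set" where
  "c i t = g i \<otimes>\<^bsub>W\<^esub> t \<otimes>\<^bsub>W\<^esub> g i"

definition cj :: "'i list \<Rightarrow> 'i list set \<Rightarrow> 'i list set" where
  "cj u t = foldr c u t"

lemma cj_simps [simp]: "cj [] t = t" "cj (i # u) t = c i (cj u t)" "cj (u @ v) t = cj u (cj v t)"
  by (simp_all add: cj_def)

lemma c_cl: "i \<in> I \<Longrightarrow> x \<in> L \<Longrightarrow> c i (cl x) = cl (i # x @ [i])"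
  by (simp add: c_def g_cl mult_W)

lemma cj_cl: "u \<in> L \<Longrightarrow> x \<in> L \<Longrightarrow> cj u (cl x) = cl (u @ x @ rev u)"
  by (induction u) (auto simp: c_cl)

lemma c_c [simp]:
  assumes "i \<in> I" "t \<in> carrier W" shows "c i (c i t) = t"
proof -
  obtain x where x: "t = cl x" "x \<in> L" using assms by (auto simp: carrier_W)
  have "cl ([i, i] @ x @ [i, i]) = cl ([] @ x @ [i, i])"
    using cl_cong[of "[i, i]" "[]" "[]" "x @ [i, i]"] x assms cl_square by auto
  also have "\<dots> = cl x"
    using cl_cong[of "[i, i]" "[]" x "[]"] x assms cl_square by auto
  finally show ?thesis using x assms by (simp add: c_cl)
qed

lemma c_closed [simp, intro]: "i \<in> I \<Longrightarrow> t \<in> carrier W \<Longrightarrow> c i t \<in> carrier W"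
  by (simp add: c_def)

lemma cj_closed [simp, intro]: "u \<in> L \<Longrightarrow> t \<in> carrier W \<Longrightarrow> cj u t \<in> carrier W"
  by (induction u) auto

lemma cj_rev [simp]: "u \<in> L \<Longrightarrow> t \<in> carrier W \<Longrightarrow> cj (rev u) (cj u t) = t"
  by (induction u) auto

lemma cj_eq_iff: "u \<in> L \<Longrightarrow> t \<in> carrier W \<Longrightarrow> s \<in> carrier W \<Longrightarrow> cj u t = s \<longleftrightarrow> t = cj (rev u) s"
  using cj_rev[of u t] cj_rev[of "rev u" s] by auto

lemma cj_inj:
  assumes "u \<in> L" "t \<in> carrier W" "s \<in> carrier W"
  shows "cj u t = cj u s \<longleftrightarrow> t = s"
proof
  assume "cj u t = cj u s"
  then have "cj (rev u) (cj u t) = cj (rev u) (cj u s)" by simp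
  then show "t = s" using assms by simp
qed simp

lemma c_inj:
  assumes "i \<in> I" "t \<in> carrier W" "s \<in> carrier W"
  shows "c i t = c i s \<longleftrightarrow> t = s"
  using cj_inj[of "[i]" t s] assms by simp

lemma cj_eq: "u \<in> L \<Longrightarrow> t \<in> carrier W \<Longrightarrow> cj u t = cl u \<otimes>\<^bsub>W\<^esub> t \<otimes>\<^bsub>W\<^esub> inv\<^bsub>W\<^esub> cl u"
  by (auto simp: carrier_W cj_cl mult_W inv_W)

lemma cj_cong: "cl u = cl v \<Longrightarrow> u \<in> L \<Longrightarrow> v \<in> L \<Longrightarrow> t \<in> carrier W \<Longrightarrow> cj u t = cj v t"
  by (simp add: cj_eq)

lemma c_g [simp]: "i \<in> I \<Longrightarrow> c i (g i) = g i"
  using cl_cong[of "[i, i]" "[]" "[]" "[i]"] cl_square[of i] by (simp add: g_cl c_cl)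

lemma reflections_eq: "R = {cj u (g i) | u i. u \<in> L \<and> i \<in> I}"
proof -
  have "cl u \<otimes>\<^bsub>W\<^esub> g i \<otimes>\<^bsub>W\<^esub> inv\<^bsub>W\<^esub> cl u = cj u (g i)" if "u \<in> L" "i \<in> I" for u i
    using that by (simp add: cj_eq)
  then show ?thesis unfolding reflections_def carrier_W by blast
qed

lemma reflections_closed: "t \<in> R \<Longrightarrow> t \<in> carrier W"
  by (auto simp: reflections_eq)

lemma g_reflection [simp, intro]: "i \<in> I \<Longrightarrow> g i \<in> R"
  unfolding reflections_eq by (rule CollectI, rule exI[of _ "[]"], rule exI[of _ i]) simp

lemma c_reflection [simp, intro]:
  assumes "i \<in> I" "t \<in> R" shows "c i t \<in> R"
proof -
  obtain u j where "t = cj u (g j)" "u \<in> L" "j \<in> I" using assms by (auto simp: reflections_eq)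
  then show ?thesis unfolding reflections_eq
    using assms by (intro CollectI exI[of _ "i # u"] exI[of _ j]) simp
qed

lemma cj_reflection [simp, intro]: "u \<in> L \<Longrightarrow> t \<in> R \<Longrightarrow> cj u t \<in> R"
  by (induction u) auto

text \<open>The step may assume \<open>t \<noteq> g i\<close> because \<open>c i\<close> fixes
  \<open>g i\<close>; this is exactly the range in which the family \<open>D\<close> satisfies its
  recursion.\<close>

lemma reflections_induct [consumes 1, case_names gen conj]:
  assumes "t \<in> R" and gen: "\<And>i. i \<in> I \<Longrightarrow> P (g i)"
    and conj: "\<And>i t. i \<in> I \<Longrightarrow> t \<in> R \<Longrightarrow> t \<noteq> g i \<Longrightarrow> P t \<Longrightarrow> P (c i t)"
  shows "P t"
proof -
  obtain u i where t: "t = cj u (g i)" "u \<in> L" "i \<in> I" using assms(1) by (auto simp: reflections_eq)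
  show ?thesis
    using t(2) unfolding t(1)
  proof (induction u)
    case (Cons k u)
    show ?case
    proof (cases "cj u (g i) = g k")
      case True
      then show ?thesis using Cons gen by simp
    next
      case False
      then show ?thesis using Cons conj[of k "cj u (g i)"] t by auto
    qed
  qed (use t gen in auto)
qed

lemma even_length_cong: "cox_eq I m u v \<Longrightarrow> even (length u) = even (length v)"
proof (induction rule: cox_eq.induct)
  case (rel i j)
  have "length (concat (replicate n [i, j])) = 2 * n" for n by (induction n) auto
  then show ?case by simp
qed auto

text \<open>All defining words have even length, so length parity is an invariant of the group
  element, and a conjugate of a letter is odd. Later this separates reflections from rotations in a
  rank two parabolic subgroup.\<close>

lemma reflection_odd:
  assumes "cl x \<in> R" "x \<in> L"
  shows "odd (length x)"
proof -
  obtain u i where "u \<in> L" "i \<in> I" "cl x = cl (u @ [i] @ rev u)"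
    using assms by (auto simp: reflections_eq g_cl cj_cl)
  then have "cox_eq I m x (u @ [i] @ rev u)" using assms by (simp add: cl_eq)
  from even_length_cong[OF this] show ?thesis by simp
qed

subsection \<open>A linear representation\<close>

text \<open>The dual of the geometric representation, with the integral form
  \<open>2, 0, -1, -2\<close> according to \<open>i = j\<close>, \<open>m i j = 2, 3, 0\<close>.\<close>

definition act_gen :: "'i \<Rightarrow> ('i \<Rightarrow> int) \<Rightarrow> 'i \<Rightarrow> int" where
  "act_gen i f k = f k + (if i = k then - 2 else if m i k = 3 then 1 else if m i k = 0 then 2 else 0) * f i"

definition act_word :: "'i list \<Rightarrow> ('i \<Rightarrow> int) \<Rightarrow> 'i \<Rightarrow> int" where
  "act_word u f = foldr act_gen u f"

lemma act_word_simps [simp]: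
  "act_word [] f = f" "act_word (i # u) f = act_gen i (act_word u f)" "act_word (u @ v) f = act_word u (act_word v f)"
  by (simp_all add: act_word_def)

lemma act_word_cong: "cox_eq I m u v \<Longrightarrow> act_word u f = act_word v f"
proof (induction arbitrary: f rule: cox_eq.induct)
  case (rel i j)
  note ij = m_sym[OF rel]
  show ?case
  proof (cases "i = j")
    case True
    then show ?thesis using rel by (auto simp: m_one act_gen_def fun_eq_iff)
  next
    case False
    from rel False show ?thesis
    proof (cases rule: m_cases)
      case 2
      then show ?thesis using False ij by (auto simp: act_gen_def fun_eq_iff numeral_eq_Suc)
    next
      case 3
      then have "m j i = 3" "replicate (m i j) [i, j] = [[i, j], [i, j], [i, j]]"
        using ij by (simp_all add: eval_nat_numeral)
      then show ?thesis using False 3 by (simp add: act_gen_def fun_eq_iff)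
    qed simp
  qed
qed auto

lemma g_eq_iff: "i \<in> I \<Longrightarrow> j \<in> I \<Longrightarrow> g i = g j \<longleftrightarrow> i = j"
proof -
  assume ij: "i \<in> I" "j \<in> I"
  have "i = j" if "cox_eq I m [i] [j]"
    using act_word_cong[OF that, of "\<lambda>k. if k = i then 1 else 0"]
    by (auto simp: act_gen_def dest!: fun_cong[of _ _ i] split: if_splits)
  then show ?thesis using ij cl_eq[of "[i]" "[j]"] by (auto simp: g_cl)
qed

text \<open>On the coordinates i and j the product acts unipotently: their sum stays 1, while
  coordinate i drops by 2 with every factor, so no positive power returns to the start.\<close>

lemma infinite_order:
  assumes "i \<in> I" "j \<in> I" "i \<noteq> j" "m i j = 0" "cl (concat (replicate n [i, j])) = cl []"
  shows "n = 0"
proof -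
  define f :: "'i \<Rightarrow> int" where "f = (\<lambda>k. if k = i then 1 else 0)"
  have "act_word (concat (replicate n [i, j])) f i = 1 - 2 * int n \<and>
        act_word (concat (replicate n [i, j])) f j = 2 * int n" for n
  proof (induction n)
    case (Suc n)
    then show ?case using assms m_sym[of i j] by (simp add: act_gen_def)
  qed (use assms in \<open>auto simp: f_def\<close>)
  moreover have "act_word (concat (replicate n [i, j])) f = f"
    using assms act_word_cong[of "concat (replicate n [i, j])" "[]"] by (simp add: cl_eq)
  ultimately have "f i = 1 - 2 * int n" by metis
  then show ?thesis by (simp add: f_def)
qed

lemma pow_word: "u \<in> L \<Longrightarrow> cl u [^]\<^bsub>W\<^esub> (n::nat) = cl (concat (replicate n u))"
proof (induction n)
  case (Suc n)
  have "concat (replicate n u) @ u = u @ concat (replicate n u)"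
    by (induction n) auto
  then show ?case using Suc by (simp add: mult_W)
qed (simp add: one_W)

lemma c_comm: "i \<in> I \<Longrightarrow> j \<in> I \<Longrightarrow> m i j = 2 \<Longrightarrow> c i (g j) = g j"
proof -
  assume *: "i \<in> I" "j \<in> I" "m i j = 2"
  then have "cl [i, j, i, j] = cl []" using cl_rel[of i j] by (simp add: numeral_eq_Suc)
  then have "cl ([i, j, i, j] @ [j]) = cl [j]" using cl_cong[of "[i, j, i, j]" "[]" "[]" "[j]"] * by simp
  moreover have "cl ([i, j, i] @ [j, j] @ []) = cl [i, j, i]"
    using cl_cong[of "[j, j]" "[]" "[i, j, i]" "[]"] * cl_square[of j] by simp
  ultimately have "cl [i, j, i] = cl [j]" by simp
  then show ?thesis using * c_cl[of i "[j]"] by (simp add: g_cl)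
qed

lemma cl_braid: "i \<in> I \<Longrightarrow> j \<in> I \<Longrightarrow> m i j = 3 \<Longrightarrow> cl [i, j, i] = cl [j, i, j]"
proof -
  assume *: "i \<in> I" "j \<in> I" "m i j = 3"
  then have "cl [i, j, i, j, i, j] = cl []" using cl_rel[of i j] by (simp add: numeral_eq_Suc)
  then have "cl ([i, j, i, j, i, j] @ [j, i, j]) = cl [j, i, j]"
    using cl_cong[of "[i, j, i, j, i, j]" "[]" "[]" "[j, i, j]"] * by simp
  moreover have "cl ([i, j, i] @ ([j, i, j] @ rev [j, i, j]) @ []) = cl [i, j, i]"
    using cl_cong[of "[j, i, j] @ rev [j, i, j]" "[]" "[i, j, i]" "[]"] * cl_rev[of "[j, i, j]"] by simp
  ultimately show ?thesis by simp
qed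

lemma c_braid: "i \<in> I \<Longrightarrow> j \<in> I \<Longrightarrow> m i j = 3 \<Longrightarrow> c i (g j) = c j (g i)"
  using cl_braid[of i j] by (simp add: g_cl c_cl)

lemma c_c_braid: "i \<in> I \<Longrightarrow> j \<in> I \<Longrightarrow> m i j = 3 \<Longrightarrow> c i (c j (g i)) = g j"
  using c_braid[of i j] by (metis c_c g_closed)

lemma c_braid_neq:
  assumes "i \<in> I" "j \<in> I" "m i j = 3" "i \<noteq> j"
  shows "c i (g j) \<noteq> g i" "c i (g j) \<noteq> g j"
proof -
  have *: "c i (g j) \<noteq> g i" if "i \<in> I" "j \<in> I" "i \<noteq> j" for i j
    using c_inj[of i "g j" "g i"] that by (simp add: g_eq_iff)
  show "c i (g j) \<noteq> g i" using * assms by blast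
  show "c i (g j) \<noteq> g j" using *[of j i] c_braid[of i j] assms by auto
qed

subsection \<open>Inversions and the length function\<close>

text \<open>\<open>nu u r\<close> expresses that \<open>u\<close> maps the positive root of \<open>r\<close> to a negative one.\<close>

primrec nu :: "'i list \<Rightarrow> 'i list set \<Rightarrow> bool" where
  "nu [] r = False"
| "nu (i # u) r = (nu u r \<noteq> (cj u r = g i))"

lemma nu_append: "nu (u @ v) r = (nu v r \<noteq> nu u (cj v r))"
  by (induction u) auto

text \<open>By \<open>nu_append\<close>, \<open>nu\<close> is a cocycle modulo 2, so the defining
  words decide. While r travels through the word of length 2m for a pair with finite bond m, each
  reflection of the dihedral group meets a matching letter exactly twice or not at all, and the
  parities cancel.\<close>

lemma nu_cong_aux: "cox_eq I m u v \<Longrightarrow> r \<in> carrier W \<Longrightarrow> nu u r = nu v r"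
proof (induction arbitrary: r rule: cox_eq.induct)
  case (rel i j)
  have c_eq: "c k (cj u r) = s \<longleftrightarrow> cj u r = c k s" if "k \<in> I" "u \<in> L" "s \<in> carrier W" for k u s
    using cj_eq_iff[of "[k]" "cj u r" s] that rel by simp
  note c_eq = c_eq[of _ "[]", simplified] c_eq[of _ "[_]", simplified] c_eq[of _ "[_,_]", simplified]
    c_eq[of _ "[_,_,_]", simplified] c_eq[of _ "[_,_,_,_]", simplified]
  show ?case
  proof (cases "i = j")
    case True
    then show ?thesis using rel c_eq(1)[of i "g i"] by (simp add: m_one)
  next
    case False
    from rel(1,2) False show ?thesis
    proof (cases rule: m_cases)
      case 2
      have "c i (g j) = g j" "c j (g i) = g i" using 2 rel c_comm m_sym by auto
      then show ?thesis using 2 rel by (simp add: numeral_eq_Suc c_eq) argo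
    next
      case 3
      obtain t where "c i (g j) = t" "c j (g i) = t" "c i t = g j" "c j t = g i" "t \<in> carrier W"
        using c_closed[of j "g i"] c_braid[OF rel(1,2) 3] c_c_braid[OF rel(1,2) 3] c_c[of j "g i"] rel by auto
      then show ?thesis using 3 rel by (simp add: eval_nat_numeral c_eq) argo
    qed simp
  qed
next
  case (append u u' v v')
  then have "u \<in> L" "u' \<in> L" "v \<in> L" "v' \<in> L" using cox_eq_L by blast+
  moreover from this have "cj v r = cj v' r"
    using append by (intro cj_cong) (auto simp: cl_eq)
  ultimately show ?case using append by (simp add: nu_append)
qed auto

lemma nu_cong: "cl u = cl v \<Longrightarrow> u \<in> L \<Longrightarrow> v \<in> L \<Longrightarrow> r \<in> carrier W \<Longrightarrow> nu u r = nu v r"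
  using nu_cong_aux by (simp add: cl_eq)

abbreviation "len \<equiv> cox_length"

lemma len_le: "u \<in> L \<Longrightarrow> len (cl u) \<le> length u"
  unfolding cox_length_def by (rule Least_le, rule bexI[of _ u]) (simp_all add: mem_cl L_def cox_eq.refl)

lemma reduced_word:
  assumes "u \<in> L"
  obtains v where "v \<in> L" "cl v = cl u" "length v = len (cl u)"
proof -
  have "\<exists>v\<in>cl u. length v = length u" using assms by (intro bexI[of _ u]) (simp_all add: mem_cl L_def cox_eq.refl)
  then have "\<exists>v\<in>cl u. length v = len (cl u)" unfolding cox_length_def by (rule LeastI)
  then obtain v where "v \<in> cl u" "length v = len (cl u)" by blast
  moreover from this have "v \<in> L" using cox_eq_L by (auto simp: mem_cl)
  ultimately show ?thesis
    using that[of v] cl_eq[of v u] assms cox_eq.sym[of I m u v] by (simp add: mem_cl)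
qed

text \<open>The strong exchange property. Some letter i of u is preceded on its right by a suffix
  that conjugates r into \<open>g i\<close>; multiplying by r then deletes this letter.\<close>

lemma exchange:
  assumes "u \<in> L" "r \<in> carrier W" "nu u r"
  shows "\<exists>v\<in>L. length v < length u \<and> cl u \<otimes>\<^bsub>W\<^esub> r = cl v"
  using assms(1,3)
proof (induction u)
  case (Cons i u)
  then have iu: "i \<in> I" "u \<in> L" by auto
  have eq: "cl (i # u) = g i \<otimes>\<^bsub>W\<^esub> cl u" using iu by (simp add: g_cl mult_W)
  show ?case
  proof (cases "nu u r")
    case True
    with Cons obtain v where v: "v \<in> L" "length v < length u" "cl u \<otimes>\<^bsub>W\<^esub> r = cl v" by auto
    have "cl (i # u) \<otimes>\<^bsub>W\<^esub> r = cl (i # v)"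
      using v iu assms(2) by (simp add: eq W.m_assoc) (simp add: g_cl mult_W)
    then show ?thesis using v iu by (intro bexI[of _ "i # v"]) auto
  next
    case False
    then have "cl u \<otimes>\<^bsub>W\<^esub> r \<otimes>\<^bsub>W\<^esub> inv\<^bsub>W\<^esub> cl u = g i" using Cons.prems iu assms by (simp add: cj_eq)
    then have "cl u \<otimes>\<^bsub>W\<^esub> r = g i \<otimes>\<^bsub>W\<^esub> cl u"
      using iu assms W.inv_solve_right'[of "g i" "cl u \<otimes>\<^bsub>W\<^esub> r" "cl u"] by simp
    then have "cl (i # u) \<otimes>\<^bsub>W\<^esub> r = g i \<otimes>\<^bsub>W\<^esub> (g i \<otimes>\<^bsub>W\<^esub> cl u)"
      using iu assms(2) by (simp add: eq W.m_assoc)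
    also have "\<dots> = cl u"
      using iu cl_cong[of "[i, i]" "[]" "[]" u] cl_square[of i] by (simp add: g_cl mult_W)
    finally show ?thesis using iu by (intro bexI[of _ u]) auto
  qed
qed simp

lemma reflection_square: "r \<in> R \<Longrightarrow> r \<otimes>\<^bsub>W\<^esub> r = \<one>\<^bsub>W\<^esub>"
proof -
  assume "r \<in> R"
  then obtain u i where r: "u \<in> L" "i \<in> I" "r = cl (u @ [i] @ rev u)"
    by (auto simp: reflections_eq g_cl cj_cl)
  then show ?thesis using cl_rev[of "u @ [i] @ rev u"] by (simp add: mult_W one_W)
qed

lemma len_less:
  assumes "u \<in> L" "r \<in> carrier W" "nu u r"
  shows "len (cl u \<otimes>\<^bsub>W\<^esub> r) < len (cl u)"
proof -
  obtain v where v: "v \<in> L" "cl v = cl u" "length v = len (cl u)" using reduced_word assms by blast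
  then have "nu v r" using assms nu_cong by blast
  with exchange[of v r] assms v obtain v' where "v' \<in> L" "length v' < length v" "cl u \<otimes>\<^bsub>W\<^esub> r = cl v'"
    by auto
  then show ?thesis using len_le[of v'] v by simp
qed

text \<open>A reflection inverts its own root. In the palindrome the outer halves contribute as much
  as in \<open>y @ rev y\<close>, that is nothing, and only the middle letter counts.\<close>

lemma nu_self:
  assumes "r = cj y (g i)" "y \<in> L" "i \<in> I"
  shows "nu (y @ [i] @ rev y) r"
proof -
  have "nu (y @ rev y) r = nu [] r"
    using assms by (intro nu_cong) (auto simp: cl_rev)
  moreover have "cj (rev y) r = g i" using assms by simp
  ultimately show ?thesis using assms by (auto simp: nu_append)
qed

text \<open>If u does not invert r, then u r does, because r inverts itself; \<open>len_less\<close>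
  applied to u r gives the inequality.\<close>

lemma len_greater:
  assumes "u \<in> L" "r \<in> R" "\<not> nu u r"
  shows "len (cl u) < len (cl u \<otimes>\<^bsub>W\<^esub> r)"
proof -
  obtain y i where r: "r = cj y (g i)" "y \<in> L" "i \<in> I" using assms by (auto simp: reflections_eq)
  define x where "x = y @ [i] @ rev y"
  have x: "x \<in> L" "r = cl x" using r by (auto simp: x_def g_cl cj_cl)
  have rc: "r \<in> carrier W" using assms reflections_closed by blast
  have "cj x r = r \<otimes>\<^bsub>W\<^esub> r \<otimes>\<^bsub>W\<^esub> inv\<^bsub>W\<^esub> r" using x cj_eq[of x r] by simp
  then have "cj x r = r" using rc by (simp add: W.m_assoc)
  then have "nu (u @ x) r" using assms nu_self[OF r] by (simp add: nu_append x_def)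
  then have "len (cl (u @ x) \<otimes>\<^bsub>W\<^esub> r) < len (cl (u @ x))"
    using assms x rc by (intro len_less) auto
  moreover have "cl (u @ x) = cl u \<otimes>\<^bsub>W\<^esub> r" using assms x by (simp add: mult_W)
  moreover have "cl u \<otimes>\<^bsub>W\<^esub> r \<otimes>\<^bsub>W\<^esub> r = cl u"
    using assms rc reflection_square[of r] by (simp add: W.m_assoc)
  ultimately show ?thesis by simp
qed

lemma len_gen:
  assumes "u \<in> L" "i \<in> I"
  shows "len (cl u \<otimes>\<^bsub>W\<^esub> g i) = len (cl u) + 1 \<longleftrightarrow> \<not> nu u (g i)"
proof -
  obtain v where v: "v \<in> L" "cl v = cl u" "length v = len (cl u)" using reduced_word assms by blast
  have "len (cl (v @ [i])) \<le> len (cl u) + 1" using len_le[of "v @ [i]"] v assms by auto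
  moreover have "cl (v @ [i]) = cl u \<otimes>\<^bsub>W\<^esub> g i"
    using mult_W[of v "[i]"] v assms by (simp add: g_cl)
  ultimately show ?thesis
    using len_less[of u "g i"] len_greater[of u "g i"] assms by fastforce
qed

lemma compatible_iff:
  "compatible I m s s' \<longleftrightarrow> s \<noteq> s' \<and>
    (\<exists>w\<in>L. \<exists>a\<in>I. \<exists>b\<in>I. s = cj w (g a) \<and> s' = cj w (g b) \<and> \<not> nu w (g a) \<and> \<not> nu w (g b))"
proof -
  have "cl w \<otimes>\<^bsub>W\<^esub> g a \<otimes>\<^bsub>W\<^esub> inv\<^bsub>W\<^esub> cl w = cj w (g a)" "cj w (g a) \<in> R"
    "len (cl w \<otimes>\<^bsub>W\<^esub> g a) = len (cl w) + 1 \<longleftrightarrow> \<not> nu w (g a)"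
    if "w \<in> L" "a \<in> I" for w a
    using that len_gen[of w a] by (simp_all add: cj_eq[symmetric])
  then show ?thesis unfolding compatible_def carrier_W bex_simps(7) by (smt (verit) Bex_def)
qed

lemma compatible_sym: "compatible I m s s' \<Longrightarrow> compatible I m s' s"
  unfolding compatible_iff by blast

lemma compatible_reflections: "compatible I m s s' \<Longrightarrow> s \<in> R \<and> s' \<in> R \<and> s \<noteq> s'"
  unfolding compatible_def by blast

text \<open>Prefixing i to the word w changes the sign of precisely the reflection that w carries to
  \<open>g i\<close>, and neither s nor s' is \<open>g i\<close>.\<close>

lemma compatible_conj:
  assumes "compatible I m s s'" "i \<in> I" "s \<noteq> g i" "s' \<noteq> g i"
  shows "compatible I m (c i s) (c i s')"
proof -
  obtain w a b where w: "s = cj w (g a)" "s' = cj w (g b)" "\<not> nu w (g a)" "\<not> nu w (g b)"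
    "w \<in> L" "a \<in> I" "b \<in> I" "s \<noteq> s'"
    using assms unfolding compatible_iff by blast
  have "c i s \<noteq> c i s'" using w assms by (subst c_inj) auto
  then show ?thesis
    unfolding compatible_iff
    using w assms by (intro conjI bexI[of _ "i # w"] bexI[of _ a] bexI[of _ b]) auto
qed

subsection \<open>Parabolic subgroups of rank two\<close>

text \<open>Passing to an element of minimal length in the coset \<open>u W\<^bsub>{i,k}\<^esub>\<close> reduces
  questions about inversions in \<open>W\<^bsub>{i,k}\<^esub>\<close> to words in \<open>i\<close> and \<open>k\<close>.\<close>

lemma coset_inversions:
  assumes "u \<in> L" "i \<in> I" "k \<in> I"
  shows "\<exists>z\<in>lists {i, k}. \<forall>x\<in>lists {i, k}. cl x \<in> R \<longrightarrow> nu u (cl x) = nu z (cl x)"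
proof -
  note J = L_subset[OF assms(2,3)]
  define y where "y = arg_min (\<lambda>y. len (cl (u @ y))) (\<lambda>y. y \<in> lists {i, k})"
  have "[] \<in> lists {i, k}" by simp
  note min = arg_min_nat_lemma[where P = "\<lambda>y. y \<in> lists {i, k}" and m = "\<lambda>y. len (cl (u @ y))", OF this,
      folded y_def]
  have y: "y \<in> lists {i, k}" "y \<in> L" using min J by blast+
  have "nu u (cl x) = nu (rev y) (cl x)" if x: "x \<in> lists {i, k}" "cl x \<in> R" for x
  proof -
    have xL: "x \<in> L" using x J by blast
    have "cl (u @ (y @ rev y) @ []) = cl (u @ [] @ [])"
      using y assms cl_rev[of y] by (intro cl_cong) auto
    then have "nu u (cl x) = nu ((u @ y) @ rev y) (cl x)"
      using assms xL y by (intro nu_cong) auto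
    moreover have "\<not> nu (u @ y) (cj (rev y) (cl x))"
    proof
      assume "nu (u @ y) (cj (rev y) (cl x))"
      then have "len (cl (u @ y) \<otimes>\<^bsub>W\<^esub> cj (rev y) (cl x)) < len (cl (u @ y))"
        using assms y xL by (intro len_less) auto
      moreover have "cl (u @ y) \<otimes>\<^bsub>W\<^esub> cj (rev y) (cl x) = cl (u @ y @ rev y @ x @ y)"
        using assms y xL by (simp add: cj_cl mult_W)
      moreover have "y @ rev y @ x @ y \<in> lists {i, k}" using x y by auto
      ultimately show False using min by (metis leD)
    qed
    ultimately show ?thesis using nu_append[of "u @ y" "rev y" "cl x"] by argo
  qed
  moreover have "rev y \<in> lists {i, k}" using y(1) unfolding in_lists_conv_set by simp
  ultimately show ?thesis by blast
qed

text \<open>The root of \<open>c a (g b)\<close> is the sum of the simple roots of a and b, so it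
  has their sign whenever both have the same one. After restriction to a word in a and b this is a
  parity invariant, kept when a letter is appended on the right.\<close>

lemma braid_noninversion:
  assumes "w \<in> L" "a \<in> I" "b \<in> I" "m a b = 3" "a \<noteq> b" "\<not> nu w (g a)" "\<not> nu w (g b)"
  shows "\<not> nu w (c a (g b))"
proof -
  obtain z where z: "z \<in> lists {a, b}" and
    eq: "\<And>x. x \<in> lists {a, b} \<Longrightarrow> cl x \<in> R \<Longrightarrow> nu w (cl x) = nu z (cl x)"
    using coset_inversions[OF assms(1-3)] by blast
  have t: "c a (g b) = cl [a, b, a]" using assms by (simp add: g_cl c_cl)
  have "cl [a, b, a] \<in> R" using t assms c_reflection[of a "g b"] by simp
  then have e: "nu w (g a) = nu z (g a)" "nu w (g b) = nu z (g b)" "nu w (c a (g b)) = nu z (c a (g b))"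
    using eq[of "[a]"] eq[of "[b]"] eq[of "[a, b, a]"] g_reflection[OF assms(2)] g_reflection[OF assms(3)]
    unfolding t by (auto simp: g_cl[symmetric])
  note br = c_braid[OF assms(2-4)] c_c_braid[OF assms(2-4)]
  have ne: "c a (g b) \<noteq> g a" "c a (g b) \<noteq> g b" "g a \<noteq> g b" "g b \<noteq> g a"
    using c_braid_neq[of a b] assms by (auto simp: g_eq_iff)
  have cc: "c a (c a (g b)) = g b" "c b (c a (g b)) = g a"
    using br c_c[of a "g b"] c_c[of b "g a"] assms by auto
  have "nu z (g a) = nu z (g b) \<longrightarrow> nu z (c a (g b)) = nu z (g a)"
    using z
  proof (induction z rule: rev_induct)
    case (snoc d z)
    then consider "d = a" | "d = b" by auto
    then show ?case
      using snoc assms ne br cc by cases (auto simp: nu_append)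
  qed simp
  then show ?thesis using e assms by simp
qed

lemma cl_append_of_cj:
  assumes "u \<in> L" "t \<in> carrier W" "j \<in> I" "x \<in> L" "t = cl x" "cj u t = g j"
  shows "cl (u @ x) = cl (j # u)"
proof -
  have "cl u \<otimes>\<^bsub>W\<^esub> t \<otimes>\<^bsub>W\<^esub> inv\<^bsub>W\<^esub> cl u = g j" using assms by (simp add: cj_eq)
  then have "cl u \<otimes>\<^bsub>W\<^esub> t = g j \<otimes>\<^bsub>W\<^esub> cl u"
    using assms W.inv_solve_right'[of "g j" "cl u \<otimes>\<^bsub>W\<^esub> t" "cl u"] by simp
  then show ?thesis using assms by (simp add: mult_W g_cl)
qed

text \<open>A simple root is not a sum of two positive roots. Without roots: t = aba would satisfy w
  t = s_j w. The left side inverts \<open>g a\<close>, since t takes the root of a to minus that of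
  b; the right side does not, since s_j changes the sign of a single positive root, which is not the
  image of the root of a.\<close>

lemma braid_not_simple:
  assumes "w \<in> L" "a \<in> I" "b \<in> I" "j \<in> I" "m a b = 3" "a \<noteq> b" "\<not> nu w (g a)" "\<not> nu w (g b)"
  shows "cj w (c a (g b)) \<noteq> g j"
proof
  assume *: "cj w (c a (g b)) = g j"
  have t: "c a (g b) = cl [a, b, a]" using assms by (simp add: g_cl c_cl)
  have "cl (w @ [a, b, a]) = cl (j # w)"
    using assms * t by (intro cl_append_of_cj[where t = "c a (g b)"]) auto
  then have "nu (w @ [a, b, a]) (g a) = nu (j # w) (g a)"
    using assms by (intro nu_cong) auto
  moreover have "cj w (g a) \<noteq> g j"
    using * cj_inj[of w "g a" "c a (g b)"] assms c_braid_neq[of a b] by auto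
  ultimately show False
    using assms c_braid[of a b] c_c_braid[of a b] c_braid_neq[of a b]
    by (auto simp: nu_append g_eq_iff)
qed

text \<open>From u s_i = s_j u it follows that u also inverts \<open>c i (g k)\<close>. In the
  infinite dihedral group generated by i and k the reflections lie on a line with
  \<open>g k\<close>, \<open>g i\<close>, \<open>c i (g k)\<close> adjacent in this order, and an
  inversion set cannot contain the outer two without the middle one.\<close>

lemma infinite_not_simple:
  assumes "u \<in> L" "i \<in> I" "k \<in> I" "j \<in> I" "i \<noteq> k" "m i k = 0"
    "cj u (g i) = g j" "nu u (g k)" "\<not> nu u (g i)"
  shows False
proof -
  have "cl (u @ [i]) = cl (j # u)"
    using assms by (intro cl_append_of_cj[where t = "g i"]) (auto simp: g_cl)
  then have "nu (u @ [i]) (g k) = nu (j # u) (g k)" using assms by (intro nu_cong) auto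
  moreover have "cj u (g k) \<noteq> g j" using assms cj_inj[of u "g k" "g i"] by (auto simp: g_eq_iff)
  ultimately have inv: "nu u (c i (g k))" using assms by (auto simp: nu_append g_eq_iff)
  define \<rho> where "\<rho> = cl [i, k]"
  have \<rho> [simp]: "\<rho> \<in> carrier W" using assms by (auto simp: \<rho>_def)
  have gi [simp]: "g i \<in> carrier W" "g k \<in> carrier W" using assms by auto
  have gg: "g i \<otimes>\<^bsub>W\<^esub> g i = \<one>\<^bsub>W\<^esub>" using reflection_square[of "g i"] assms by simp
  have gg': "g i \<otimes>\<^bsub>W\<^esub> (g i \<otimes>\<^bsub>W\<^esub> x) = x" if "x \<in> carrier W" for x
    using that gg by (simp flip: W.m_assoc)
  have \<rho>_eq: "\<rho> = g i \<otimes>\<^bsub>W\<^esub> g k" using assms by (simp add: \<rho>_def g_cl mult_W)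
  have gk: "g k = g i \<otimes>\<^bsub>W\<^esub> \<rho>" using gg' by (simp add: \<rho>_eq)
  have conj1: "g i \<otimes>\<^bsub>W\<^esub> \<rho> \<otimes>\<^bsub>W\<^esub> g i = inv\<^bsub>W\<^esub> \<rho>"
    using assms inv_W[of "[i, k]"] by (simp add: \<rho>_def) (simp add: gk[symmetric] \<rho>_def[symmetric], simp add: g_cl mult_W)
  have conj: "g i \<otimes>\<^bsub>W\<^esub> \<rho> [^]\<^bsub>W\<^esub> p \<otimes>\<^bsub>W\<^esub> g i = \<rho> [^]\<^bsub>W\<^esub> (- p)" for p :: int
  proof -
    have "(\<lambda>x. g i \<otimes>\<^bsub>W\<^esub> x \<otimes>\<^bsub>W\<^esub> g i) \<in> hom W W"
      by (rule homI) (auto simp: W.m_assoc gg')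
    then have "g i \<otimes>\<^bsub>W\<^esub> \<rho> [^]\<^bsub>W\<^esub> p \<otimes>\<^bsub>W\<^esub> g i = (g i \<otimes>\<^bsub>W\<^esub> \<rho> \<otimes>\<^bsub>W\<^esub> g i) [^]\<^bsub>W\<^esub> p"
      using group_W
        hom_int_pow[of "\<lambda>x. g i \<otimes>\<^bsub>W\<^esub> x \<otimes>\<^bsub>W\<^esub> g i" W W \<rho> p] by auto
    then show ?thesis by (simp add: conj1 W.int_pow_inv W.int_pow_neg)
  qed
  \<comment> \<open>Coordinates on the line of reflections: r(-1), r(0), r(1) are
    \<open>g k\<close>, \<open>g i\<close>, \<open>c i (g k)\<close>, and conjugation by i or k is
    the point reflection p to -p or p to -p-2.\<close>
  define r where "r p = \<rho> [^]\<^bsub>W\<^esub> p \<otimes>\<^bsub>W\<^esub> g i" for p :: int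
  have conj': "g i \<otimes>\<^bsub>W\<^esub> \<rho> [^]\<^bsub>W\<^esub> p = r (- p)" for p :: int
    using conj[of p] W.m_assoc[of "g i \<otimes>\<^bsub>W\<^esub> \<rho> [^]\<^bsub>W\<^esub> p" "g i" "g i"] by (simp add: r_def gg)
  have r_closed: "r p \<in> carrier W" for p by (simp add: r_def)
  have ci: "c i (r p) = r (- p)" for p
    using conj'[of p] by (simp add: c_def r_def W.m_assoc gg)
  have ck: "c k (r p) = r (- p - 2)" for p
  proof -
    have "c k (r p) = g i \<otimes>\<^bsub>W\<^esub> (\<rho> \<otimes>\<^bsub>W\<^esub> \<rho> [^]\<^bsub>W\<^esub> p \<otimes>\<^bsub>W\<^esub> \<rho>)"
      by (simp add: c_def r_def gk W.m_assoc gg')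
    also have "\<rho> \<otimes>\<^bsub>W\<^esub> \<rho> [^]\<^bsub>W\<^esub> p \<otimes>\<^bsub>W\<^esub> \<rho> = \<rho> [^]\<^bsub>W\<^esub> (p + 2)"
      using W.int_pow_mult[of \<rho> "1 + p" 1] W.int_pow_mult[of \<rho> 1 p] by (simp add: add.commute)
    finally show ?thesis using conj'[of "p + 2"] by simp
  qed
  have fin: "p = 0" if "\<rho> [^]\<^bsub>W\<^esub> p = \<one>\<^bsub>W\<^esub>" for p :: int
  proof -
    have "\<rho> [^]\<^bsub>W\<^esub> nat \<bar>p\<bar> = \<one>\<^bsub>W\<^esub>"
    proof (cases p rule: int_cases2)
      case (nonneg n)
      then have "nat \<bar>p\<bar> = n" by simp
      then show ?thesis using that unfolding nonneg int_pow_int by simp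
    next
      case (nonpos n)
      then have n: "nat \<bar>p\<bar> = n" by simp
      have "inv\<^bsub>W\<^esub> (\<rho> [^]\<^bsub>W\<^esub> n) = \<one>\<^bsub>W\<^esub>" using that unfolding nonpos W.int_pow_neg_int[OF \<rho>] .
      then have "\<rho> [^]\<^bsub>W\<^esub> n = \<one>\<^bsub>W\<^esub>" by (subst (asm) W.inv_eq_1_iff) simp_all
      then show ?thesis unfolding n .
    qed
    then have "cl (concat (replicate (nat \<bar>p\<bar>) [i, k])) = cl []"
      using pow_word[of "[i, k]" "nat \<bar>p\<bar>"] assms(2,3) by (simp only: \<rho>_def one_W L_simps)
    then have "nat \<bar>p\<bar> = 0" by (rule infinite_order[OF assms(2,3,5,6)])
    then show ?thesis by (cases "0 \<le> p") simp_all
  qed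
  have inj: "p = q" if "r p = r q" for p q
  proof -
    have "\<rho> [^]\<^bsub>W\<^esub> p = \<rho> [^]\<^bsub>W\<^esub> q" using that by (simp add: r_def)
    then have "\<rho> [^]\<^bsub>W\<^esub> (p - q) = \<one>\<^bsub>W\<^esub>" by (simp add: W.int_pow_diff)
    then show ?thesis using fin by fastforce
  qed
  have r0: "r 0 = g i" by (simp add: r_def)
  have r1: "r (- 1) = g k" using conj'[of 1] gk by simp
  have r2: "r 1 = c i (g k)" using ci[of "-1"] r1 by simp
  obtain z where z: "z \<in> lists {i, k}" and
    eq: "\<And>x. x \<in> lists {i, k} \<Longrightarrow> cl x \<in> R \<Longrightarrow> nu u (cl x) = nu z (cl x)"
    using coset_inversions[OF assms(1-3)] by blast
  \<comment> \<open>Inversions form a run of consecutive p ending at the gap between -1 and 0, to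
    the right of it for positive n and to the left for negative n. Appending i mirrors the run by p
    to -p and toggles 0, so n becomes 1 - n; appending k mirrors by p to -p-2 and toggles -1, so n
    becomes -1 - n.\<close>
  have "\<exists>n::int. \<forall>p. nu z (r p) \<longleftrightarrow> 0 \<le> p \<and> p < n \<or> n \<le> p \<and> p < 0"
    using z
  proof (induction z rule: rev_induct)
    case Nil
    show ?case by (intro exI[of _ 0]) auto
  next
    case (snoc d z)
    then obtain n where n: "\<And>p. nu z (r p) \<longleftrightarrow> 0 \<le> p \<and> p < n \<or> n \<le> p \<and> p < 0" by auto
    have e: "r p = g i \<longleftrightarrow> p = 0" "r p = g k \<longleftrightarrow> p = - 1" for p
      using inj[of p 0] inj[of p "- 1"] r0 r1 by auto
    consider "d = i" | "d = k" using snoc by auto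
    then show ?case
    proof cases
      case 1
      then show ?thesis
        by (intro exI[of _ "1 - n"]) (auto simp: nu_append n e ci)
    next
      case 2
      then show ?thesis
        by (intro exI[of _ "- 1 - n"]) (auto simp: nu_append n e ck)
    qed
  qed
  then obtain n where n: "\<And>p. nu z (r p) \<longleftrightarrow> 0 \<le> p \<and> p < n \<or> n \<le> p \<and> p < 0" by blast
  have x: "g i = cl [i]" "g k = cl [k]" "c i (g k) = cl [i, k, i]" using assms by (auto simp: g_cl c_cl)
  have "nu z (g i) = nu u (g i)" "nu z (g k) = nu u (g k)" "nu z (c i (g k)) = nu u (c i (g k))"
    using eq[of "[i]"] eq[of "[k]"] eq[of "[i, k, i]"] assms x g_reflection[of i] g_reflection[of k]
      c_reflection[of i "g k"] by auto
  then show False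
    using n[of 0] n[of "-1"] n[of 1] r0 r1 r2 assms inv by auto
qed

section \<open>The elements \<open>D\<^sub>s\<close> of \<open>Hhat(W)\<close>\<close>

abbreviation "G \<equiv> gens I"

lemma gens_simps [simp]: "SGen i \<in> G \<longleftrightarrow> i \<in> I" "DGen i \<in> G \<longleftrightarrow> i \<in> I"
  by (auto simp: gens_def)

lemma map_SGen_closed: "u \<in> L \<Longrightarrow> map SGen u \<in> lists G"
  by (auto simp: L_def)

lemma Hhat_relators_closed: "Hhat_relators I m \<subseteq> carrier (free_ring G)"
proof -
  have "x \<in> I" if "x \<in> set (alternating j i n)" "i \<in> I" "j \<in> I" for x i j n
    using that by (auto simp: alternating_def split: if_splits)
  then show ?thesis
    unfolding Hhat_relators_def
    by (intro Un_least subsetI; elim CollectE exE conjE; hypsubst; intro free_ring_closed)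
      (auto split: if_splits)
qed

sublocale H: presentation G "Hhat_relators I m"
  by unfold_locales (rule Hhat_relators_closed)

section \<open>Congruence of words in Hhat(W)\<close>

definition weq :: "'i gen list \<Rightarrow> 'i gen list \<Rightarrow> bool" where
  "weq u v \<longleftrightarrow> fword u - fword v \<in> H.N"

lemma weq_refl: "weq u u"
  by (simp add: weq_def H.N_zero)

lemma weq_sym: "weq u v \<Longrightarrow> weq v u"
  unfolding weq_def by (rule H.N_sym)

lemma weq_trans [trans]: "weq u v \<Longrightarrow> weq v w \<Longrightarrow> weq u w"
  unfolding weq_def by (rule H.N_trans)

lemma weq_context:
  assumes "weq u v" "x \<in> lists G" "y \<in> lists G"
  shows "weq (x @ u @ y) (x @ v @ y)"
proof -
  have "fword x * (fword u - fword v) * fword y \<in> H.N"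
    using assms by (intro H.N_r H.N_l free_ring_closed) (auto simp: weq_def)
  then show ?thesis by (simp add: weq_def algebra_simps fword_mult)
qed

lemma weq_append:
  assumes "weq u u'" "weq v v'" "u' \<in> lists G" "v \<in> lists G"
  shows "weq (u @ v) (u' @ v')"
  using weq_trans[of "u @ v" "u' @ v" "u' @ v'"] weq_context[OF assms(1), of "[]" v]
    weq_context[OF assms(2), of u' "[]"] assms(3,4) by simp

lemma rel_weq: "fword u - fword v \<in> Hhat_relators I m \<Longrightarrow> weq u v"
  unfolding weq_def by (rule H.N_rel)

lemma weq_square: "i \<in> I \<Longrightarrow> weq [SGen i, SGen i] []"
  by (rule rel_weq) (auto simp: Hhat_relators_def fword_Nil)

lemma weq_cox: "cox_eq I m u v \<Longrightarrow> weq (map SGen u) (map SGen v)"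
proof (induction rule: cox_eq.induct)
  case (rel i j)
  have *: "map SGen (concat (replicate n [i, j])) = concat (replicate n [SGen i, SGen j])" for n
    by (induction n) auto
  show ?case using rel unfolding * by (intro rel_weq) (auto simp: Hhat_relators_def fword_Nil)
next
  case (append u u' v v')
  then have "u' \<in> L" "v \<in> L" using cox_eq_L by blast+
  then show ?case using append weq_append map_SGen_closed by simp
qed (auto intro: weq_refl weq_sym weq_trans)

lemma braid_rel:
  assumes "i \<in> I" "j \<in> I" "i \<noteq> j" "m i j \<noteq> 0"
  shows "weq (DGen i # map SGen (alternating j i (m i j - 1)))
    (map SGen (alternating j i (m i j - 1)) @ [DGen (if even (m i j) then i else j)])"
  by (rule rel_weq) (use assms in \<open>unfold Hhat_relators_def, blast\<close>)

lemma weq_comm: "i \<in> I \<Longrightarrow> j \<in> I \<Longrightarrow> m i j = 2 \<Longrightarrow> i \<noteq> j \<Longrightarrow> weq [DGen i, SGen j] [SGen j, DGen i]"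
  using braid_rel[of i j] by (simp add: alternating_def)

lemma weq_braid: "i \<in> I \<Longrightarrow> j \<in> I \<Longrightarrow> m i j = 3 \<Longrightarrow> i \<noteq> j \<Longrightarrow>
    weq [DGen i, SGen j, SGen i] [SGen j, SGen i, DGen j]"
  using braid_rel[of i j] by (simp add: alternating_def upt_rec)

lemma weq_rev: "u \<in> L \<Longrightarrow> weq (map SGen (u @ rev u)) []"
  using cl_rev[of u] weq_cox[of "u @ rev u" "[]"] by (simp add: cl_eq)

text \<open>The conjugate of D_i by u. It represents \<open>D_t\<close> for
  \<open>t = cj u (g i)\<close> only if u keeps the simple root of i positive; otherwise s_i D_i s_i
  = 1 - s_i - D_i interferes.\<close>

definition dword :: "'i list \<Rightarrow> 'i \<Rightarrow> 'i gen list" where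
  "dword u i = map SGen u @ [DGen i] @ map SGen (rev u)"

lemma dword_closed [simp]: "u \<in> L \<Longrightarrow> i \<in> I \<Longrightarrow> dword u i \<in> lists G"
  by (auto simp: dword_def L_def)

lemma dword_append: "dword (u @ v) i = map SGen u @ dword v i @ map SGen (rev u)"
  by (simp add: dword_def)

lemma dword_cong:
  assumes "cl u = cl v" "u \<in> L" "v \<in> L" "i \<in> I"
  shows "weq (dword u i) (dword v i)"
proof -
  have "cl (rev u) = cl (rev v)" using inv_W[of u] inv_W[of v] assms by simp
  then have "weq (map SGen u) (map SGen v)" "weq (map SGen (rev u)) (map SGen (rev v))"
    using assms cl_eq[of u v] cl_eq[of "rev u" "rev v"] weq_cox by auto
  moreover have "map SGen v \<in> lists G" "map SGen (rev u) \<in> lists G" "[DGen i] \<in> lists G"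
    using map_SGen_closed[of v] map_SGen_closed[of "rev u"] assms by simp_all
  ultimately show ?thesis
    unfolding dword_def by (intro weq_append weq_refl) auto
qed

text \<open>First of the two rank two moves: s_k D_i s_k = D_i. The second, in
  \<open>dword_braid\<close>, is s_i s_k D_i s_k s_i = D_k, where the word s_i s_k carries the
  simple root of i to that of k.\<close>

lemma dword_comm:
  assumes "u \<in> L" "i \<in> I" "k \<in> I" "i \<noteq> k" "m i k = 2"
  shows "weq (dword (u @ [k]) i) (dword u i)"
proof -
  have "weq ([SGen k] @ [DGen i, SGen k] @ []) ([SGen k] @ [SGen k, DGen i] @ [])"
    using weq_comm[of i k] assms by (intro weq_context) auto
  also have "weq \<dots> ([] @ [] @ [DGen i])"
    using weq_context[OF weq_square[of k], of "[]" "[DGen i]"] assms by simp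
  finally have "weq (dword [k] i) [DGen i]" by (simp add: dword_def)
  then show ?thesis
    using weq_context[of "dword [k] i" "[DGen i]" "map SGen u" "map SGen (rev u)"]
      map_SGen_closed[of u] map_SGen_closed[of "rev u"] assms by (simp add: dword_def)
qed

lemma dword_braid:
  assumes "u \<in> L" "i \<in> I" "k \<in> I" "i \<noteq> k" "m i k = 3"
  shows "weq (dword (u @ [i, k]) i) (dword u k)"
proof -
  have "weq ([] @ [SGen i, SGen k, DGen i] @ [SGen k, SGen i]) ([] @ [DGen k, SGen i, SGen k] @ [SGen k, SGen i])"
    using weq_sym[OF weq_braid[of k i]] assms m_sym[of i k] by (intro weq_context) auto
  also have "weq \<dots> ([DGen k] @ [])"
    using weq_context[OF weq_rev[of "[i, k]"], of "[DGen k]" "[]"] assms by simp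
  finally have "weq (dword [i, k] i) [DGen k]" by (simp add: dword_def)
  then show ?thesis
    using weq_context[of "dword [i, k] i" "[DGen k]" "map SGen u" "map SGen (rev u)"]
      map_SGen_closed[of u] map_SGen_closed[of "rev u"] assms by (simp add: dword_def)
qed

text \<open>An element taking one simple root to another is a product of rank two moves; each of
  them is matched by a braid relation of \<open>Hhat(W)\<close>.\<close>

lemma dword_simple:
  assumes "u \<in> L" "i \<in> I" "j \<in> I" "cj u (g i) = g j" "\<not> nu u (g i)"
  shows "weq (dword u i) [DGen j]"
  using assms
proof (induction "len (cl u)" arbitrary: u i rule: less_induct)
  case (less u0 i)
  obtain u where u: "u \<in> L" "cl u = cl u0" "length u = len (cl u0)"
    using reduced_word less.prems by blast
  have cj: "cj u (g i) = g j" using less.prems u cj_cong[of u u0] by simp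
  have nu: "\<not> nu u (g i)" using less.prems u nu_cong[of u u0] by simp
  have "weq (dword u i) [DGen j]"
  proof (cases u rule: rev_cases)
    case Nil
    then have "i = j" using cj less.prems g_eq_iff by simp
    then show ?thesis using Nil by (simp add: dword_def weq_refl)
  next
    case (snoc w k)
    have wk: "w \<in> L" "k \<in> I" using snoc u by auto
    have len_w: "len (cl w) < len (cl u0)" using len_le[of w] wk u snoc by simp
    have wgk: "cl w \<otimes>\<^bsub>W\<^esub> g k = cl u0" using mult_W[of w "[k]"] wk u snoc by (simp add: g_cl)
    have nk: "\<not> nu w (g k)" using len_less[of w "g k"] wk wgk len_w by auto
    have ik: "i \<noteq> k" using nu nk wk by (auto simp: snoc nu_append)
    have cw: "cj w (c k (g i)) = g j" using cj snoc by simp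
    have nw: "\<not> nu w (c k (g i))" using nu ik less.prems wk by (simp add: snoc nu_append g_eq_iff)
    note ikI = less.prems(2) wk(2) ik
    from ikI show ?thesis
    proof (cases rule: m_cases)
      case 1
      have "nu u (g k)" using nk wk by (simp add: snoc nu_append)
      then show ?thesis using infinite_not_simple[of u i k j] u ikI less.prems cj nu 1 by blast
    next
      case 2
      then have "c k (g i) = g i" using c_comm[of k i] ikI m_sym by simp
      then have "weq (dword w i) [DGen j]"
        using less.hyps[of w i] len_w wk less.prems cw nw by simp
      then show ?thesis using dword_comm[of w i k] wk ikI 2 snoc weq_trans by blast
    next
      case 3
      have t: "c k (g i) = c i (g k)" using c_braid[of i k] ikI 3 by simp
      \<comment> \<open>Otherwise w would keep both simple roots positive and could not send the
        reflection iki to a simple one. Hence w i is shorter than w, and u = (w i)(i k) reduces the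
        claim for i to the claim for k and w i.\<close>
      have "nu w (g i)"
        using braid_not_simple[of w i k j] wk ikI less.prems nk 3 cw t by auto
      then have "len (cl w \<otimes>\<^bsub>W\<^esub> g i) < len (cl w)" using len_less wk less.prems by simp
      moreover have "cl w \<otimes>\<^bsub>W\<^esub> g i = cl (w @ [i])"
        using mult_W[of w "[i]"] wk less.prems by (simp add: g_cl)
      ultimately have len_v: "len (cl (w @ [i])) < len (cl u0)" using len_w by simp
      have v: "w @ [i] \<in> L" using wk less.prems by simp
      have "cj (w @ [i]) (g k) = g j" using cw t by simp
      moreover have "\<not> nu (w @ [i]) (g k)" using nw t ikI by (simp add: nu_append g_eq_iff)
      ultimately have *: "weq (dword (w @ [i]) k) [DGen j]"
        using less.hyps[OF len_v v, of k] wk less.prems by simp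
      have "cl (w @ ([i, i]) @ [k]) = cl (w @ [] @ [k])"
        using cl_square[of i] ikI wk by (intro cl_cong) auto
      then have "weq (dword u i) (dword ((w @ [i]) @ [i, k]) i)"
        using snoc u ikI wk by (intro dword_cong) auto
      also have "weq \<dots> (dword (w @ [i]) k)" using dword_braid[OF v, of i k] ikI 3 by simp
      finally show ?thesis using * weq_trans by blast
    qed
  qed
  then show ?case using dword_cong[of u0 u i] u less.prems weq_trans by auto
qed

text \<open>The element v^-1 u carries the simple root of i to that of j, sign included, so
  \<open>dword_simple\<close> applies to it; conjugating the result by v gives the
  comparison.\<close>

lemma dword_unique:
  assumes "u \<in> L" "i \<in> I" "\<not> nu u (g i)" "v \<in> L" "j \<in> I" "\<not> nu v (g j)" "cj u (g i) = cj v (g j)"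
  shows "weq (dword u i) (dword v j)"
proof -
  have "nu (rev v @ v) (g j) = nu [] (g j)"
    using assms cl_rev[of "rev v"] by (intro nu_cong) auto
  then have "\<not> nu (rev v) (cj v (g j))" using assms by (simp add: nu_append)
  then have "\<not> nu (rev v @ u) (g i)" using assms by (simp add: nu_append)
  moreover have "cj (rev v @ u) (g i) = g j" using assms by simp
  ultimately have "weq (dword (rev v @ u) i) [DGen j]" using assms by (intro dword_simple) auto
  then have *: "weq (dword (v @ rev v @ u) i) (dword v j)"
    using weq_context[of "dword (rev v @ u) i" "[DGen j]" "map SGen v" "map SGen (rev v)"]
      map_SGen_closed[of v] map_SGen_closed[of "rev v"] assms by (simp add: dword_def)
  have "cl ([] @ (v @ rev v) @ u) = cl ([] @ [] @ u)"
    using assms cl_rev[of v] by (intro cl_cong) auto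
  then have "weq (dword u i) (dword (v @ rev v @ u) i)" using assms by (intro dword_cong) auto
  then show ?thesis using * weq_trans by blast
qed

text \<open>If u inverts the root of i, then u i does not, and it yields the same
  reflection.\<close>

lemma positive_word:
  assumes "t \<in> R"
  shows "\<exists>u i. u \<in> L \<and> i \<in> I \<and> t = cj u (g i) \<and> \<not> nu u (g i)"
proof -
  obtain u i where u: "u \<in> L" "i \<in> I" "t = cj u (g i)" using assms by (auto simp: reflections_eq)
  show ?thesis
  proof (cases "nu u (g i)")
    case True
    then have "u @ [i] \<in> L" "t = cj (u @ [i]) (g i)" "\<not> nu (u @ [i]) (g i)"
      using u by (auto simp: nu_append)
    then show ?thesis using u by blast
  qed (use u in blast)
qed

section \<open>The family of all D_t\<close>

lemma Hhat_Q: "Hhat I m = H.Q"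
  and Hhat_word_cls: "Hhat_word I m u = H.cls (fword u)"
  by (simp_all add: Hhat_def Hhat_word_def)

lemma cls_weq: "u \<in> lists G \<Longrightarrow> v \<in> lists G \<Longrightarrow> H.cls (fword u) = H.cls (fword v) \<longleftrightarrow> weq u v"
  by (simp add: H.cls_eq free_ring_closed weq_def)

lemma cls_fword_mult: "u \<in> lists G \<Longrightarrow> v \<in> lists G \<Longrightarrow>
    H.cls (fword u) \<otimes>\<^bsub>H.Q\<^esub> H.cls (fword v) = H.cls (fword (u @ v))"
  by (simp add: H.cls_mult free_ring_closed fword_mult)

text \<open>Any choice of sign-preserving words defines the family, by \<open>dword_unique\<close>.
  The explicit formula is kept as a second conjunct: uniqueness transfers it to
  \<open>D_hat\<close>, where it is needed for arbitrary words.\<close>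

lemma D_family_exists: "\<exists>D. D_family I m D \<and>
    (\<forall>u\<in>L. \<forall>i\<in>I. \<not> nu u (g i) \<longrightarrow> D (cj u (g i)) = H.cls (fword (dword u i)))"
proof -
  obtain U K where UK: "\<And>t. t \<in> R \<Longrightarrow> U t \<in> L \<and> K t \<in> I \<and> t = cj (U t) (g (K t)) \<and> \<not> nu (U t) (g (K t))"
    using positive_word by metis
  define D where "D = restrict (\<lambda>t. H.cls (fword (dword (U t) (K t)))) R"
  have D: "D (cj u (g i)) = H.cls (fword (dword u i))" if "u \<in> L" "i \<in> I" "\<not> nu u (g i)" for u i
  proof -
    have t: "cj u (g i) \<in> R" using that by simp
    have "weq (dword (U (cj u (g i))) (K (cj u (g i)))) (dword u i)"
      using UK[OF t] that by (intro dword_unique) auto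
    then show ?thesis using UK[OF t] that t by (simp add: D_def cls_weq del: in_lists_conv_set)
  qed
  have "D \<in> R \<rightarrow>\<^sub>E carrier H.Q"
    using UK by (auto simp: D_def intro!: H.cls_closed free_ring_closed dword_closed)
  moreover have "D (g i) = H.cls (fword [DGen i])" if "i \<in> I" for i
    using D[of "[]" i] that by (simp add: dword_def)
  moreover have "D (c i t) = H.cls (fword [SGen i]) \<otimes>\<^bsub>H.Q\<^esub> D t \<otimes>\<^bsub>H.Q\<^esub> H.cls (fword [SGen i])"
    if "i \<in> I" "t \<in> R" "t \<noteq> g i" for i t
  proof -
    obtain u k where u: "u \<in> L" "k \<in> I" "t = cj u (g k)" "\<not> nu u (g k)"
      using positive_word[OF \<open>t \<in> R\<close>] by blast
    have ne: "c i (cj u (g k)) \<noteq> g i"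
      using that u c_inj[of i "cj u (g k)" "g i"] by simp
    have nn: "\<not> nu (i # u) (g k)" using u that by auto
    have "D (c i t) = H.cls (fword (dword (i # u) k))"
      using D[of "i # u" k] u that nn by simp
    moreover have "dword (i # u) k = ([SGen i] @ dword u k) @ [SGen i]" by (simp add: dword_def)
    ultimately show ?thesis using D[of u k] u that dword_closed[of u k] cls_fword_mult[of "[SGen i]" "dword u k"]
      cls_fword_mult[of "[SGen i] @ dword u k" "[SGen i]"] by simp
  qed
  ultimately have "D_family I m D"
    unfolding D_family_def Hhat_Q Hhat_word_cls c_def[symmetric] by blast
  then show ?thesis using D by blast
qed

lemma D_family_unique:
  assumes "D_family I m D" "D_family I m D'"
  shows "D = D'"
proof -
  note d = assms[unfolded D_family_def Hhat_Q Hhat_word_cls c_def[symmetric]]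
  have "D t = D' t" if "t \<in> R" for t
    using that by (induction rule: reflections_induct) (use d in auto)
  then show ?thesis using d by (intro PiE_ext[of D R _ D']) auto
qed

lemma D_hat_family: "D_family I m (D_hat I m)"
  unfolding D_hat_def using D_family_exists D_family_unique by (metis (mono_tags) theI)

lemma D_hat_dword:
  "u \<in> L \<Longrightarrow> i \<in> I \<Longrightarrow> \<not> nu u (g i) \<Longrightarrow> D_hat I m (cj u (g i)) = H.cls (fword (dword u i))"
  using D_family_exists D_family_unique[OF D_hat_family] by metis

lemma D_hat_closed: "t \<in> R \<Longrightarrow> D_hat I m t \<in> carrier H.Q"
  using D_hat_family unfolding D_family_def Hhat_Q by blast

lemma D_hat_g: "i \<in> I \<Longrightarrow> D_hat I m (g i) = H.cls (fword [DGen i])"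
  using D_hat_family unfolding D_family_def Hhat_word_cls by blast

lemma D_hat_c: "i \<in> I \<Longrightarrow> t \<in> R \<Longrightarrow> t \<noteq> g i \<Longrightarrow> D_hat I m (c i t) =
    H.cls (fword [SGen i]) \<otimes>\<^bsub>H.Q\<^esub> D_hat I m t \<otimes>\<^bsub>H.Q\<^esub> H.cls (fword [SGen i])"
  using D_hat_family unfolding D_family_def Hhat_word_cls Hhat_Q c_def[symmetric] by blast

end

section \<open>The counit\<close>

lemma frag_cmul_of_int: "frag_cmul n x = of_int n * (x :: 'x list \<Rightarrow>\<^sub>0 int)"
proof (induction n rule: int_induct[where k = 0])
  case (step1 i)
  then show ?case by (simp add: frag_cmul_distrib distrib_right)
next
  case (step2 i)
  have "frag_cmul (i + - 1) x = frag_cmul i x + frag_cmul (- 1) x" by (rule frag_cmul_distrib)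
  then show ?case using step2 by (simp add: left_diff_distrib)
qed simp

abbreviation gen_counit :: "'i gen \<Rightarrow> int" where
  "gen_counit \<equiv> \<lambda>g. case g of SGen i \<Rightarrow> 1 | DGen i \<Rightarrow> 0"

text \<open>Integers are embedded as constants of the free ring, because the values of
  \<open>frag_extend\<close> are formal sums; additivity and multiplicativity of the counit then
  come from the general lemmas.\<close>

lemma free_counit_extend:
  "(of_int (free_counit p) :: 'i gen list \<Rightarrow>\<^sub>0 int) = frag_extend (\<lambda>u. of_int (\<Prod>g\<leftarrow>u. gen_counit g)) p"
  by (simp add: free_counit_def frag_extend_def frag_cmul_of_int)

lemma of_int_word_ring_eqI:
  "(of_int x :: 'i gen list \<Rightarrow>\<^sub>0 int) = of_int y \<Longrightarrow> x = y"
  by simp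

lemma free_counit_diff: "free_counit (p - q) = free_counit p - free_counit q"
  and free_counit_add: "free_counit (p + q) = free_counit p + free_counit q"
  and free_counit_mult: "free_counit (p * q) = free_counit p * free_counit q"
  by (rule of_int_word_ring_eqI, simp add: free_counit_extend frag_extend_diff frag_extend_add frag_extend_mult)+

lemma free_counit_fword: "free_counit (fword u) = (\<Prod>g\<leftarrow>u. gen_counit g)"
  by (rule of_int_word_ring_eqI) (simp add: free_counit_extend)

lemma free_counit_one: "free_counit 1 = 1"
  using free_counit_fword[of "[]"] by (simp add: fword_Nil)

lemmas free_counit_simps = free_counit_diff free_counit_add free_counit_mult free_counit_fword free_counit_one

context presentation
begin

lemma N_conj_mult:
  assumes "S * S - 1 \<in> N" "S \<in> F" "x \<in> F" "y \<in> F" "S * x * S - x' \<in> N" "S * y * S - y' \<in> N" "x' \<in> F"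
  shows "S * (x * y) * S - x' * y' \<in> N"
proof -
  have "S * (x * y) * S - x' * y' = ((S * x * S) * (S * y * S) - x' * y') - S * x * (S * S - 1) * y * S"
    by (simp add: algebra_simps)
  moreover have "(S * x * S) * (S * y * S) - x' * y' \<in> N"
    using assms by (intro N_mult_cong) auto
  moreover have "S * x * (S * S - 1) * y * S \<in> N"
    using assms by (intro N_r N_l) auto
  ultimately show ?thesis using N_diff by metis
qed

lemma N_slide:
  assumes "S * S - 1 \<in> N" "S \<in> F" "x \<in> F" "S * x * S - x' \<in> N"
  shows "S * x - x' * S \<in> N"
proof -
  have "S * x - x' * S = (S * x * S - x') * S - S * x * (S * S - 1)"
    by (simp add: algebra_simps)
  moreover have "(S * x * S - x') * S \<in> N" "S * x * (S * S - 1) \<in> N"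
    using assms by (auto intro: N_r N_l)
  ultimately show ?thesis using N_diff by metis
qed

text \<open>For a = D_i, b = D_j and t the third element, conjugation by S = s_i exchanges b and t
  and sends a to 1 - S - a. The terms with S collect to S t - b S, which vanishes by
  \<open>N_slide\<close>, and the relator with a and b exchanged remains.\<close>

lemma reflect_braid:
  assumes "S \<in> F" "a \<in> F" "b \<in> F" "t \<in> F" and S: "S * S - 1 \<in> N"
    and a: "S * a * S - (1 - S - a) \<in> N" and b: "S * b * S - t \<in> N" and t: "S * t * S - b \<in> N"
  shows "S * (a * b - (t * a + b * t - t)) * S - (b * a - (t * b + a * t - t)) \<in> N"
proof -
  note c = N_conj_mult[OF S \<open>S \<in> F\<close>]
  have a': "1 - S - a \<in> F" using assms by auto
  have eq: "S * (a * b - (t * a + b * t - t)) * S - (b * a - (t * b + a * t - t)) =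
    (S * (a * b) * S - (1 - S - a) * t) - (S * (t * a) * S - b * (1 - S - a))
    - (S * (b * t) * S - t * b) + (S * t * S - b) - (S * t - b * S)"
    by (simp add: algebra_simps)
  have "S * (a * b) * S - (1 - S - a) * t \<in> N" using c[OF _ _ a b a'] assms by simp
  moreover have "S * (t * a) * S - b * (1 - S - a) \<in> N" using c[OF _ _ t a] assms by simp
  moreover have "S * (b * t) * S - t * b \<in> N" using c[OF _ _ b t] assms by simp
  moreover have "S * t - b * S \<in> N" using N_slide[OF S _ _ t] assms by simp
  ultimately show ?thesis unfolding eq using t N_diff N_add by metis
qed

lemma reflect_commute:
  assumes "S \<in> F" "a \<in> F" "b \<in> F" and S: "S * S - 1 \<in> N"
    and a: "S * a * S - (1 - S - a) \<in> N" and b: "S * b * S - b \<in> N"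
  shows "S * (a * b - b * a) * S - (b * a - a * b) \<in> N"
proof -
  note c = N_conj_mult[OF S \<open>S \<in> F\<close>]
  have a': "1 - S - a \<in> F" using assms by auto
  have eq: "S * (a * b - b * a) * S - (b * a - a * b) =
    (S * (a * b) * S - (1 - S - a) * b) - (S * (b * a) * S - b * (1 - S - a)) - (S * b - b * S)"
    by (simp add: algebra_simps)
  have "S * (a * b) * S - (1 - S - a) * b \<in> N" using c[OF _ _ a b a'] assms by simp
  moreover have "S * (b * a) * S - b * (1 - S - a) \<in> N" using c[OF _ _ b a] assms by simp
  moreover have "S * b - b * S \<in> N" using N_slide[OF S _ _ b] assms by simp
  ultimately show ?thesis unfolding eq using N_diff by metis
qed

end

section \<open>The defining relations hold in \<open>D(W)\<close>\<close>

context simply_laced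
begin

lemma free_counit_N: "x \<in> H.N \<Longrightarrow> free_counit x = 0"
proof (induction rule: H.N_induct)
  case zero
  show ?case using free_counit_simps(1)[of 0 0] by simp
next
  case (rel u v r)
  have *: "(\<Prod>g\<leftarrow>concat (replicate n [SGen i, SGen j]). gen_counit g) = 1" for n and i j :: 'i
    by (induction n) auto
  have "free_counit r = 0"
    using rel(3) unfolding Hhat_relators_def
    by (elim UnE CollectE exE conjE; hypsubst) (simp_all add: free_counit_simps *)
  then show ?case by (simp add: free_counit_simps)
qed (simp add: free_counit_simps)

lemma counit_cls:
  assumes "p \<in> H.F" shows "counit (H.cls p) = free_counit p"
proof -
  have "free_counit x = free_counit p" if "x \<in> H.cls p" for x
    using that free_counit_N[of "x - p"] assms by (simp add: H.mem_cls free_counit_simps)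
  moreover have "p \<in> H.cls p" using assms by (simp add: H.mem_cls H.N_zero)
  ultimately have "free_counit ` H.cls p = {free_counit p}" by blast
  then show ?thesis by (simp add: counit_def)
qed

text \<open>A representative of D_t in the free ring, so that identities in Hhat(W) become
  congruences between ring elements of a type with its own arithmetic.\<close>

definition d :: "'i list set \<Rightarrow> 'i gen list \<Rightarrow>\<^sub>0 int" where
  "d t = (SOME x. x \<in> H.F \<and> H.cls x = D_hat I m t)"

lemma d: "t \<in> R \<Longrightarrow> d t \<in> H.F" "t \<in> R \<Longrightarrow> H.cls (d t) = D_hat I m t"
proof -
  assume "t \<in> R"
  then have "\<exists>x. x \<in> H.F \<and> H.cls x = D_hat I m t" using D_hat_closed[of t] unfolding H.carrier_Q by auto
  from someI_ex[OF this] show "d t \<in> H.F" "H.cls (d t) = D_hat I m t" by (simp_all add: d_def)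
qed

definition S :: "'i list \<Rightarrow> 'i gen list \<Rightarrow>\<^sub>0 int" where
  "S u = fword (map SGen u)"

lemma S_closed [simp]: "u \<in> L \<Longrightarrow> S u \<in> H.F"
  using map_SGen_closed by (auto simp: S_def)

lemma S_append: "S (u @ v) = S u * S v"
  by (simp add: S_def fword_mult)

lemma S_Nil [simp]: "S [] = 1"
  by (simp add: S_def fword_Nil)

lemma S_rev: "u \<in> L \<Longrightarrow> S u * S (rev u) - 1 \<in> H.N"
  using weq_rev[of u] by (simp add: weq_def S_def fword_mult fword_Nil)

lemma S_square: "i \<in> I \<Longrightarrow> S [i] * S [i] - 1 \<in> H.N"
  using S_rev[of "[i]"] by simp

lemma d_g: "i \<in> I \<Longrightarrow> d (g i) - fword [DGen i] \<in> H.N"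
  using d[of "g i"] D_hat_g[of i] by (subst H.cls_eq[symmetric]) auto

lemma d_dword: "u \<in> L \<Longrightarrow> i \<in> I \<Longrightarrow> \<not> nu u (g i) \<Longrightarrow> d (cj u (g i)) - fword (dword u i) \<in> H.N"
  using d[of "cj u (g i)"] D_hat_dword[of u i] free_ring_closed(6)[OF dword_closed]
  by (subst H.cls_eq[symmetric]) auto

lemma d_c:
  assumes "i \<in> I" "t \<in> R" "t \<noteq> g i"
  shows "S [i] * d t * S [i] - d (c i t) \<in> H.N"
proof -
  have "H.cls (S [i] * d t * S [i]) = H.cls (d (c i t))"
    using D_hat_c[OF assms] d[of t] d[of "c i t"] assms S_closed[of "[i]"]
    by (simp add: S_def flip: H.cls_mult)
  then show ?thesis using assms d by (subst (asm) H.cls_eq) auto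
qed

text \<open>The relation s D + D s = s - 1, multiplied by s on the right.\<close>

lemma d_c_self:
  assumes "i \<in> I"
  shows "S [i] * d (g i) * S [i] - (1 - S [i] - d (g i)) \<in> H.N"
proof -
  let ?s = "S [i]" and ?D = "fword [DGen i]"
  have rel: "(?s * ?D + ?D * ?s) - (?s - 1) \<in> H.N"
    using assms by (intro H.N_rel) (auto simp: Hhat_relators_def S_def fword_mult)
  have eq: "?s * d (g i) * ?s - (1 - ?s - d (g i)) = ?s * (d (g i) - ?D) * ?s + (d (g i) - ?D)
      + ((?s * ?D + ?D * ?s) - (?s - 1)) * ?s - (?D - 1) * (?s * ?s - 1)"
    by (simp add: algebra_simps)
  have "?s * (d (g i) - ?D) * ?s \<in> H.N" "(?D - 1) * (?s * ?s - 1) \<in> H.N"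
    "((?s * ?D + ?D * ?s) - (?s - 1)) * ?s \<in> H.N"
    using assms by (intro H.N_l H.N_r d_g S_square rel; simp add: free_ring_closed)+
  then show ?thesis unfolding eq using d_g[OF assms] H.N_add H.N_diff by metis
qed

lemma d_idem:
  assumes "t \<in> R"
  shows "d t * d t - d t \<in> H.N"
  using assms
proof (induction rule: reflections_induct)
  case (gen i)
  let ?D = "fword [DGen i]"
  have rel: "?D * ?D - ?D \<in> H.N"
    using gen by (intro H.N_rel) (auto simp: Hhat_relators_def fword_mult)
  have "d (g i) * d (g i) - ?D * ?D \<in> H.N"
    using d_g[OF gen] gen d by (intro H.N_mult_cong) auto
  then show ?case using rel d_g[OF gen] by (metis H.N_trans H.N_sym)
next
  case (conj i t)
  let ?s = "S [i]"
  have *: "?s * (d t * d t) * ?s - d (c i t) * d (c i t) \<in> H.N"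
    using conj S_square[of i] d d_c by (intro H.N_conj_mult) auto
  have "?s * (d t * d t - d t) * ?s \<in> H.N" using conj by (intro H.N_l H.N_r) auto
  then have "?s * (d t * d t) * ?s - ?s * d t * ?s \<in> H.N" by (simp add: algebra_simps)
  then show ?case using * d_c[of i t] conj by (metis H.N_trans H.N_sym)
qed

text \<open>The lift to free rings of the substitution of D_t for the letter t.\<close>

definition E :: "('i list set list \<Rightarrow>\<^sub>0 int) \<Rightarrow> 'i gen list \<Rightarrow>\<^sub>0 int" where
  "E p = frag_extend (\<lambda>u. \<Prod>t\<leftarrow>u. d t) p"

lemma E_simps:
  "E (p - q) = E p - E q" "E (p + q) = E p + E q" "E (p * q) = E p * E q" "E 1 = 1" "E 0 = 0"
  "E (fword u) = (\<Prod>t\<leftarrow>u. d t)"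
  by (simp_all add: E_def frag_extend_diff frag_extend_add frag_extend_mult)

lemma E_fword_closed: "u \<in> lists R \<Longrightarrow> E (fword u) \<in> H.F"
  by (induction u) (auto simp: E_simps d)

lemma E_closed: "p \<in> carrier (free_ring R) \<Longrightarrow> E p \<in> H.F"
  unfolding carrier_free_ring[of p R]
  by (induction p rule: fword_induct) (simp_all add: E_simps(1,5) E_fword_closed free_ring_closed)

lemma free_counit_d:
  assumes "t \<in> R" shows "free_counit (d t) = 0"
proof -
  obtain u i where u: "u \<in> L" "i \<in> I" "t = cj u (g i)" "\<not> nu u (g i)"
    using positive_word[OF assms] by blast
  have "free_counit (fword (dword u i)) = 0" by (simp add: free_counit_simps dword_def)
  then show ?thesis
    using free_counit_N[OF d_dword[OF u(1,2,4)]] u by (simp add: free_counit_simps)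
qed

subsection \<open>Orders of products of two reflections\<close>

lemma gg_cancel [simp]: "i \<in> I \<Longrightarrow> x \<in> carrier W \<Longrightarrow> g i \<otimes>\<^bsub>W\<^esub> (g i \<otimes>\<^bsub>W\<^esub> x) = x"
  using reflection_square[of "g i"] by (simp flip: W.m_assoc)

lemma cj_mult:
  assumes "w \<in> L" "s \<in> carrier W" "t \<in> carrier W"
  shows "cj w (s \<otimes>\<^bsub>W\<^esub> t) = cj w s \<otimes>\<^bsub>W\<^esub> cj w t"
  using assms(1) by (induction w) (use assms in \<open>auto simp: c_def W.m_assoc\<close>)

lemma cj_pow:
  assumes "w \<in> L" "s \<in> carrier W"
  shows "cj w (s [^]\<^bsub>W\<^esub> (n::nat)) = cj w s [^]\<^bsub>W\<^esub> n"
proof (induction n)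
  case 0
  show ?case using assms(1) by (induction w) (use reflection_square in \<open>auto simp: c_def\<close>)
qed (use assms in \<open>simp add: cj_mult\<close>)

lemma order_conj:
  assumes "w \<in> L" "s \<in> carrier W" "t \<in> carrier W"
  shows "cox_order I m (cj w s) (cj w t) = cox_order I m s t"
proof -
  let ?x = "s \<otimes>\<^bsub>W\<^esub> t"
  have one: "cj w \<one>\<^bsub>W\<^esub> = \<one>\<^bsub>W\<^esub>" using cj_pow[of w s 0] assms by simp
  have x: "?x \<in> carrier W" "cj w ?x \<in> carrier W" using assms by auto
  have "cj w ?x [^]\<^bsub>W\<^esub> n = \<one>\<^bsub>W\<^esub> \<longleftrightarrow> ?x [^]\<^bsub>W\<^esub> n = \<one>\<^bsub>W\<^esub>" for n :: nat
    using cj_inj[of w "?x [^]\<^bsub>W\<^esub> n" "\<one>\<^bsub>W\<^esub>"] assms x cj_pow[of w ?x n] one by simp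
  then have iff: "W.ord (cj w ?x) dvd n \<longleftrightarrow> W.ord ?x dvd n" for n
    using W.pow_eq_id[OF x(1), of n] W.pow_eq_id[OF x(2), of n] by simp
  have "W.ord (cj w ?x) = W.ord ?x"
    by (rule dvd_antisym) (use iff[of "W.ord ?x"] iff[of "W.ord (cj w ?x)"] in simp_all)
  then show ?thesis using assms by (simp add: cox_order_def cj_mult)
qed

text \<open>The order divides m because the relation holds, and it is not 1 because distinct
  generators differ. As 2 and 3 are prime this settles the finite bonds; for m = 0 the linear
  representation excludes a positive order.\<close>

lemma order_gen:
  assumes "i \<in> I" "j \<in> I" "i \<noteq> j"
  shows "cox_order I m (g i) (g j) = m i j"
proof -
  let ?x = "g i \<otimes>\<^bsub>W\<^esub> g j"
  have x: "?x = cl [i, j]" "?x \<in> carrier W" using assms by (simp_all add: g_cl mult_W)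
  have ne: "?x \<noteq> \<one>\<^bsub>W\<^esub>"
  proof
    assume "?x = \<one>\<^bsub>W\<^esub>"
    then have "g i \<otimes>\<^bsub>W\<^esub> ?x = g i" using assms by simp
    then show False using assms by (simp add: g_eq_iff)
  qed
  have pow: "?x [^]\<^bsub>W\<^esub> n = cl (concat (replicate n [i, j]))" for n :: nat
    unfolding x(1) using assms by (intro pow_word) simp
  have "?x [^]\<^bsub>W\<^esub> m i j = \<one>\<^bsub>W\<^esub>" unfolding pow one_W using assms by (intro cl_rel)
  then have dvd: "W.ord ?x dvd m i j" using W.pow_eq_id x by simp
  have ne1: "W.ord ?x \<noteq> 1" using ne W.ord_eq_1 x by blast
  from assms have "W.ord ?x = m i j"
  proof (cases rule: m_cases)
    case 1
    have "?x [^]\<^bsub>W\<^esub> W.ord ?x = \<one>\<^bsub>W\<^esub>" using W.pow_ord_eq_1 x by blast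
    then have "W.ord ?x = 0" unfolding pow one_W using infinite_order[OF assms 1] by blast
    then show ?thesis using 1 by simp
  next
    case 2
    then have "W.ord ?x dvd 2" using dvd by simp
    then have "W.ord ?x \<le> 2" "W.ord ?x \<noteq> 0" by (auto intro: dvd_imp_le intro!: gr0I)
    then show ?thesis using ne1 2 by linarith
  next
    case 3
    then have dvd3: "W.ord ?x dvd 3" using dvd by simp
    then have "W.ord ?x \<le> 3" "W.ord ?x \<noteq> 0" by (auto intro: dvd_imp_le intro!: gr0I)
    moreover have "W.ord ?x \<noteq> 2"
    proof
      assume "W.ord ?x = 2"
      then show False using dvd3 by simp
    qed
    ultimately show ?thesis using ne1 3 by linarith
  qed
  then show ?thesis by (simp add: cox_order_def)
qed

lemma compatible_cases:
  assumes "compatible I m s s'"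
  obtains w a b where "w \<in> L" "a \<in> I" "b \<in> I" "a \<noteq> b" "s = cj w (g a)" "s' = cj w (g b)"
    "\<not> nu w (g a)" "\<not> nu w (g b)" "cox_order I m s s' = m a b"
    "s \<otimes>\<^bsub>W\<^esub> s' \<otimes>\<^bsub>W\<^esub> s = cj w (c a (g b))"
proof -
  obtain w a b where w: "w \<in> L" "a \<in> I" "b \<in> I" "s = cj w (g a)" "s' = cj w (g b)"
    "\<not> nu w (g a)" "\<not> nu w (g b)" "s \<noteq> s'" using assms unfolding compatible_iff by blast
  then have "a \<noteq> b" by blast
  moreover have "cox_order I m s s' = m a b"
    using w order_conj[of w "g a" "g b"] order_gen[of a b] \<open>a \<noteq> b\<close> by simp
  moreover have "s \<otimes>\<^bsub>W\<^esub> s' \<otimes>\<^bsub>W\<^esub> s = cj w (c a (g b))"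
    unfolding c_def using w by (simp add: cj_mult)
  ultimately show ?thesis using that w by blast
qed

end

context presentation
begin

lemma N_conj_mult':
  assumes "V * U - 1 \<in> N" "U \<in> F" "V \<in> F" "x \<in> F" "y \<in> F" "x' \<in> F" "y' \<in> F"
    "x' - U * x * V \<in> N" "y' - U * y * V \<in> N"
  shows "x' * y' - U * (x * y) * V \<in> N"
proof -
  have eq: "x' * y' - U * (x * y) * V = (x' * y' - (U * x * V) * (U * y * V)) + U * x * (V * U - 1) * y * V"
    by (simp add: algebra_simps)
  have "x' * y' - (U * x * V) * (U * y * V) \<in> N" using assms by (intro N_mult_cong) auto
  moreover have "U * x * (V * U - 1) * y * V \<in> N" using assms by (intro N_r N_l) auto
  ultimately show ?thesis unfolding eq by (rule N_add)
qed

end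

context simply_laced
begin

section \<open>Relators in the free ring on the reflections, and the subrings they map into\<close>

definition rel1 :: "'i list set \<Rightarrow> 'i list set list \<Rightarrow>\<^sub>0 int" where
  "rel1 s = fword [s, s] - fword [s]"

definition rel2 :: "'i list set \<Rightarrow> 'i list set \<Rightarrow> 'i list set list \<Rightarrow>\<^sub>0 int" where
  "rel2 s t = fword [s, t] - fword [t, s]"

definition rel3 :: "'i list set \<Rightarrow> 'i list set \<Rightarrow> 'i list set \<Rightarrow> 'i list set list \<Rightarrow>\<^sub>0 int" where
  "rel3 s t r = fword [s, t] - (fword [r, s] + fword [t, r] - fword [r])"

definition rels :: "('i list set list \<Rightarrow>\<^sub>0 int) set" where
  "rels = {rel1 s | s. s \<in> R} \<union>
     {rel2 s s' | s s'. compatible I m s s' \<and> cox_order I m s s' = 2} \<union>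
     {rel3 s s' (s \<otimes>\<^bsub>W\<^esub> s' \<otimes>\<^bsub>W\<^esub> s) | s s'. compatible I m s s' \<and> cox_order I m s s' = 3}"

lemma rel_closed:
  "s \<in> T \<Longrightarrow> rel1 s \<in> carrier (free_ring T)"
  "s \<in> T \<Longrightarrow> t \<in> T \<Longrightarrow> rel2 s t \<in> carrier (free_ring T)"
  "s \<in> T \<Longrightarrow> t \<in> T \<Longrightarrow> r \<in> T \<Longrightarrow> rel3 s t r \<in> carrier (free_ring T)"
  unfolding rel1_def rel2_def rel3_def by (intro free_ring_closed; simp)+

lemma compatible_third:
  assumes "compatible I m s s'"
  shows "s \<otimes>\<^bsub>W\<^esub> s' \<otimes>\<^bsub>W\<^esub> s \<in> R"
  using assms by (rule compatible_cases) auto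

lemma rels_closed: "rels \<subseteq> carrier (free_ring R)"
  unfolding rels_def using compatible_third compatible_reflections
  by (intro Un_least subsetI; elim CollectE exE conjE; hypsubst; intro rel_closed) auto

sublocale P: presentation R rels
  by unfold_locales (rule rels_closed)

definition EC :: "('i list set list \<Rightarrow>\<^sub>0 int) \<Rightarrow> ('i gen list \<Rightarrow>\<^sub>0 int) set" where
  "EC p = H.cls (E p)"

lemma EC_closed [simp]: "p \<in> P.F \<Longrightarrow> EC p \<in> carrier H.Q"
  by (simp add: EC_def E_closed)

lemma EC_mult: "p \<in> P.F \<Longrightarrow> q \<in> P.F \<Longrightarrow> EC (p * q) = EC p \<otimes>\<^bsub>H.Q\<^esub> EC q"
  and EC_add: "p \<in> P.F \<Longrightarrow> q \<in> P.F \<Longrightarrow> EC (p + q) = EC p \<oplus>\<^bsub>H.Q\<^esub> EC q"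
  by (simp_all add: EC_def E_simps E_closed H.cls_mult H.cls_add)

lemma EC_one: "EC 1 = \<one>\<^bsub>H.Q\<^esub>"
  and EC_zero: "EC 0 = \<zero>\<^bsub>H.Q\<^esub>"
  by (simp_all add: EC_def E_simps H.cls_one H.cls_zero)

lemma EC_uminus: "p \<in> P.F \<Longrightarrow> EC (- p) = \<ominus>\<^bsub>H.Q\<^esub> EC p"
  using E_simps(1)[of 0 p] by (simp add: EC_def E_closed E_simps H.cls_uminus)

lemma EC_letter: "t \<in> R \<Longrightarrow> EC (fword [t]) = D_hat I m t"
  by (simp add: EC_def E_simps d)

lemma EC_word: "u \<in> lists R \<Longrightarrow> foldr (\<lambda>s x. D_hat I m s \<otimes>\<^bsub>H.Q\<^esub> x) u \<one>\<^bsub>H.Q\<^esub> = EC (fword u)"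
proof (induction u)
  case (Cons t u)
  then have "EC (fword (t # u)) = EC (fword [t]) \<otimes>\<^bsub>H.Q\<^esub> EC (fword u)"
    by (subst fword_split, subst EC_mult) (simp_all add: free_ring_closed)
  then show ?case using Cons by (simp add: EC_letter)
qed (simp add: fword_Nil EC_one)

lemma free_ring_mono: "T \<subseteq> R \<Longrightarrow> p \<in> carrier (free_ring T) \<Longrightarrow> p \<in> P.F"
  using lists_mono[of T R] by (auto simp: carrier_free_ring simp del: in_lists_conv_set)

text \<open>With U the words of bounded length, the degree filtration becomes a condition on the
  support of a polynomial.\<close>

lemma generate_add:
  assumes U: "U \<subseteq> lists R"
  shows "generate (add_monoid H.Q) ((\<lambda>u. EC (fword u)) ` U) = EC ` {p. Poly_Mapping.keys p \<subseteq> U}"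
proof
  have F: "p \<in> P.F" if "Poly_Mapping.keys p \<subseteq> U" for p
    using that U by (simp add: carrier_free_ring)
  have "x \<in> EC ` {p. Poly_Mapping.keys p \<subseteq> U}"
    if "x \<in> generate (add_monoid H.Q) ((\<lambda>u. EC (fword u)) ` U)" for x
    using that
  proof induction
    case one
    show ?case by (intro image_eqI[of _ _ 0]) (simp_all add: EC_zero)
  next
    case (incl h)
    then obtain u where u: "u \<in> U" "h = EC (fword u)" by blast
    then show ?case by (intro image_eqI[of _ _ "fword u"]) simp_all
  next
    case (inv h)
    then obtain u where u: "u \<in> U" "h = EC (fword u)" by blast
    then have "inv\<^bsub>add_monoid H.Q\<^esub> h = EC (- fword u)" using F[of "fword u"] by (simp add: EC_uminus a_inv_def)
    then show ?case using u by (intro image_eqI[of _ _ "- fword u"]) simp_all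
  next
    case (eng h1 h2)
    then obtain p q where "Poly_Mapping.keys p \<subseteq> U" "Poly_Mapping.keys q \<subseteq> U" "h1 = EC p" "h2 = EC q"
      by blast
    then show ?case using F keys_add[of p q] by (intro image_eqI[of _ _ "p + q"]) (auto simp: EC_add)
  qed
  then show "generate (add_monoid H.Q) ((\<lambda>u. EC (fword u)) ` U) \<subseteq> EC ` {p. Poly_Mapping.keys p \<subseteq> U}"
    by blast
next
  interpret A: group "add_monoid H.Q" using abelian_group.a_group[OF ring.is_abelian_group[OF H.Q_ring]] .
  have sub: "(\<lambda>u. EC (fword u)) ` U \<subseteq> carrier (add_monoid H.Q)"
    using U by (intro image_subsetI) (simp, intro EC_closed free_ring_closed(6), blast)
  interpret G: subgroup "generate (add_monoid H.Q) ((\<lambda>u. EC (fword u)) ` U)" "add_monoid H.Q"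
    by (rule A.generate_is_subgroup[OF sub])
  have "Poly_Mapping.keys p \<subseteq> U \<and> EC p \<in> generate (add_monoid H.Q) ((\<lambda>u. EC (fword u)) ` U)"
    if "Poly_Mapping.keys p \<subseteq> U" for p
    using that
  proof (induction p rule: fword_induct)
    case zero
    show ?case using G.one_closed by (simp add: EC_zero)
  next
    case (word u)
    then show ?case by (auto intro: generate.incl)
  next
    case (diff p q)
    then have F: "p \<in> P.F" "- q \<in> P.F" "q \<in> P.F" using U by (auto simp: carrier_free_ring simp del: in_lists_conv_set)
    have "EC (p - q) = EC p \<oplus>\<^bsub>H.Q\<^esub> \<ominus>\<^bsub>H.Q\<^esub> EC q"
      using EC_add[OF F(1,2)] F by (simp add: EC_uminus)
    then show ?case
      using diff keys_diff[of p q] G.m_closed[of "EC p" "inv\<^bsub>add_monoid H.Q\<^esub> EC q"] G.m_inv_closed[of "EC q"]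
      by (auto simp: a_inv_def)
  qed
  then show "EC ` {p. Poly_Mapping.keys p \<subseteq> U} \<subseteq> generate (add_monoid H.Q) ((\<lambda>u. EC (fword u)) ` U)"
    by blast
qed

lemma generate_ring_D:
  assumes T: "T \<subseteq> R"
  shows "generate_ring H.Q (D_hat I m ` T) = EC ` carrier (free_ring T)"
proof
  note F = free_ring_mono[OF T]
  have "x \<in> EC ` carrier (free_ring T)" if "x \<in> generate_ring H.Q (D_hat I m ` T)" for x
    using that
  proof induction
    case one
    show ?case by (intro image_eqI[of _ _ 1]) (simp_all add: EC_one)
  next
    case (incl h)
    then obtain t where "t \<in> T" "h = D_hat I m t" by blast
    then show ?case using T by (intro image_eqI[of _ _ "fword [t]"]) (auto simp: EC_letter intro: free_ring_closed)
  next
    case (a_inv h)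
    then obtain p where "p \<in> carrier (free_ring T)" "h = EC p" by blast
    then show ?case using F by (intro image_eqI[of _ _ "- p"]) (auto simp: EC_uminus)
  next
    case (eng_add h1 h2)
    then obtain p q where "p \<in> carrier (free_ring T)" "h1 = EC p" "q \<in> carrier (free_ring T)" "h2 = EC q" by blast
    then show ?case using F by (intro image_eqI[of _ _ "p + q"]) (auto simp: EC_add)
  next
    case (eng_mult h1 h2)
    then obtain p q where "p \<in> carrier (free_ring T)" "h1 = EC p" "q \<in> carrier (free_ring T)" "h2 = EC q" by blast
    then show ?case using F by (intro image_eqI[of _ _ "p * q"]) (auto simp: EC_mult)
  qed
  then show "generate_ring H.Q (D_hat I m ` T) \<subseteq> EC ` carrier (free_ring T)" by blast
next
  have word: "EC (fword u) \<in> generate_ring H.Q (D_hat I m ` T)" if "u \<in> lists T" for u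
  proof -
    have "u \<in> lists R" using that lists_mono[OF T] by blast
    then have "EC (fword u) = foldr (\<lambda>s x. D_hat I m s \<otimes>\<^bsub>H.Q\<^esub> x) u \<one>\<^bsub>H.Q\<^esub>" by (simp only: EC_word)
    also have "\<dots> \<in> generate_ring H.Q (D_hat I m ` T)"
      using that by (induction u) (auto intro: generate_ring.intros)
    finally show ?thesis .
  qed
  have "p \<in> carrier (free_ring T) \<and> EC p \<in> generate_ring H.Q (D_hat I m ` T)"
    if "Poly_Mapping.keys p \<subseteq> lists T" for p
    using that
  proof (induction p rule: fword_induct)
    case zero
    show ?case using ring.zero_in_generate[OF H.Q_ring] by (simp add: EC_zero)
  next
    case (diff p q)
    then have F: "p \<in> P.F" "- q \<in> P.F" "q \<in> P.F" using free_ring_mono[OF T] by auto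
    have "EC (p - q) = EC p \<oplus>\<^bsub>H.Q\<^esub> \<ominus>\<^bsub>H.Q\<^esub> EC q"
      using EC_add[OF F(1,2)] F by (simp add: EC_uminus)
    then show ?case using diff by (auto intro: generate_ring.intros)
  qed (use word free_ring_closed in blast)
  then show "EC ` carrier (free_ring T) \<subseteq> generate_ring H.Q (D_hat I m ` T)"
    by (auto simp: carrier_free_ring)
qed

subsection \<open>The simple relators lie in \<open>K\<^sub>i\<^sub>j\<close>\<close>

lemma parabolic_words: "w \<in> parabolic I m {a, b} \<Longrightarrow> a \<in> I \<Longrightarrow> b \<in> I \<Longrightarrow> \<exists>z\<in>lists {a, b}. w = cl z"
  unfolding parabolic_def
proof (induction rule: generate.induct)
  case one
  show ?case by (intro bexI[of _ "[]"]) (simp_all add: one_W)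
next
  case (incl h)
  then obtain k where "k \<in> {a, b}" "h = cl [k]" by (auto simp: g_cl)
  then show ?case by (intro bexI[of _ "[k]"]) simp_all
next
  case (inv h)
  then obtain k where "k \<in> {a, b}" "h = cl [k]" "k \<in> I" by (auto simp: g_cl)
  then show ?case by (intro bexI[of _ "[k]"]) (simp_all add: inv_W)
next
  case (eng h1 h2)
  then obtain y z where "y \<in> lists {a, b}" "z \<in> lists {a, b}" "h1 = cl y" "h2 = cl z" by blast
  moreover from this have "y \<in> L" "z \<in> L"
    using L_subset[of a b y] L_subset[of a b z] eng.prems by simp_all
  ultimately show ?case by (intro bexI[of _ "y @ z"]) (simp_all add: mult_W)
qed

lemma parabolic_gen: "k \<in> {a, b} \<Longrightarrow> g k \<in> parabolic I m {a, b}"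
  unfolding parabolic_def by (intro generate.incl) auto

lemma parabolic_c: "a \<in> I \<Longrightarrow> b \<in> I \<Longrightarrow> c a (g b) \<in> parabolic I m {a, b}"
  using parabolic_gen[of a a b] parabolic_gen[of b a b]
  unfolding parabolic_def c_def by (intro generate.eng) simp_all

lemma W_to_Hhat_cl:
  assumes "z \<in> L" shows "W_to_Hhat I m (cl z) = H.cls (S z)"
proof -
  have "Hhat_word I m (map SGen u) = H.cls (S z)" if "u \<in> cl z" for u
  proof -
    have "cox_eq I m z u" using that by (simp add: mem_cl)
    then have "weq (map SGen u) (map SGen z)" "u \<in> L"
      using weq_sym[OF weq_cox[of z u]] cox_eq_L[of z u] by simp_all
    then show ?thesis
      using assms map_SGen_closed[of u] map_SGen_closed[of z]
      by (simp add: Hhat_word_cls S_def cls_weq del: in_lists_conv_set)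
  qed
  moreover have "z \<in> cl z" using assms by (simp add: mem_cl L_def cox_eq.refl)
  ultimately have "(\<lambda>u. Hhat_word I m (map SGen u)) ` cl z = {H.cls (S z)}" by blast
  then show ?thesis by (simp add: W_to_Hhat_def)
qed

abbreviation "RP a b \<equiv> R \<inter> parabolic I m {a, b}"

text \<open>If a set Y of polynomials is stable, modulo the relations of Hhat(W), under conjugation
  by both generators, it is stable under the whole rank two group. Every conjugate of an element of
  Y then lies in Dhat(W_{a,b}).\<close>

lemma K_parabolic_intro:
  assumes ab: "a \<in> I" "b \<in> I" and Y: "Y \<subseteq> carrier (free_ring (RP a b))" and p: "p \<in> Y"
    and step: "\<And>p k. p \<in> Y \<Longrightarrow> k \<in> {a, b} \<Longrightarrow> \<exists>q\<in>Y. S [k] * E p * S [k] - E q \<in> H.N"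
  shows "EC p \<in> K_parabolic I m {a, b}"
  unfolding K_parabolic_def
proof (rule INT_I)
  fix w assume "w \<in> parabolic I m {a, b}"
  then obtain z where z: "z \<in> lists {a, b}" "w = cl z" using parabolic_words ab by blast
  have YF: "q \<in> P.F" if "q \<in> Y" for q using that Y free_ring_mono[of "RP a b"] by blast
  \<comment> \<open>Conjugation by the inverse of w: from w^-1 p w = q the required form p = w q
    w^-1 follows by conjugating back.\<close>
  have "\<exists>q\<in>Y. S (rev z) * E p * S z - E q \<in> H.N"
    using z(1)
  proof (induction z rule: rev_induct)
    case Nil
    show ?case using p by (intro bexI[of _ p]) (simp_all add: H.N_zero)
  next
    case (snoc k z)
    then obtain q where q: "q \<in> Y" "S (rev z) * E p * S z - E q \<in> H.N" by auto
    have k: "k \<in> {a, b}" "k \<in> I" using snoc ab by auto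
    obtain q' where q': "q' \<in> Y" "S [k] * E q * S [k] - E q' \<in> H.N" using step q k by blast
    have "S [k] * (S (rev z) * E p * S z - E q) * S [k] \<in> H.N"
      using q(2) k by (intro H.N_l H.N_r) simp_all
    then have "S [k] * (S (rev z) * E p * S z - E q) * S [k] + (S [k] * E q * S [k] - E q') \<in> H.N"
      using q' H.N_add by blast
    moreover have "S [k] * (S (rev z) * E p * S z - E q) * S [k] + (S [k] * E q * S [k] - E q')
        = S (rev (z @ [k])) * E p * S (z @ [k]) - E q'"
      using S_append[of "[k]" "rev z"] S_append[of z "[k]"] by (simp add: algebra_simps)
    ultimately show ?case using q'(1) by (intro bexI[of _ q']) simp_all
  qed
  then obtain q where q: "q \<in> Y" "S (rev z) * E p * S z - E q \<in> H.N" by blast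
  have zL: "z \<in> L" using z L_subset ab by blast
  have F: "E p \<in> H.F" "E q \<in> H.F" "S z \<in> H.F" "S (rev z) \<in> H.F"
    using E_closed YF p q zL by simp_all
  have N1: "S z * S (rev z) - 1 \<in> H.N" using S_rev zL by blast
  have "S z * (S (rev z) * E p * S z - E q) * S (rev z) \<in> H.N"
    "(S z * S (rev z) - 1) * (E p * (S z * S (rev z))) \<in> H.N" "E p * (S z * S (rev z) - 1) \<in> H.N"
    using H.N_r[OF H.N_l[OF q(2) F(3)] F(4)] H.N_l[OF N1 F(1)]
      H.N_r[OF N1 free_ring_mult_closed[OF F(1) free_ring_mult_closed[OF F(3,4)]]] by simp_all
  then have "(S z * S (rev z) - 1) * (E p * (S z * S (rev z))) + E p * (S z * S (rev z) - 1)
     - S z * (S (rev z) * E p * S z - E q) * S (rev z) \<in> H.N"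
    by (intro H.N_add H.N_diff)
  then have "S z * E q * S (rev z) - E p \<in> H.N" by (simp add: algebra_simps)
  then have "H.cls (S z * E q * S (rev z)) = EC p"
    unfolding EC_def using F by (subst H.cls_eq) auto
  moreover have "inv\<^bsub>W\<^esub> w = cl (rev z)" using z zL by (simp add: inv_W)
  ultimately have "EC p = W_to_Hhat I m w \<otimes>\<^bsub>H.Q\<^esub> EC q \<otimes>\<^bsub>H.Q\<^esub> W_to_Hhat I m (inv\<^bsub>W\<^esub> w)"
    using z zL F by (simp add: W_to_Hhat_cl EC_def H.cls_mult)
  moreover have "EC q \<in> Dhat_parabolic I m {a, b}"
    unfolding Dhat_parabolic_def Hhat_Q using generate_ring_D[of "RP a b"] q Y by blast
  ultimately show "EC p \<in> {W_to_Hhat I m w \<otimes>\<^bsub>Hhat I m\<^esub> x \<otimes>\<^bsub>Hhat I m\<^esub> W_to_Hhat I m (inv\<^bsub>W\<^esub> w) | x.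
      x \<in> Dhat_parabolic I m {a, b}}"
    unfolding Hhat_Q by blast
qed

lemma Dhat_deg_le:
  "Dhat_parabolic_deg_le I m {a, b} r = EC ` {p. Poly_Mapping.keys p \<subseteq> {u \<in> lists (RP a b). length u \<le> r}}"
proof -
  have sub: "{u \<in> lists (RP a b). length u \<le> r} \<subseteq> lists R" by auto
  have "{foldr (\<lambda>s x. D_hat I m s \<otimes>\<^bsub>H.Q\<^esub> x) ss \<one>\<^bsub>H.Q\<^esub> | ss. ss \<in> lists (RP a b) \<and> length ss \<le> r}
    = (\<lambda>u. EC (fword u)) ` {u \<in> lists (RP a b). length u \<le> r}"
    using EC_word sub by (auto simp del: in_lists_conv_set; blast)
  then show ?thesis
    unfolding Dhat_parabolic_deg_le_def Hhat_Q using generate_add[OF sub] by simp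
qed

lemma counit_EC: "p \<in> P.F \<Longrightarrow> counit (EC p) = free_counit (E p)"
  by (simp add: EC_def counit_cls E_closed)

lemma E_rel2: "E (rel2 s t) = d s * d t - d t * d s"
  and E_rel3: "E (rel3 s t r) = d s * d t - (d r * d s + d t * d r - d r)"
  by (simp_all add: rel2_def rel3_def E_simps)

lemma keys_rel:
  "Poly_Mapping.keys (rel2 s t) \<subseteq> {[s, t], [t, s]}"
  "Poly_Mapping.keys (rel3 s t r) \<subseteq> {[s, t], [r, s], [t, r], [r]}"
proof -
  show "Poly_Mapping.keys (rel2 s t) \<subseteq> {[s, t], [t, s]}"
    using keys_diff[of "fword [s, t]" "fword [t, s]"] by (auto simp: rel2_def)
  show "Poly_Mapping.keys (rel3 s t r) \<subseteq> {[s, t], [r, s], [t, r], [r]}"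
    unfolding rel3_def
    using keys_diff[of "fword [s, t]" "fword [r, s] + fword [t, r] - fword [r]"]
      keys_diff[of "fword [r, s] + fword [t, r]" "fword [r]"] keys_add[of "fword [r, s]" "fword [t, r]"]
    by auto
qed

lemma d_reflect:
  assumes "a \<in> I" "b \<in> I" "a \<noteq> b"
  shows "S [a] * d (g b) * S [a] - d (c a (g b)) \<in> H.N" "S [a] * d (c a (g b)) * S [a] - d (g b) \<in> H.N"
proof -
  show "S [a] * d (g b) * S [a] - d (c a (g b)) \<in> H.N" using d_c assms by (simp add: g_eq_iff)
  have "c a (g b) \<noteq> g a" using c_inj[of a "g b" "g a"] assms by (simp add: g_eq_iff)
  then show "S [a] * d (c a (g b)) * S [a] - d (g b) \<in> H.N" using d_c[of a "c a (g b)"] assms by simp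
qed

text \<open>Either generator exchanges the commutators for (a, b) and (b, a), so these two form the
  stable set. Two of the four congruences come from \<open>reflect_commute\<close>; the others are
  their negatives.\<close>

lemma rel2_K_pair:
  assumes "a \<in> I" "b \<in> I" "a \<noteq> b" "m a b = 2"
  shows "EC (rel2 (g a) (g b)) \<in> K_pair I m a b"
proof -
  have ca: "c a (g b) = g b" "c b (g a) = g a" using c_comm[of a b] c_comm[of b a] assms m_sym[of a b] by simp_all
  have mem: "g a \<in> RP a b" "g b \<in> RP a b" using assms parabolic_gen[of _ a b] by auto
  have F: "d (g a) \<in> H.F" "d (g b) \<in> H.F" "S [a] \<in> H.F" "S [b] \<in> H.F" using assms d by simp_all
  have "EC (rel2 (g a) (g b)) \<in> K_parabolic I m {a, b}"
  proof (rule K_parabolic_intro[where Y = "{rel2 (g a) (g b), rel2 (g b) (g a)}"])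
    show "{rel2 (g a) (g b), rel2 (g b) (g a)} \<subseteq> carrier (free_ring (RP a b))"
      using rel_closed(2)[OF mem] rel_closed(2)[OF mem(2,1)] by simp
    have 1: "S [a] * (d (g a) * d (g b) - d (g b) * d (g a)) * S [a] - (d (g b) * d (g a) - d (g a) * d (g b)) \<in> H.N"
      using assms d_reflect(1)[of a b] by (intro H.reflect_commute F S_square d_c_self) (simp_all add: ca)
    have 2: "S [b] * (d (g b) * d (g a) - d (g a) * d (g b)) * S [b] - (d (g a) * d (g b) - d (g b) * d (g a)) \<in> H.N"
      using assms d_reflect(1)[of b a] by (intro H.reflect_commute F S_square d_c_self) (simp_all add: ca)
    have neg: "S k * (x - y) * S k - (y - x) = - (S k * (y - x) * S k - (x - y))" for k x y
      by (simp add: algebra_simps)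
    have 3: "S [a] * (d (g b) * d (g a) - d (g a) * d (g b)) * S [a] - (d (g a) * d (g b) - d (g b) * d (g a)) \<in> H.N"
      using H.N_uminus[OF 1] by (subst neg)
    have 4: "S [b] * (d (g a) * d (g b) - d (g b) * d (g a)) * S [b] - (d (g b) * d (g a) - d (g a) * d (g b)) \<in> H.N"
      using H.N_uminus[OF 2] by (subst neg)
    show "\<exists>q\<in>{rel2 (g a) (g b), rel2 (g b) (g a)}. S [k] * E p * S [k] - E q \<in> H.N"
      if "p \<in> {rel2 (g a) (g b), rel2 (g b) (g a)}" "k \<in> {a, b}" for p k
      using that(1)
    proof (elim insertE emptyE)
      assume p: "p = rel2 (g a) (g b)"
      show ?thesis
        using that(2) 1 4 unfolding p by (intro bexI[of _ "rel2 (g b) (g a)"]) (auto simp: E_rel2)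
    next
      assume p: "p = rel2 (g b) (g a)"
      show ?thesis
        using that(2) 2 3 unfolding p by (intro bexI[of _ "rel2 (g a) (g b)"]) (auto simp: E_rel2)
    qed
  qed (use assms in auto)
  moreover have "rel2 (g a) (g b) \<in> P.F" using assms by (intro rel_closed) auto
  then have "counit (EC (rel2 (g a) (g b))) = 0"
    using assms free_counit_d by (simp add: counit_EC E_rel2 free_counit_simps)
  moreover have "EC (rel2 (g a) (g b)) \<in> Dhat_parabolic_deg_le I m {a, b} (m a b)"
    unfolding Dhat_deg_le using keys_rel(1)[of "g a" "g b"] mem assms(4) by (intro imageI) auto
  ultimately show ?thesis by (simp add: K_pair_def)
qed

text \<open>As in the commuting case, the relators for (a, b) and (b, a) with the common third
  reflection are exchanged by both generators.\<close>

lemma rel3_K_pair: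
  assumes "a \<in> I" "b \<in> I" "a \<noteq> b" "m a b = 3"
  shows "EC (rel3 (g a) (g b) (c a (g b))) \<in> K_pair I m a b"
proof -
  define t where "t = c a (g b)"
  have t: "c b (g a) = t" using c_braid[of a b] assms by (simp add: t_def)
  have mem: "g a \<in> RP a b" "g b \<in> RP a b" "t \<in> RP a b"
    using assms parabolic_gen[of _ a b] parabolic_c by (auto simp: t_def)
  have F: "d (g a) \<in> H.F" "d (g b) \<in> H.F" "d t \<in> H.F" "S [a] \<in> H.F" "S [b] \<in> H.F"
    using assms d mem by simp_all
  have 1: "S [a] * E (rel3 (g a) (g b) t) * S [a] - E (rel3 (g b) (g a) t) \<in> H.N"
    using assms d_reflect[of a b] unfolding E_rel3
    by (intro H.reflect_braid F S_square d_c_self) (simp_all add: t_def)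
  have 2: "S [b] * E (rel3 (g b) (g a) t) * S [b] - E (rel3 (g a) (g b) t) \<in> H.N"
    using assms d_reflect[of b a] unfolding E_rel3
    by (intro H.reflect_braid F S_square d_c_self) (simp_all add: t)
  \<comment> \<open>Conjugation by an involution is its own inverse, so the two congruences above
    yield those in the opposite direction.\<close>
  have undo: "S [k] * y * S [k] - x \<in> H.N"
    if "S [k] * x * S [k] - y \<in> H.N" "k \<in> I" "x \<in> H.F" for k x y
  proof -
    have F: "S [k] \<in> H.F" using that by simp
    have eq: "S [k] * y * S [k] - x = (S [k] * S [k] - 1) * (x * (S [k] * S [k])) + x * (S [k] * S [k] - 1)
        - S [k] * (S [k] * x * S [k] - y) * S [k]" by (simp add: algebra_simps)
    have "(S [k] * S [k] - 1) * (x * (S [k] * S [k])) \<in> H.N" "x * (S [k] * S [k] - 1) \<in> H.N"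
      "S [k] * (S [k] * x * S [k] - y) * S [k] \<in> H.N"
      using H.N_r[OF H.N_l[OF that(1) F] F] H.N_l[OF S_square[OF that(2)] that(3)]
        H.N_r[OF S_square[OF that(2)] free_ring_mult_closed[OF that(3) free_ring_mult_closed[OF F F]]]
      by simp_all
    then show ?thesis unfolding eq by (intro H.N_add H.N_diff)
  qed
  have rF: "rel3 (g a) (g b) t \<in> P.F" "rel3 (g b) (g a) t \<in> P.F" using assms mem by (auto intro!: rel_closed)
  note 3 = undo[OF 1 assms(1) E_closed[OF rF(1)]] undo[OF 2 assms(2) E_closed[OF rF(2)]]
  have "EC (rel3 (g a) (g b) t) \<in> K_parabolic I m {a, b}"
  proof (rule K_parabolic_intro[where Y = "{rel3 (g a) (g b) t, rel3 (g b) (g a) t}"])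
    show "{rel3 (g a) (g b) t, rel3 (g b) (g a) t} \<subseteq> carrier (free_ring (RP a b))"
      using rel_closed(3)[OF mem] rel_closed(3)[OF mem(2,1,3)] by simp
    show "\<exists>q\<in>{rel3 (g a) (g b) t, rel3 (g b) (g a) t}. S [k] * E p * S [k] - E q \<in> H.N"
      if "p \<in> {rel3 (g a) (g b) t, rel3 (g b) (g a) t}" "k \<in> {a, b}" for p k
      using that(1)
    proof (elim insertE emptyE)
      assume p: "p = rel3 (g a) (g b) t"
      show ?thesis
        using that(2) 1 3 unfolding p by (intro bexI[of _ "rel3 (g b) (g a) t"]) auto
    next
      assume p: "p = rel3 (g b) (g a) t"
      show ?thesis
        using that(2) 2 3 unfolding p by (intro bexI[of _ "rel3 (g a) (g b) t"]) auto
    qed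
  qed (use assms in auto)
  moreover have "counit (EC (rel3 (g a) (g b) t)) = 0"
    using assms rF mem free_counit_d by (simp add: counit_EC E_rel3 free_counit_simps)
  moreover have "EC (rel3 (g a) (g b) t) \<in> Dhat_parabolic_deg_le I m {a, b} (m a b)"
    unfolding Dhat_deg_le using keys_rel(2)[of "g a" "g b" t] mem assms(4) by (intro imageI) auto
  ultimately show ?thesis by (simp add: K_pair_def t_def)
qed

lemma K_pair_closed: "K_pair I m a b \<subseteq> carrier H.Q"
proof -
  have "p \<in> P.F" if "Poly_Mapping.keys p \<subseteq> {u \<in> lists (RP a b). length u \<le> r}" for p r
    using that by (auto simp: carrier_free_ring)
  then show ?thesis unfolding K_pair_def Dhat_deg_le by auto
qed

section \<open>The relators vanish in H(W)\<close>

abbreviation "J \<equiv> J_ideal I m"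

lemma J_ideal: "ideal J H.Q"
  unfolding J_ideal_def Hhat_Q using K_pair_closed by (intro ring.genideal_ideal[OF H.Q_ring]) blast

lemma K_pair_J: "a \<in> I \<Longrightarrow> b \<in> I \<Longrightarrow> a \<noteq> b \<Longrightarrow> K_pair I m a b \<subseteq> J"
  unfolding J_ideal_def Hhat_Q using ring.genideal_self[OF H.Q_ring, of "\<Union>i\<in>I. \<Union>j\<in>I - {i}. K_pair I m i j"] K_pair_closed
  by blast

text \<open>Both v and w v keep the root of k positive, so both elements are given by
  \<open>dword\<close>, and those words differ by conjugation with w.\<close>

lemma d_cj:
  assumes "w \<in> L" "v \<in> L" "k \<in> I" "\<not> nu v (g k)" "\<not> nu (w @ v) (g k)" "t = cj v (g k)"
  shows "d (cj w t) - S w * d t * S (rev w) \<in> H.N"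
proof -
  have eq: "d (cj w t) - S w * d t * S (rev w) =
    (d (cj (w @ v) (g k)) - fword (dword (w @ v) k)) - S w * (d t - fword (dword v k)) * S (rev w)"
    using assms(6) by (simp add: dword_append algebra_simps S_def fword_mult)
  have "S w * (d t - fword (dword v k)) * S (rev w) \<in> H.N"
    using assms d_dword[of v k] by (intro H.N_l H.N_r) simp_all
  moreover have "d (cj (w @ v) (g k)) - fword (dword (w @ v) k) \<in> H.N"
    using assms by (intro d_dword) simp_all
  ultimately show ?thesis unfolding eq using H.N_diff by blast
qed

lemma conj_J:
  assumes "w \<in> L" "E p - S w * E q * S (rev w) \<in> H.N" "EC q \<in> J" "p \<in> P.F" "q \<in> P.F"
  shows "EC p \<in> J"
proof -
  interpret ideal J H.Q by (rule J_ideal)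
  have "EC p = H.cls (S w * E q * S (rev w))"
    unfolding EC_def using assms E_closed by (subst H.cls_eq) auto
  also have "\<dots> = H.cls (S w) \<otimes>\<^bsub>H.Q\<^esub> EC q \<otimes>\<^bsub>H.Q\<^esub> H.cls (S (rev w))"
    using assms E_closed by (simp add: EC_def H.cls_mult)
  finally show ?thesis using assms I_l_closed I_r_closed by auto
qed

text \<open>The idempotent relators vanish already in Hhat(W). A compatible pair is (w s_a w^-1, w
  s_b w^-1) with w inverting neither root, so its relator is the conjugate by w of a relator of
  simple reflections.\<close>

lemma rels_J:
  assumes "r \<in> rels" shows "EC r \<in> J"
proof -
  from assms consider (1) s where "s \<in> R" "r = rel1 s"
    | (2) s s' where "compatible I m s s'" "cox_order I m s s' = 2" "r = rel2 s s'"
    | (3) s s' where "compatible I m s s'" "cox_order I m s s' = 3" "r = rel3 s s' (s \<otimes>\<^bsub>W\<^esub> s' \<otimes>\<^bsub>W\<^esub> s)"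
    unfolding rels_def by blast
  then show ?thesis
  proof cases
    case (1 s)
    then have "E r \<in> H.N" using d_idem by (simp add: rel1_def E_simps)
    then have "EC r = \<zero>\<^bsub>H.Q\<^esub>"
      using rels_closed assms E_closed H.cls_eq_zero by (auto simp: EC_def)
    then show ?thesis using J_ideal by (simp add: additive_subgroup.zero_closed ideal.axioms(1))
  next
    case (2 s s')
    from 2(1) show ?thesis
    proof (rule compatible_cases)
      fix w a b
      assume w: "w \<in> L" "a \<in> I" "b \<in> I" "a \<noteq> b" "s = cj w (g a)" "s' = cj w (g b)"
        "\<not> nu w (g a)" "\<not> nu w (g b)" "cox_order I m s s' = m a b"
      have da: "d s - S w * d (g a) * S (rev w) \<in> H.N" "d s' - S w * d (g b) * S (rev w) \<in> H.N"
        using d_cj[of w "[]" a] d_cj[of w "[]" b] w by simp_all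
      have F: "S w \<in> H.F" "S (rev w) \<in> H.F" "d (g a) \<in> H.F" "d (g b) \<in> H.F" "d s \<in> H.F" "d s' \<in> H.F"
        using w d by simp_all
      have inv: "S (rev w) * S w - 1 \<in> H.N" using S_rev[of "rev w"] w by simp
      note cm = H.N_conj_mult'[OF inv F(1,2)]
      have "(d s * d s' - S w * (d (g a) * d (g b)) * S (rev w)) -
          (d s' * d s - S w * (d (g b) * d (g a)) * S (rev w)) \<in> H.N"
        using cm[OF F(3,4,5,6) da] cm[OF F(4,3,6,5) da(2,1)] by (rule H.N_diff)
      then have "E r - S w * E (rel2 (g a) (g b)) * S (rev w) \<in> H.N"
        unfolding 2 E_rel2 by (simp add: algebra_simps)
      moreover have "EC (rel2 (g a) (g b)) \<in> J" using rel2_K_pair[of a b] K_pair_J[of a b] w 2 by auto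
      moreover have "rel2 (g a) (g b) \<in> P.F" using w by (intro rel_closed) auto
      ultimately show ?thesis using conj_J w rels_closed assms by blast
    qed
  next
    case (3 s s')
    from 3(1) show ?thesis
    proof (rule compatible_cases)
      fix w a b
      assume w: "w \<in> L" "a \<in> I" "b \<in> I" "a \<noteq> b" "s = cj w (g a)" "s' = cj w (g b)"
        "\<not> nu w (g a)" "\<not> nu w (g b)" "cox_order I m s s' = m a b"
        "s \<otimes>\<^bsub>W\<^esub> s' \<otimes>\<^bsub>W\<^esub> s = cj w (c a (g b))"
      define t where "t = c a (g b)"
      \<comment> \<open>The third reflection has to be transported by w without a change of sign as
        well; this is where \<open>braid_noninversion\<close> enters.\<close>
      have t: "\<not> nu w t" "t \<in> R" "cj w t \<in> R" using braid_noninversion[of w a b] w 3 by (auto simp: t_def)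
      have "\<not> nu (w @ [a]) (g b)" using t w by (auto simp: nu_append t_def g_eq_iff)
      then have dt: "d (cj w t) - S w * d t * S (rev w) \<in> H.N"
        using d_cj[of w "[a]" b t] w by (simp add: t_def g_eq_iff)
      have da: "d s - S w * d (g a) * S (rev w) \<in> H.N" "d s' - S w * d (g b) * S (rev w) \<in> H.N"
        using d_cj[of w "[]" a] d_cj[of w "[]" b] w by simp_all
      have F: "S w \<in> H.F" "S (rev w) \<in> H.F" "d (g a) \<in> H.F" "d (g b) \<in> H.F" "d s \<in> H.F" "d s' \<in> H.F"
        "d t \<in> H.F" "d (cj w t) \<in> H.F"
        using w d t by simp_all
      have inv: "S (rev w) * S w - 1 \<in> H.N" using S_rev[of "rev w"] w by simp
      note cm = H.N_conj_mult'[OF inv F(1,2)]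
      have "(d s * d s' - S w * (d (g a) * d (g b)) * S (rev w))
          - (d (cj w t) * d s - S w * (d t * d (g a)) * S (rev w))
          - (d s' * d (cj w t) - S w * (d (g b) * d t) * S (rev w))
          + (d (cj w t) - S w * d t * S (rev w)) \<in> H.N"
        using cm[OF F(3,4,5,6) da] cm[OF F(7,3,8,5) dt da(1)] cm[OF F(4,7,6,8) da(2) dt] dt
        by (intro H.N_add[OF H.N_diff[OF H.N_diff]])
      then have "E r - S w * E (rel3 (g a) (g b) t) * S (rev w) \<in> H.N"
        unfolding 3 E_rel3 w(10) t_def[symmetric] by (simp add: algebra_simps)
      moreover have "EC (rel3 (g a) (g b) t) \<in> J"
        using rel3_K_pair[of a b] K_pair_J[of a b] w 3 by (auto simp: t_def)
      moreover have "rel3 (g a) (g b) t \<in> P.F" using w t by (intro rel_closed) auto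
      ultimately show ?thesis using conj_J w rels_closed assms by blast
    qed
  qed
qed

section \<open>An action of \<open>Hhat(W)\<close> on the presented algebra\<close>

lemma compatible2:
  assumes "compatible I m s t" "cox_order I m s t = 2"
  shows "s \<otimes>\<^bsub>W\<^esub> t \<otimes>\<^bsub>W\<^esub> s = t" "t \<otimes>\<^bsub>W\<^esub> s \<otimes>\<^bsub>W\<^esub> t = s"
proof -
  obtain w a b where w: "w \<in> L" "a \<in> I" "b \<in> I" "s = cj w (g a)" "t = cj w (g b)" "m a b = 2"
    "s \<otimes>\<^bsub>W\<^esub> t \<otimes>\<^bsub>W\<^esub> s = cj w (c a (g b))"
    using compatible_cases[OF assms(1)] assms(2) by metis
  have "c a (g b) = g b" "c b (g a) = g a" using c_comm[of a b] c_comm[of b a] m_sym[of a b] w by simp_all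
  moreover have "t \<otimes>\<^bsub>W\<^esub> s \<otimes>\<^bsub>W\<^esub> t = cj w (c b (g a))" unfolding c_def using w by (simp add: cj_mult)
  ultimately show "s \<otimes>\<^bsub>W\<^esub> t \<otimes>\<^bsub>W\<^esub> s = t" "t \<otimes>\<^bsub>W\<^esub> s \<otimes>\<^bsub>W\<^esub> t = s" using w by simp_all
qed

text \<open>The last clause matters most: the third reflection is never simple, so in applying s_i
  to a relator only s or t can be the exceptional letter \<open>g i\<close>.\<close>

lemma compatible3:
  assumes "compatible I m s t" "cox_order I m s t = 3"
  shows "cox_order I m t s = 3" "t \<otimes>\<^bsub>W\<^esub> s \<otimes>\<^bsub>W\<^esub> t = s \<otimes>\<^bsub>W\<^esub> t \<otimes>\<^bsub>W\<^esub> s"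
    "i \<in> I \<Longrightarrow> s \<otimes>\<^bsub>W\<^esub> t \<otimes>\<^bsub>W\<^esub> s \<noteq> g i"
proof -
  obtain w a b where w: "w \<in> L" "a \<in> I" "b \<in> I" "a \<noteq> b" "s = cj w (g a)" "t = cj w (g b)" "m a b = 3"
    "\<not> nu w (g a)" "\<not> nu w (g b)" "s \<otimes>\<^bsub>W\<^esub> t \<otimes>\<^bsub>W\<^esub> s = cj w (c a (g b))"
    using compatible_cases[OF assms(1)] assms(2) by metis
  show "cox_order I m t s = 3" using w order_conj[of w "g b" "g a"] order_gen[of b a] m_sym[of a b] by simp
  have "t \<otimes>\<^bsub>W\<^esub> s \<otimes>\<^bsub>W\<^esub> t = cj w (c b (g a))" unfolding c_def using w by (simp add: cj_mult)
  then show "t \<otimes>\<^bsub>W\<^esub> s \<otimes>\<^bsub>W\<^esub> t = s \<otimes>\<^bsub>W\<^esub> t \<otimes>\<^bsub>W\<^esub> s" using w c_braid[of a b] by simp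
  show "s \<otimes>\<^bsub>W\<^esub> t \<otimes>\<^bsub>W\<^esub> s \<noteq> g i" if "i \<in> I"
    using braid_not_simple[of w a b i] w that by simp
qed

lemma c_mult: "i \<in> I \<Longrightarrow> s \<in> carrier W \<Longrightarrow> t \<in> carrier W \<Longrightarrow> c i (s \<otimes>\<^bsub>W\<^esub> t) = c i s \<otimes>\<^bsub>W\<^esub> c i t"
  using cj_mult[of "[i]" s t] by simp

lemma order_c: "i \<in> I \<Longrightarrow> s \<in> carrier W \<Longrightarrow> t \<in> carrier W \<Longrightarrow>
    cox_order I m (c i s) (c i t) = cox_order I m s t"
  using order_conj[of "[i]" s t] by simp

abbreviation "f t \<equiv> fword [t :: 'i list set]"

text \<open>\<open>s\<^sub>i\<close> acts on the free ring by the commutation rules with the \<open>D\<^sub>t\<close> and by the scalar \<open>e\<close>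
  on \<open>1\<close>. The two characters \<open>e = 1\<close> and \<open>e = -1\<close> of \<open>W\<close> together separate the coefficients
  of \<open>1\<close> and \<open>s\<^sub>i\<close>.\<close>

primrec Tw :: "int \<Rightarrow> 'i \<Rightarrow> 'i list set list \<Rightarrow> 'i list set list \<Rightarrow>\<^sub>0 int" where
  "Tw e i [] = of_int e"
| "Tw e i (t # u) = (if t = g i then Tw e i u - fword u - f t * Tw e i u else f (c i t) * Tw e i u)"

definition T :: "int \<Rightarrow> 'i \<Rightarrow> ('i list set list \<Rightarrow>\<^sub>0 int) \<Rightarrow> 'i list set list \<Rightarrow>\<^sub>0 int" where
  "T e i p = frag_extend (Tw e i) p"

lemma T_simps: "T e i 0 = 0" "T e i (p - q) = T e i p - T e i q" "T e i (p + q) = T e i p + T e i q"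
    "T e i 1 = of_int e" "T e i (- p) = - T e i p"
  by (simp_all add: T_def frag_extend_diff frag_extend_add frag_extend_minus)

lemma T_of_int: "T e i (of_int n * p) = of_int n * T e i p"
  by (simp add: T_def frag_extend_of_int)

lemma T_self: "T e i (f (g i) * p) = T e i p - p - f (g i) * T e i p"
proof (induction p rule: fword_induct[OF subset_UNIV])
  case (2 u)
  show ?case by (simp add: T_def fword_mult)
next
  case (3 p q)
  then show ?case by (simp only: right_diff_distrib T_simps) (simp add: algebra_simps)
qed (simp add: T_simps)

lemma T_other: "t \<noteq> g i \<Longrightarrow> T e i (f t * p) = f (c i t) * T e i p"
proof (induction p rule: fword_induct[OF subset_UNIV])
  case (2 u)
  then show ?case by (simp add: T_def fword_mult)
qed (simp_all add: T_simps right_diff_distrib)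

lemma T_closed:
  assumes "i \<in> I" "p \<in> P.F"
  shows "T e i p \<in> P.F"
proof -
  have w: "Tw e i u \<in> P.F" if "u \<in> lists R" for u
    using that
  proof (induction u)
    case (Cons t u)
    have F: "f t \<in> P.F" "f (c i t) \<in> P.F" "fword u \<in> P.F"
      using Cons assms by (intro free_ring_closed; simp)+
    have "Tw e i u \<in> P.F" using Cons by simp
    with F have "Tw e i u - fword u - f t * Tw e i u \<in> P.F \<and> f (c i t) * Tw e i u \<in> P.F"
      by (intro conjI free_ring_closed(5) free_ring_mult_closed)
    then show ?case by (cases "t = g i") simp_all
  qed auto
  have "Poly_Mapping.keys p \<subseteq> lists R" using assms by (simp add: carrier_free_ring)
  then show ?thesis
    by (induction p rule: fword_induct) (use w in \<open>simp_all add: T_def frag_extend_diff free_ring_closed\<close>)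
qed

text \<open>Additive operators are compared on 1 and then letter by letter from the left, which
  matches the recursive rules \<open>T_self\<close> and \<open>T_other\<close>.\<close>

lemma operator_eqI:
  assumes "p \<in> P.F" "F1 0 = F2 0" "\<And>p q. F1 (p - q) = F1 p - F1 q" "\<And>p q. F2 (p - q) = F2 p - F2 q"
    "F1 1 = F2 1" "\<And>t u. t \<in> R \<Longrightarrow> u \<in> lists R \<Longrightarrow> F1 (fword u) = F2 (fword u) \<Longrightarrow>
      F1 (f t * fword u) = F2 (f t * fword u)"
  shows "F1 p = (F2 p :: 'i list set list \<Rightarrow>\<^sub>0 int)"
proof -
  have w: "F1 (fword u) = F2 (fword u)" if "u \<in> lists R" for u
    using that
  proof (induction u)
    case (Cons t u)
    then have "F1 (f t * fword u) = F2 (f t * fword u)" using assms(6)[of t u] by simp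
    then show ?case by (simp only: fword_split[symmetric])
  qed (simp add: fword_Nil assms(5))
  have "Poly_Mapping.keys p \<subseteq> lists R" using assms by (simp add: carrier_free_ring)
  then show ?thesis by (induction p rule: fword_induct) (simp_all only: assms w)
qed

lemma c_eq_iff: "i \<in> I \<Longrightarrow> t \<in> R \<Longrightarrow> s \<in> R \<Longrightarrow> c i t = s \<longleftrightarrow> t = c i s"
  using c_c[of i t] c_c[of i s] reflections_closed by auto

text \<open>This and the commutation and braid laws below are equalities in the free ring: W acts
  there, before any relation among the letters is imposed.\<close>

lemma T_square:
  assumes "e * e = 1" "i \<in> I" "p \<in> P.F"
  shows "T e i (T e i p) = p"
proof (rule operator_eqI[OF assms(3)])
  show "T e i (T e i 1) = 1"
    using T_of_int[of e i e 1] assms(1) by (simp add: T_simps flip: of_int_mult)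
  fix t u assume t: "t \<in> R" and IH: "T e i (T e i (fword u)) = fword u"
  show "T e i (T e i (f t * fword u)) = f t * fword u"
  proof (cases "t = g i")
    case True
    then show ?thesis by (simp add: T_self T_simps IH algebra_simps)
  next
    case False
    then have "c i t \<noteq> g i" using c_eq_iff[of i t "g i"] assms t by simp
    then show ?thesis using False assms t reflections_closed by (simp add: T_other IH)
  qed
qed (simp_all add: T_simps)

lemma T_commute:
  assumes ij: "i \<in> I" "j \<in> I" "i \<noteq> j" "m i j = 2" and "p \<in> P.F"
  shows "T e i (T e j p) = T e j (T e i p)"
proof (rule operator_eqI[OF \<open>p \<in> P.F\<close>])
  have cg: "c i (g j) = g j" "c j (g i) = g i" "g i \<noteq> g j" "g j \<noteq> g i"
    using c_comm[of i j] c_comm[of j i] m_sym[of i j] ij by (simp_all add: g_eq_iff)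
  show "T e i (T e j 1) = T e j (T e i 1)"
    using T_of_int[of e i e 1] T_of_int[of e j e 1] by (simp add: T_simps)
  fix t u assume t: "t \<in> R" and IH: "T e i (T e j (fword u)) = T e j (T e i (fword u))"
  consider "t = g i" | "t = g j" | "t \<noteq> g i" "t \<noteq> g j" by blast
  then show "T e i (T e j (f t * fword u)) = T e j (T e i (f t * fword u))"
  proof cases
    case 1
    then show ?thesis using cg by (simp add: T_self T_other T_simps IH)
  next
    case 2
    then show ?thesis using cg by (simp add: T_self T_other T_simps IH)
  next
    case 3
    have "c i t \<noteq> g j" "c j t \<noteq> g i" using 3 c_eq_iff[of i t "g j"] c_eq_iff[of j t "g i"] ij t cg by simp_all
    moreover have "c i (c j t) = c j (c i t)"
    proof -
      have "cl ([i, j, i] @ [i]) = cl ([j] @ [i])"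
        using cg ij cl_cong[of "[i, j, i]" "[j]" "[]" "[i]"] by (simp add: g_cl c_cl)
      moreover have "cl ([i, j] @ [i, i] @ []) = cl ([i, j] @ [] @ [])"
        using cl_square[of i] ij by (intro cl_cong) simp_all
      ultimately have "cl [i, j] = cl [j, i]" by simp
      then show ?thesis using cj_cong[of "[i, j]" "[j, i]" t] ij t reflections_closed by simp
    qed
    ultimately show ?thesis using 3 by (simp add: T_other IH)
  qed
qed (simp_all add: T_simps)

lemma T_braid:
  assumes ij: "i \<in> I" "j \<in> I" "i \<noteq> j" "m i j = 3" and e: "e * e = 1" and "p \<in> P.F"
  shows "T e i (T e j (T e i p)) = T e j (T e i (T e j p))"
proof (rule operator_eqI[OF \<open>p \<in> P.F\<close>])
  define r where "r = c i (g j)"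
  have cg: "c i (g j) = r" "c j (g i) = r" "c i r = g j" "c j r = g i"
    using c_braid[OF ij(1,2,4)] c_c_braid[OF ij(1,2,4)] c_c[of j "g i"] ij by (simp_all add: r_def)
  have ne: "g i \<noteq> g j" "g j \<noteq> g i" "r \<noteq> g i" "r \<noteq> g j"
    using c_braid_neq[OF ij(1,2,4,3)] ij by (simp_all add: g_eq_iff r_def)
  have rR: "r \<in> R" using ij by (simp add: r_def)
  show "T e i (T e j (T e i 1)) = T e j (T e i (T e j 1))"
    using T_of_int[of e i e 1] T_of_int[of e j e 1] T_of_int[of e i e "of_int e"] T_of_int[of e j e "of_int e"]
    by (simp add: T_simps)
  fix t u assume t: "t \<in> R" "u \<in> lists R"
    and IH: "T e i (T e j (T e i (fword u))) = T e j (T e i (T e j (fword u)))"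
  have u: "fword u \<in> P.F" "T e i (fword u) \<in> P.F" "T e j (fword u) \<in> P.F"
    using t ij by (auto intro!: T_closed free_ring_closed)
  note sq = T_square[OF e ij(1) u(1)] T_square[OF e ij(2) u(1)]
  consider "t = g i" | "t = g j" | "t = r" | "t \<noteq> g i" "t \<noteq> g j" "t \<noteq> r" by blast
  then show "T e i (T e j (T e i (f t * fword u))) = T e j (T e i (T e j (f t * fword u)))"
  proof cases
    case 1
    show ?thesis unfolding 1 using cg ne by (simp add: T_self T_other T_simps IH)
  next
    case 2
    show ?thesis unfolding 2 using cg ne by (simp add: T_self T_other T_simps IH)
  next
    \<comment> \<open>Here r passes through both simple reflections, and the sides produce
      \<open>T e i (T e i u)\<close> and \<open>T e j (T e j u)\<close> for the remaining word u;
      both equal u.\<close>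
    case 3
    show ?thesis unfolding 3 using cg ne by (simp add: T_self T_other T_simps IH sq)
  next
    case 4
    have i: "c i t \<noteq> g j" "c i t \<noteq> r" and j: "c j t \<noteq> g i" "c j t \<noteq> r"
      using 4 c_eq_iff[of i t] c_eq_iff[of j t] ij t cg rR by simp_all
    have "c j (c i t) \<noteq> g i" "c i (c j t) \<noteq> g j"
      using i j c_eq_iff[of j "c i t"] c_eq_iff[of i "c j t"] ij t cg rR by simp_all
    moreover have "c i (c j (c i t)) = c j (c i (c j t))"
      using cj_cong[OF cl_braid[OF ij(1,2,4)], of t] ij t reflections_closed by simp
    ultimately show ?thesis using 4 i j by (simp add: T_other IH)
  qed
qed (simp_all add: T_simps)

lemma rel_mult:
  "rel1 s * p = f s * (f s * p) - f s * p"
  "rel2 s t * p = f s * (f t * p) - f t * (f s * p)"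
  "rel3 s t r * p = f s * (f t * p) - (f r * (f s * p) + f t * (f r * p) - f r * p)"
proof -
  have f2: "fword [x, y] * p = f x * (f y * p)" for x y
    using fword_split[of x "[y]"] by (simp add: mult.assoc)
  show "rel1 s * p = f s * (f s * p) - f s * p"
    "rel2 s t * p = f s * (f t * p) - f t * (f s * p)"
    "rel3 s t r * p = f s * (f t * p) - (f r * (f s * p) + f t * (f r * p) - f r * p)"
    by (simp_all add: rel1_def rel2_def rel3_def left_diff_distrib distrib_right f2)
qed

text \<open>The computation of \<open>reflect_braid\<close> at the level of operators: moving s_i
  past a relator turns it into a relator for the conjugated pair, or, if \<open>g i\<close> is one
  of its two reflections, into one for the exchanged pair. The terms free of \<open>T e i p\<close>
  cancel.\<close>

lemma rels_conj:
  assumes "r \<in> rels" "i \<in> I"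
  shows "\<exists>r' \<in> P.N. \<forall>p. T e i (r * p) = r' * T e i p"
proof -
  from assms consider (1) s where "s \<in> R" "r = rel1 s"
    | (2) s t where "compatible I m s t" "cox_order I m s t = 2" "r = rel2 s t"
    | (3) s t where "compatible I m s t" "cox_order I m s t = 3" "r = rel3 s t (s \<otimes>\<^bsub>W\<^esub> t \<otimes>\<^bsub>W\<^esub> s)"
    unfolding rels_def by blast
  then show ?thesis
  proof cases
    case (1 s)
    have N: "rel1 s' \<in> P.N" if "s' \<in> R" for s' using that by (intro P.N_rel) (auto simp: rels_def)
    show ?thesis
    proof (cases "s = g i")
      case True
      have "T e i (r * p) = rel1 s * T e i p" for p
        unfolding 1 True rel_mult by (simp add: T_self T_simps algebra_simps)
      then show ?thesis using N 1 by blast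
    next
      case False
      have "T e i (r * p) = rel1 (c i s) * T e i p" for p
        unfolding 1 rel_mult using False
        by (simp add: T_other T_simps algebra_simps)
      then show ?thesis using N[of "c i s"] 1 assms by auto
    qed
  next
    case (2 s t)
    have st: "s \<in> R" "t \<in> R" "s \<noteq> t" using compatible_reflections 2 by blast+
    note cc = compatible2[OF 2(1,2)]
    have N: "rel2 s t \<in> P.N" using 2 by (intro P.N_rel) (auto simp: rels_def)
    consider "s = g i" | "t = g i" | "s \<noteq> g i" "t \<noteq> g i" by blast
    then show ?thesis
    proof cases
      case a: 1
      then have "t \<noteq> g i" "c i t = t" using cc st by (auto simp: c_def)
      then have "T e i (r * p) = - rel2 s t * T e i p" for p
        unfolding 2 a mult_minus_left rel_mult
        by (simp add: T_self T_other T_simps algebra_simps)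
      then show ?thesis using P.N_uminus[OF N] by blast
    next
      case a: 2
      then have "s \<noteq> g i" "c i s = s" using cc st by (auto simp: c_def)
      then have "T e i (r * p) = - rel2 s t * T e i p" for p
        unfolding 2 a mult_minus_left rel_mult
        by (simp add: T_self T_other T_simps algebra_simps)
      then show ?thesis using P.N_uminus[OF N] by blast
    next
      case a: 3
      then have "T e i (r * p) = rel2 (c i s) (c i t) * T e i p" for p
        unfolding 2 rel_mult
        by (simp add: T_other T_simps algebra_simps)
      moreover have "compatible I m (c i s) (c i t)" "cox_order I m (c i s) (c i t) = 2"
        using compatible_conj[OF 2(1) assms(2) a] order_c[of i s t] 2 assms st reflections_closed by simp_all
      then have "rel2 (c i s) (c i t) \<in> P.N" by (intro P.N_rel) (auto simp: rels_def)
      ultimately show ?thesis by blast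
    qed
  next
    case (3 s t)
    have st: "s \<in> R" "t \<in> R" "s \<noteq> t" using compatible_reflections 3 by blast+
    define q where "q = s \<otimes>\<^bsub>W\<^esub> t \<otimes>\<^bsub>W\<^esub> s"
    have q: "q \<noteq> g i" "q \<in> R" "t \<otimes>\<^bsub>W\<^esub> s \<otimes>\<^bsub>W\<^esub> t = q" "cox_order I m t s = 3"
      using compatible3[OF 3(1,2)] compatible_third[OF 3(1)] assms by (simp_all add: q_def)
    have r: "r = rel3 s t q" using 3 by (simp add: q_def)
    have N: "rel3 t s q \<in> P.N"
      using compatible_sym[OF 3(1)] q by (intro P.N_rel) (auto simp: rels_def)
    consider "s = g i" | "t = g i" | "s \<noteq> g i" "t \<noteq> g i" by blast
    then show ?thesis
    proof cases
      case a: 1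
      then have c: "t \<noteq> g i" "c i t = q" "c i q = t" using c_c[of i t] st assms reflections_closed by (auto simp: c_def q_def)
      have "T e i (r * p) = rel3 t s q * T e i p" for p
        unfolding r rel_mult using c q(1)
        by (simp add: a T_self T_other T_simps algebra_simps)
      then show ?thesis using N by blast
    next
      case a: 2
      then have c: "s \<noteq> g i" "c i s = q" "c i q = s" using c_c[of i s] st assms q(3) reflections_closed by (auto simp: c_def)
      have "T e i (r * p) = rel3 t s q * T e i p" for p
        unfolding r rel_mult using c q(1)
        by (simp add: a T_self T_other T_simps algebra_simps)
      then show ?thesis using N by blast
    next
      case a: 3
      then have "T e i (r * p) = rel3 (c i s) (c i t) (c i q) * T e i p" for p
        unfolding r rel_mult using q(1)
        by (simp add: T_other T_simps algebra_simps)
      moreover have "compatible I m (c i s) (c i t)" "cox_order I m (c i s) (c i t) = 3"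
        using compatible_conj[OF 3(1) assms(2) a] order_c[of i s t] 3 assms st reflections_closed by simp_all
      moreover have "c i q = c i s \<otimes>\<^bsub>W\<^esub> c i t \<otimes>\<^bsub>W\<^esub> c i s"
        using st assms reflections_closed by (simp add: q_def c_mult)
      ultimately have "rel3 (c i s) (c i t) (c i q) \<in> P.N"
        by (intro P.N_rel) (auto simp: rels_def)
      then show ?thesis using \<open>\<And>p. T e i (r * p) = rel3 (c i s) (c i t) (c i q) * T e i p\<close> by blast
    qed
  qed
qed

lemma f_closed: "t \<in> R \<Longrightarrow> f t \<in> P.F"
  by (intro free_ring_closed) simp

text \<open>Letters to the left of a relator are peeled off by \<open>T_self\<close> and
  \<open>T_other\<close>. The former also produces the untransformed element, so membership of both
  elements is carried through the induction.\<close>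

lemma T_N:
  assumes "x \<in> P.N" "i \<in> I"
  shows "T e i x \<in> P.N"
  using assms(1)
proof (induction rule: P.N_induct)
  case (rel u v r)
  have v: "fword v \<in> P.F" using rel by (intro free_ring_closed)
  have "fword u * r * fword v \<in> P.N \<and> T e i (fword u * r * fword v) \<in> P.N"
    using rel(1)
  proof (induction u)
    case Nil
    obtain r' where r': "r' \<in> P.N" "\<forall>p. T e i (r * p) = r' * T e i p"
      using rels_conj[OF rel(3) assms(2), of e] by blast
    then show ?case
      using P.N_r[OF P.N_rel[OF rel(3)] v] P.N_r[OF r'(1) T_closed[OF assms(2) v]] by (simp add: fword_Nil)
  next
    case (Cons t u)
    let ?x = "fword u * r * fword v"
    have eq: "fword (t # u) * r * fword v = f t * ?x" by (subst fword_split) (simp add: mult.assoc)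
    have x: "?x \<in> P.N" "T e i ?x \<in> P.N" using Cons by auto
    have F: "f t \<in> P.F" "f (c i t) \<in> P.F" using f_closed Cons assms by simp_all
    have "T e i (f t * ?x) \<in> P.N"
    proof (cases "t = g i")
      case True
      then show ?thesis unfolding True T_self
        using P.N_diff[OF P.N_diff[OF x(2,1)] P.N_l[OF x(2) f_closed[of "g i"]]] assms by simp
    next
      case False
      then show ?thesis using P.N_l[OF x(2) F(2)] by (simp add: T_other)
    qed
    then show ?case unfolding eq using P.N_l[OF x(1) F(1)] by simp
  qed
  then show ?case ..
qed (simp_all add: T_simps P.N_zero P.N_diff)

section \<open>The module structure on the presented algebra\<close>

primrec actw :: "int \<Rightarrow> 'i gen list \<Rightarrow> ('i list set list \<Rightarrow>\<^sub>0 int) \<Rightarrow> 'i list set list \<Rightarrow>\<^sub>0 int" where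
  "actw e [] v = v"
| "actw e (y # x) v = (case y of SGen i \<Rightarrow> T e i (actw e x v) | DGen i \<Rightarrow> f (g i) * actw e x v)"

definition act :: "int \<Rightarrow> ('i gen list \<Rightarrow>\<^sub>0 int) \<Rightarrow> ('i list set list \<Rightarrow>\<^sub>0 int) \<Rightarrow> 'i list set list \<Rightarrow>\<^sub>0 int" where
  "act e x v = frag_extend (\<lambda>u. actw e u v) x"

lemma actw_append: "actw e (u @ w) v = actw e u (actw e w v)"
  by (induction u) (simp_all split: gen.split)

lemma actw_diff: "actw e u (v - w) = actw e u v - actw e u w"
  by (induction u) (simp_all add: T_simps right_diff_distrib split: gen.split)

lemma actw_zero: "actw e u 0 = 0"
  using actw_diff[of e u 0 0] by simp

lemma act_simps:
  "act e (fword u) v = actw e u v" "act e 0 v = 0" "act e (x - y) v = act e x v - act e y v"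
  "act e (x + y) v = act e x v + act e y v" "act e 1 v = v"
  by (simp_all add: act_def frag_extend_diff frag_extend_add)

lemma act_mult: "act e (x * y) v = act e x (act e y v)"
proof (induction x rule: fword_induct[OF subset_UNIV])
  case (2 u)
  show ?case
    by (induction y rule: fword_induct[OF subset_UNIV])
      (simp_all add: fword_mult act_simps actw_append actw_zero actw_diff right_diff_distrib)
qed (simp_all add: act_simps left_diff_distrib)

lemma actw_closed:
  assumes "u \<in> lists G" "v \<in> P.F"
  shows "actw e u v \<in> P.F"
  using assms(1)
proof (induction u)
  case (Cons y u)
  then show ?case using f_closed T_closed by (cases y) auto
qed (use assms in simp)

lemma act_closed:
  assumes "x \<in> H.F" "v \<in> P.F"
  shows "act e x v \<in> P.F"
proof -
  have "Poly_Mapping.keys x \<subseteq> lists G" using assms by (simp add: carrier_free_ring)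
  then show ?thesis
    by (induction x rule: fword_induct) (use assms actw_closed in \<open>simp_all add: act_simps free_ring_closed\<close>)
qed

lemma act_N_right:
  assumes "x \<in> H.F" "v \<in> P.N"
  shows "act e x v \<in> P.N"
proof -
  have w: "actw e u v \<in> P.N" if "u \<in> lists G" for u
    using that
  proof (induction u)
    case (Cons y u)
    then show ?case using P.N_l[OF _ f_closed] T_N by (cases y) auto
  qed (use assms in simp)
  have "Poly_Mapping.keys x \<subseteq> lists G" using assms by (simp add: carrier_free_ring)
  then show ?thesis
    by (induction x rule: fword_induct) (use w in \<open>simp_all add: act_simps P.N_zero P.N_diff\<close>)
qed

text \<open>The relators coming from the group, the mixed relation and the braid relations
  annihilate the free ring outright. The idempotent relator acts as left multiplication by
  \<open>rel1 (g i)\<close>, which lies in the ideal.\<close>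

lemma act_relator:
  assumes e: "e * e = 1" and "r \<in> Hhat_relators I m" "v \<in> P.F"
  shows "act e r v \<in> P.N"
proof -
  note v = \<open>v \<in> P.F\<close>
  have pres: "T e i v' \<in> P.F" if "i \<in> I" "v' \<in> P.F" for i v' using T_closed that by blast
  have 1: "act e (fword [SGen i, SGen i] - 1) v \<in> P.N" if "i \<in> I" for i
    using T_square[OF e that v] by (simp add: act_simps P.N_zero)
  have 2: "act e (fword [DGen i, DGen i] - fword [DGen i]) v \<in> P.N" if "i \<in> I" for i
  proof -
    have "act e (fword [DGen i, DGen i] - fword [DGen i]) v = rel1 (g i) * v"
      by (simp add: act_simps rel_mult)
    moreover have "rel1 (g i) \<in> P.N" using that by (intro P.N_rel) (auto simp: rels_def)
    ultimately show ?thesis using P.N_r v by simp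
  qed
  have 3: "act e ((fword [SGen i, DGen i] + fword [DGen i, SGen i]) - (fword [SGen i] - 1)) v \<in> P.N" for i
    by (simp add: act_simps T_self P.N_zero)
  have 4: "act e (fword (concat (replicate (m i j) [SGen i, SGen j])) - 1) v \<in> P.N" if "i \<in> I" "j \<in> I" for i j
  proof (cases "i = j")
    case True
    then show ?thesis using 1 that by (simp add: m_one)
  next
    case False
    from that False show ?thesis
    proof (cases rule: m_cases)
      case m: 1
      then show ?thesis by (simp add: fword_Nil act_simps P.N_zero)
    next
      case m: 2
      have "T e i (T e j (T e i (T e j v))) = v"
        using T_commute[OF that False m v, of e] T_square[OF e] pres that v by simp
      then show ?thesis using m by (simp add: act_simps P.N_zero numeral_eq_Suc)
    next
      case m: 3
      have "T e i (T e j (T e i (T e j (T e i (T e j v))))) = v"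
        using T_braid[OF that False m e, of "T e j (T e i (T e j v))"] T_square[OF e] pres that v by simp
      then show ?thesis using m by (simp add: act_simps P.N_zero numeral_eq_Suc)
    qed
  qed
  have 5: "act e (fword (DGen i # map SGen (alternating j i (m i j - 1)))
        - fword (map SGen (alternating j i (m i j - 1)) @ [DGen (if even (m i j) then i else j)])) v \<in> P.N"
    if "i \<in> I" "j \<in> I" "i \<noteq> j" "m i j \<noteq> 0" for i j
    using that(1-3)
  proof (cases rule: m_cases)
    case m: 2
    have "c j (g i) = g i" "g i \<noteq> g j" using c_comm[of j i] m_sym[of i j] m that by (simp_all add: g_eq_iff)
    then show ?thesis using m by (simp add: alternating_def act_simps T_other P.N_zero)
  next
    case m: 3
    have "c i (g j) \<noteq> g j" "c j (c i (g j)) = g i" "g j \<noteq> g i"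
      using c_braid_neq[OF that(1,2) m that(3)] c_braid[OF that(1,2) m] c_c[of j "g i"] that by (simp_all add: g_eq_iff)
    then show ?thesis using m by (simp add: alternating_def upt_rec act_simps T_other P.N_zero)
  qed (use that in simp)
  show ?thesis
    using assms(2) unfolding Hhat_relators_def
    by (elim UnE CollectE exE conjE; hypsubst) (simp_all only: 1 2 3 4 5 not_False_eq_True)
qed

lemma act_N:
  assumes e: "e * e = 1" and "x \<in> H.N" "v \<in> P.F"
  shows "act e x v \<in> P.N"
  using assms(2)
proof (induction rule: H.N_induct)
  case (rel u w r)
  have F: "fword u \<in> H.F" "fword w \<in> H.F" using free_ring_closed(6)[OF rel(1)] free_ring_closed(6)[OF rel(2)] by simp_all
  have "act e r (act e (fword w) v) \<in> P.N"
    using act_relator[OF e rel(3) act_closed[OF F(2) assms(3)]] .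
  then show ?case using act_N_right[OF F(1)] by (simp add: act_mult)
qed (simp_all add: act_simps P.N_zero P.N_diff)

lemma act_cong:
  assumes "e * e = 1" "x - y \<in> H.N" "v \<in> P.F"
  shows "act e x v - act e y v \<in> P.N"
  using act_N[OF assms] by (simp add: act_simps)

text \<open>Simple reflections act this way by definition; conjugating by s_i moves the statement
  along, since \<open>T_other\<close> turns the letter t into \<open>c i t\<close> and the two
  operators \<open>T e i\<close> cancel.\<close>

lemma act_d:
  assumes e: "e * e = 1" and "t \<in> R" "v \<in> P.F"
  shows "act e (d t) v - f t * v \<in> P.N"
  using assms(2,3)
proof (induction arbitrary: v rule: reflections_induct)
  case (gen i)
  then show ?case using act_cong[OF e d_g[of i] gen(2)] by (simp add: act_simps)
next
  case (conj i t)
  have Tv: "T e i v \<in> P.F" using T_closed conj by blast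
  have S: "act e (S [i]) w = T e i w" for w by (simp add: S_def act_simps)
  have "T e i (act e (d t) (T e i v) - f t * T e i v) \<in> P.N"
    using T_N conj.IH[OF Tv] conj by blast
  then have "act e (S [i] * d t * S [i]) v - f (c i t) * v \<in> P.N"
    using conj T_square[OF e] by (simp add: act_mult S T_simps T_other)
  moreover have "act e (S [i] * d t * S [i]) v - act e (d (c i t)) v \<in> P.N"
    using act_cong[OF e d_c] conj by blast
  ultimately show ?case using P.N_trans P.N_sym by blast
qed

text \<open>The case v = 1 recovers a polynomial, modulo the relations, from its image in
  Hhat(W).\<close>

lemma act_E:
  assumes e: "e * e = 1" and "p \<in> P.F" "v \<in> P.F"
  shows "act e (E p) v - p * v \<in> P.N"
proof -
  have w: "act e (E (fword u)) v - fword u * v \<in> P.N" if "u \<in> lists R" for u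
    using that
  proof (induction u)
    case (Cons t u)
    have F: "fword u * v \<in> P.F" "act e (E (fword u)) v \<in> P.F"
      using assms Cons E_fword_closed act_closed by (auto intro!: free_ring_closed free_ring_mult_closed)
    have t: "t \<in> R" using Cons by simp
    have "act e (d t) (act e (E (fword u)) v) - f t * act e (E (fword u)) v \<in> P.N"
      using act_d[OF e t F(2)] .
    moreover have "f t * (act e (E (fword u)) v - fword u * v) \<in> P.N"
      using Cons f_closed by (intro P.N_l) auto
    ultimately have "act e (d t) (act e (E (fword u)) v) - f t * (fword u * v) \<in> P.N"
      using P.N_trans by (simp add: right_diff_distrib)
    moreover have "E (fword (t # u)) = d t * E (fword u)" by (simp add: E_simps)
    ultimately show ?case by (subst fword_split) (simp add: act_mult mult.assoc)
  qed (simp add: E_simps act_simps fword_Nil P.N_zero)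
  have "Poly_Mapping.keys p \<subseteq> lists R" using assms by (simp add: carrier_free_ring)
  then show ?thesis
  proof (induction p rule: fword_induct)
    case (diff p q)
    have "act e (E (p - q)) v - (p - q) * v = (act e (E p) v - p * v) - (act e (E q) v - q * v)"
      by (simp add: E_simps act_simps algebra_simps)
    then show ?case using diff P.N_diff by simp
  next
    case (word u)
    then show ?case by (rule w)
  qed (simp add: E_simps act_simps P.N_zero)
qed

section \<open>Characters and rank two normal forms\<close>

text \<open>The character sending every D_t to z, its integer values written as constants of the
  free ring.\<close>

definition chi :: "int \<Rightarrow> ('i list set list \<Rightarrow>\<^sub>0 int) \<Rightarrow> 'i list set list \<Rightarrow>\<^sub>0 int" where
  "chi z p = frag_extend (\<lambda>u. of_int (z ^ length u)) p"

lemma chi_simps: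
  "chi z (p - q) = chi z p - chi z q" "chi z (p + q) = chi z p + chi z q" "chi z (p * q) = chi z p * chi z q"
  "chi z (fword u) = of_int (z ^ length u)" "chi z 1 = 1" "chi z 0 = 0" "chi z (- p) = - chi z p"
  by (simp_all add: chi_def frag_extend_diff frag_extend_add frag_extend_mult frag_extend_minus power_add)

lemma chi_of_int: "chi z (of_int n) = of_int n"
  using frag_extend_of_int[of "\<lambda>u. of_int (z ^ length u)" n "1 :: 'i list set list \<Rightarrow>\<^sub>0 int"]
  by (simp add: chi_def)

text \<open>For idempotent z the braid relation becomes z z = z z + z z - z, which holds; the
  commutation relation is trivial.\<close>

lemma chi_N:
  assumes "z * z = z" "x \<in> P.N"
  shows "chi z x = 0"
  using assms(2)
proof (induction rule: P.N_induct)
  case (rel u v r)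
  have "(of_int z :: 'i list set list \<Rightarrow>\<^sub>0 int) * of_int z = of_int z"
    using assms(1) by (simp flip: of_int_mult)
  then have "chi z r = 0"
    using rel(3) unfolding rels_def
    by (elim UnE CollectE exE conjE; hypsubst)
      (simp_all add: rel1_def rel2_def rel3_def chi_simps assms(1))
  then show ?case by (simp add: chi_simps)
qed (simp_all add: chi_simps)

lemma chi_E:
  assumes "p \<in> P.F"
  shows "chi 0 p = of_int (free_counit (E p))"
proof -
  have w: "free_counit (E (fword u)) = 0 ^ length u" if "u \<in> lists R" for u
    using that by (induction u) (simp_all add: E_simps free_counit_simps free_counit_d)
  have "Poly_Mapping.keys p \<subseteq> lists R" using assms by (simp add: carrier_free_ring)
  then show ?thesis
  proof (induction p rule: fword_induct)
    case zero
    show ?case using free_counit_simps(1)[of 0 0] by (simp add: chi_simps E_simps)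
  next
    case (word u)
    then show ?case using w by (simp add: chi_simps)
  next
    case (diff p q)
    then show ?case by (simp add: chi_simps E_simps free_counit_simps)
  qed
qed

section \<open>Integral combinations modulo the relations\<close>

inductive_set spanN :: "('i list set list \<Rightarrow>\<^sub>0 int) set \<Rightarrow> ('i list set list \<Rightarrow>\<^sub>0 int) set"
  for B where
  N: "x \<in> P.N \<Longrightarrow> x \<in> spanN B"
| base: "b \<in> B \<Longrightarrow> b \<in> spanN B"
| diff: "x \<in> spanN B \<Longrightarrow> y \<in> spanN B \<Longrightarrow> x - y \<in> spanN B"

lemma spanN_uminus: "x \<in> spanN B \<Longrightarrow> - x \<in> spanN B"
  using spanN.diff[OF spanN.N[OF P.N_zero], of x B] by simp

lemma spanN_add: "x \<in> spanN B \<Longrightarrow> y \<in> spanN B \<Longrightarrow> x + y \<in> spanN B"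
  using spanN.diff[OF _ spanN_uminus[of y B], of x] by simp

lemma spanN_cong: "x - y \<in> P.N \<Longrightarrow> y \<in> spanN B \<Longrightarrow> x \<in> spanN B"
  using spanN_add[OF spanN.N, of "x - y" y B] by simp

lemma spanN_mult:
  assumes "x \<in> spanN B" "h \<in> P.F" "\<And>b. b \<in> B \<Longrightarrow> h * b \<in> spanN B'"
  shows "h * x \<in> spanN B'"
  using assms(1)
proof induction
  case (N x)
  then show ?case using P.N_l assms(2) by (intro spanN.N)
qed (use assms(3) spanN.diff in \<open>auto simp: right_diff_distrib\<close>)

lemma spanN_words:
  assumes "Poly_Mapping.keys p \<subseteq> U" "\<And>u. u \<in> U \<Longrightarrow> fword u \<in> spanN B"
  shows "p \<in> spanN B"
  using assms(1)
  by (induction p rule: fword_induct) (use assms(2) spanN.diff in \<open>auto intro: spanN.N P.N_zero\<close>)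

text \<open>Coefficients are indexed by positions in a list, so that for a concrete list the sum
  unfolds into explicit terms.\<close>

lemma spanN_coeffs:
  assumes "x \<in> spanN (set bs)"
  shows "\<exists>k. x - (\<Sum>i<length bs. of_int (k i) * bs ! i) \<in> P.N"
  using assms
proof induction
  case (N x)
  then show ?case by (intro exI[of _ "\<lambda>_. 0"]) simp
next
  case (base b)
  then obtain n where n: "n < length bs" "b = bs ! n" by (auto simp: in_set_conv_nth)
  have "(\<Sum>i<length bs. of_int (if i = n then 1 else 0) * bs ! i) = (\<Sum>i<length bs. if i = n then bs ! i else 0)"
    by (intro sum.cong) auto
  also have "\<dots> = b" using n by simp
  finally show ?case by (intro exI[of _ "\<lambda>i. if i = n then 1 else 0"]) (simp add: P.N_zero)
next
  case (diff x y)
  then obtain k l where "x - (\<Sum>i<length bs. of_int (k i) * bs ! i) \<in> P.N"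
    "y - (\<Sum>i<length bs. of_int (l i) * bs ! i) \<in> P.N" by blast
  from P.N_diff[OF this] show ?case
    by (intro exI[of _ "\<lambda>i. k i - l i"]) (simp add: left_diff_distrib sum_subtractf algebra_simps)
qed

text \<open>\<open>-2\<close> times the coefficient of \<open>s\<^sub>i\<close> in \<open>s\<^sub>i x s\<^sub>i\<close>.\<close>

definition TT :: "'i \<Rightarrow> ('i list set list \<Rightarrow>\<^sub>0 int) \<Rightarrow> 'i list set list \<Rightarrow>\<^sub>0 int" where
  "TT i x = T 1 i x + T (- 1) i x"

lemma TT_N: "x \<in> P.N \<Longrightarrow> i \<in> I \<Longrightarrow> TT i x \<in> P.N"
  unfolding TT_def by (intro P.N_add T_N)

lemma T_letter: "T e i (f (g i)) = of_int e - 1 - f (g i) * of_int e"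
  "t \<noteq> g i \<Longrightarrow> T e i (f t) = f (c i t) * of_int e" "T e i (of_int n) = of_int n * of_int e"
  using T_self[of e i 1] T_other[of t i e 1] T_of_int[of e i n 1] by (simp_all add: T_simps)

lemma TT_linear: "TT i (p - q) = TT i p - TT i q" "TT i (p + q) = TT i p + TT i q"
  "TT i (of_int n * p) = of_int n * TT i p" "TT i (of_int n) = 0"
  by (simp_all add: TT_def T_simps T_of_int T_letter distrib_left)

lemma N_chi: "x \<in> P.N \<Longrightarrow> chi 0 x = 0 \<and> chi 1 x = 0"
  by (simp add: chi_N)

lemma of_int_merge: "of_int k * (of_int n * x) = of_int (k * n) * (x :: 'i list set list \<Rightarrow>\<^sub>0 int)"
    "of_int k * of_int n = (of_int (k * n) :: 'i list set list \<Rightarrow>\<^sub>0 int)"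
  by (simp_all add: mult.assoc)

lemmas chi_eval = chi_simps(2,3,4) chi_of_int of_int_add[symmetric] of_int_mult[symmetric] of_int_eq_0_iff

text \<open>\<open>TT i\<close> kills every monomial without the letter \<open>g i\<close> and turns
  that letter into the factor -2. The characters with z = 0 and z = 1 then yield -2 ka = 0 and -2
  (ka + kab) = 0.\<close>

lemma coefficients_commute:
  assumes "i \<in> I" "j \<in> I" "i \<noteq> j" "m i j = 2"
    and x: "TT i (of_int k0 + of_int ka * f (g i) + of_int kb * f (g j) + of_int kab * (f (g i) * f (g j))) \<in> P.N"
  shows "ka = 0" "kab = 0"
proof -
  have cg: "c i (g j) = g j" "g j \<noteq> g i" using c_comm assms by (simp_all add: g_eq_iff)
  have TTs: "TT i (f (g i)) = of_int (- 2)" "TT i (f (g j)) = 0" "TT i (f (g i) * f (g j)) = of_int (- 2) * f (g j)"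
    using cg by (simp_all add: TT_def T_self T_other T_letter mult_2 mult_2_right algebra_simps)
  have y: "of_int (ka * (- 2)) + of_int (kab * (- 2)) * f (g j) \<in> P.N"
    using x by (simp only: TT_linear TTs of_int_merge mult_zero_right add_0_left add_0_right)
  have "ka = 0 \<and> kab = 0" using N_chi[OF y] by (simp only: chi_eval) simp
  then show "ka = 0" "kab = 0" by simp_all
qed

text \<open>One application of \<open>TT i\<close> leaves five unknowns, too many for two
  characters. Applying \<open>TT j\<close> and then \<open>TT i\<close> again reduces them to three
  and to one; the equations are solved from the last one back.\<close>

lemma coefficients_braid:
  assumes "i \<in> I" "j \<in> I" "i \<noteq> j" "m i j = 3" and r: "r = c i (g j)"
    and x: "TT i (of_int k0 + of_int ka * f (g i) + of_int kb * f (g j) + of_int kc * f r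
      + of_int kac * (f (g i) * f r) + of_int kbc * (f (g j) * f r)
      + of_int kca * (f r * f (g i)) + of_int kcb * (f r * f (g j))
      + of_int kacb * (f (g i) * (f r * f (g j)))
      + of_int kcac * (f r * (f (g i) * f r)) + of_int kcbc * (f r * (f (g j) * f r))) \<in> P.N"
  shows "ka = 0" "kac = 0" "kca = 0" "kacb = 0" "kcac = 0"
proof -
  have cg: "c i (g j) = r" "c j (g i) = r" "c i r = g j" "c j r = g i"
    using c_braid[OF assms(1,2,4)] c_c_braid[OF assms(1,2,4)] c_c[of j "g i"] assms by (simp_all add: r)
  have ne: "g i \<noteq> g j" "g j \<noteq> g i" "r \<noteq> g i" "r \<noteq> g j"
    using c_braid_neq[OF assms(1,2,4,3)] assms by (simp_all add: g_eq_iff r)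
  note TTs = TT_def T_self T_other T_letter T_simps cg ne mult_2 mult_2_right algebra_simps
  have 1: "TT i (f (g i)) = of_int (- 2)" "TT i (f (g j)) = 0" "TT i (f r) = 0"
    "TT i (f (g i) * f r) = of_int (- 2) * f r" "TT i (f (g j) * f r) = 0"
    "TT i (f r * f (g i)) = of_int (- 2) * f (g j)" "TT i (f r * f (g j)) = 0"
    "TT i (f (g i) * (f r * f (g j))) = of_int (- 2) * (f r * f (g j))"
    "TT i (f r * (f (g i) * f r)) = of_int (- 2) * (f (g j) * f r)"
    "TT i (f r * (f (g j) * f r)) = 0"
    by (simp_all add: TTs)
  have 2: "TT j (f (g j)) = of_int (- 2)" "TT j (f r) = 0"
    "TT j (f r * f (g j)) = of_int (- 2) * f (g i)" "TT j (f (g j) * f r) = of_int (- 2) * f r"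
    by (simp_all add: TTs)
  note ev = TT_linear of_int_merge mult_zero_right add_0_left add_0_right
  have y: "of_int (ka * (- 2)) + of_int (kac * (- 2)) * f r + of_int (kca * (- 2)) * f (g j)
    + of_int (kacb * (- 2)) * (f r * f (g j)) + of_int (kcac * (- 2)) * (f (g j) * f r) \<in> P.N"
    using x by (simp only: ev 1)
  have w: "of_int (kca * (- 2) * (- 2)) + of_int (kacb * (- 2) * (- 2)) * f (g i)
    + of_int (kcac * (- 2) * (- 2)) * f r \<in> P.N"
    using TT_N[OF y assms(2)] by (simp only: ev 2)
  have v: "of_int (kacb * (- 2) * (- 2) * (- 2)) \<in> P.N"
    using TT_N[OF w assms(1)] by (simp only: ev 1)
  show kacb: "kacb = 0" using N_chi[OF v] by (simp only: chi_eval) simp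
  have kca: "kca = 0 \<and> kcac = 0" using N_chi[OF w] by (simp only: chi_eval) (simp add: kacb)
  then show "kca = 0" "kcac = 0" by simp_all
  have "ka = 0 \<and> kac = 0" using N_chi[OF y] by (simp only: chi_eval) (simp add: kacb kca)
  then show "ka = 0" "kac = 0" by simp_all
qed

lemma rel2_N: "i \<in> I \<Longrightarrow> j \<in> I \<Longrightarrow> i \<noteq> j \<Longrightarrow> m i j = 2 \<Longrightarrow> rel2 (g i) (g j) \<in> P.N"
  and rel3_N: "i \<in> I \<Longrightarrow> j \<in> I \<Longrightarrow> i \<noteq> j \<Longrightarrow> m i j = 3 \<Longrightarrow> rel3 (g i) (g j) (c i (g j)) \<in> P.N"
  and rel1_N: "t \<in> R \<Longrightarrow> rel1 t \<in> P.N"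
proof -
  have comp: "compatible I m (g i) (g j)" if "i \<in> I" "j \<in> I" "i \<noteq> j"
    unfolding compatible_iff using that
    by (intro conjI bexI[of _ "[]"] bexI[of _ i] bexI[of _ j]) (simp_all add: g_eq_iff)
  show "rel2 (g i) (g j) \<in> P.N" if "i \<in> I" "j \<in> I" "i \<noteq> j" "m i j = 2"
    using comp order_gen[of i j] that by (intro P.N_rel) (auto simp: rels_def)
  show "rel3 (g i) (g j) (c i (g j)) \<in> P.N" if "i \<in> I" "j \<in> I" "i \<noteq> j" "m i j = 3"
    using comp order_gen[of i j] that by (intro P.N_rel) (auto simp: rels_def c_def)
  show "rel1 t \<in> P.N" if "t \<in> R" using that by (intro P.N_rel) (auto simp: rels_def)
qed

lemma rel_eq: "rel1 s = f s * f s - f s" "rel2 s t = f s * f t - f t * f s"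
  "rel3 s t r = f s * f t - (f r * f s + f t * f r - f r)"
  using rel_mult(1)[of s 1] rel_mult(2)[of s t 1] rel_mult(3)[of s t r 1] by simp_all

lemma short_words_commute:
  assumes "i \<in> I" "j \<in> I" "i \<noteq> j" "m i j = 2" "u \<in> lists {g i, g j}" "length u \<le> 2"
  shows "fword u \<in> spanN (set [1, f (g i), f (g j), f (g i) * f (g j)])"
proof -
  let ?a = "f (g i)" and ?b = "f (g j)" and ?B = "set [1, f (g i), f (g j), f (g i) * f (g j)]"
  have r: "?a * ?a - ?a \<in> P.N" "?b * ?b - ?b \<in> P.N" "?b * ?a - ?a * ?b \<in> P.N"
    using rel1_N[of "g i"] rel1_N[of "g j"] P.N_uminus[OF rel2_N[OF assms(1-4)]] assms(1,2) by (simp_all add: rel_eq)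
  have B: "1 \<in> spanN ?B" "?a \<in> spanN ?B" "?b \<in> spanN ?B" "?a * ?b \<in> spanN ?B"
    by (intro spanN.base; simp)+
  have B': "?a * ?a \<in> spanN ?B" "?b * ?b \<in> spanN ?B" "?b * ?a \<in> spanN ?B"
    using spanN_cong[OF r(1) B(2)] spanN_cong[OF r(2) B(3)] spanN_cong[OF r(3) B(4)] by simp_all
  consider "u = []" | s where "u = [s]" "s \<in> {g i, g j}" | s t where "u = [s, t]" "s \<in> {g i, g j}" "t \<in> {g i, g j}"
    using assms(5,6) by (cases u; cases "tl u"; cases "tl (tl u)") auto
  then show ?thesis
  proof cases
    case (3 s t)
    then show ?thesis using B B' by (auto simp: fword_split[of _ "[_]"])
  qed (use B in \<open>auto simp: fword_Nil\<close>)
qed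

text \<open>The relations eliminate ab and ba, leaving four words of length two besides squares. In
  length three the overlaps of the rewriting rules give further identities, after which only acb,
  cac and cbc remain.\<close>

lemma short_words_braid:
  assumes ij: "i \<in> I" "j \<in> I" "i \<noteq> j" "m i j = 3" and r: "r = c i (g j)"
    and u: "u \<in> lists {g i, g j, r}" "length u \<le> 3"
  shows "fword u \<in> spanN (set [1, f (g i), f (g j), f r, f (g i) * f r, f (g j) * f r, f r * f (g i), f r * f (g j),
      f (g i) * (f r * f (g j)), f r * (f (g i) * f r), f r * (f (g j) * f r)])"
proof -
  define a b c' where abc: "a = f (g i)" "b = f (g j)" "c' = f r"
  have F: "a \<in> P.F" "b \<in> P.F" "c' \<in> P.F" using f_closed ij by (simp_all add: abc r)
  have r': "c j (g i) = r" using c_braid[OF ij(1,2,4)] by (simp add: r)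
  have A2: "a * a - a \<in> P.N" and B2: "b * b - b \<in> P.N" and C2: "c' * c' - c' \<in> P.N"
    using rel1_N[of "g i"] rel1_N[of "g j"] rel1_N[of r] ij by (simp_all add: rel_eq abc r)
  have r1: "a * b - (c' * a + b * c' - c') \<in> P.N" and r2: "b * a - (c' * b + a * c' - c') \<in> P.N"
    using rel3_N[of i j] rel3_N[of j i] ij m_sym[of i j] by (simp_all add: rel_eq abc r r'[unfolded r])
  have 1: "a * (b * c') - (c' * (a * c') + b * c' - c') \<in> P.N"
  proof -
    have "a * (b * c') - (c' * (a * c') + b * c' - c') =
      (a * b - (c' * a + b * c' - c')) * c' + b * (c' * c' - c') - (c' * c' - c')" by (simp add: algebra_simps)
    then show ?thesis using P.N_diff[OF P.N_add[OF P.N_r[OF r1 F(3)] P.N_l[OF C2 F(2)]] C2] by (simp only:)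
  qed
  have 2: "b * (a * c') - (c' * (b * c') + a * c' - c') \<in> P.N"
  proof -
    have "b * (a * c') - (c' * (b * c') + a * c' - c') =
      (b * a - (c' * b + a * c' - c')) * c' + a * (c' * c' - c') - (c' * c' - c')" by (simp add: algebra_simps)
    then show ?thesis using P.N_diff[OF P.N_add[OF P.N_r[OF r2 F(3)] P.N_l[OF C2 F(1)]] C2] by (simp only:)
  qed
  \<comment> \<open>From the overlap aab: a(ab) is expanded by the relation for ab, while (aa)b is
    just ab.\<close>
  have 3: "a * (c' * a) - (a * c' + c' * a - c' * (a * c')) \<in> P.N"
  proof -
    have "a * (c' * a) - (a * c' + c' * a - c' * (a * c')) =
      ((a * a - a) * b - a * (a * b - (c' * a + b * c' - c'))) + ((a * b - (c' * a + b * c' - c'))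
      - (a * b - (c' * a + b * c' - c')) * c') - (b * (c' * c' - c') - (c' * c' - c'))" by (simp add: algebra_simps)
    moreover have "\<dots> \<in> P.N"
      by (rule P.N_diff[OF P.N_add[OF P.N_diff[OF P.N_r[OF A2 F(2)] P.N_l[OF r1 F(1)]]
          P.N_diff[OF r1 P.N_r[OF r1 F(3)]]] P.N_diff[OF P.N_l[OF C2 F(2)] C2]])
    ultimately show ?thesis by (simp only:)
  qed
  have 4: "b * (c' * b) - (b * c' + c' * b - c' * (b * c')) \<in> P.N"
  proof -
    have "b * (c' * b) - (b * c' + c' * b - c' * (b * c')) =
      ((b * b - b) * a - b * (b * a - (c' * b + a * c' - c'))) + ((b * a - (c' * b + a * c' - c'))
      - (b * a - (c' * b + a * c' - c')) * c') - (a * (c' * c' - c') - (c' * c' - c'))" by (simp add: algebra_simps)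
    moreover have "\<dots> \<in> P.N"
      by (rule P.N_diff[OF P.N_add[OF P.N_diff[OF P.N_r[OF B2 F(1)] P.N_l[OF r2 F(2)]]
          P.N_diff[OF r2 P.N_r[OF r2 F(3)]]] P.N_diff[OF P.N_l[OF C2 F(1)] C2]])
    ultimately show ?thesis by (simp only:)
  qed
  \<comment> \<open>From the overlap aba: (ab)a reduces to bca, while a(ba) reduces to acb.\<close>
  have 5: "b * (c' * a) - a * (c' * b) \<in> P.N"
  proof -
    have "b * (c' * a) - a * (c' * b) = (a * (b * a - (c' * b + a * c' - c')) + (a * a - a) * c')
      - ((a * b - (c' * a + b * c' - c')) * a + c' * (a * a - a))" by (simp add: algebra_simps)
    moreover have "\<dots> \<in> P.N"
      by (rule P.N_diff[OF P.N_add[OF P.N_l[OF r2 F(1)] P.N_r[OF A2 F(3)]]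
          P.N_add[OF P.N_r[OF r1 F(1)] P.N_l[OF A2 F(3)]]])
    ultimately show ?thesis by (simp only:)
  qed
  have sq: "h * (h * x) - h * x \<in> P.N" if "h * h - h \<in> P.N" "x \<in> P.F" for h x
    using P.N_r[OF that] by (simp add: algebra_simps)
  define B0 where "B0 = {1, a, b, c'}"
  define B1 where "B1 = {1, a, b, c', a * c', b * c', c' * a, c' * b}"
  define B where "B = set [1, a, b, c', a * c', b * c', c' * a, c' * b, a * (c' * b), c' * (a * c'), c' * (b * c')]"
  have s1: "h * x \<in> spanN B1" if "h \<in> {a, b, c'}" "x \<in> B0" for h x
  proof -
    have bs: "1 \<in> spanN B1" "a \<in> spanN B1" "b \<in> spanN B1" "c' \<in> spanN B1" "a * c' \<in> spanN B1"
      "b * c' \<in> spanN B1" "c' * a \<in> spanN B1" "c' * b \<in> spanN B1"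
      by (intro spanN.base; simp add: B1_def)+
    moreover have "a * a \<in> spanN B1" using spanN_cong[OF A2] bs by blast
    moreover have "b * b \<in> spanN B1" using spanN_cong[OF B2] bs by blast
    moreover have "c' * c' \<in> spanN B1" using spanN_cong[OF C2] bs by blast
    moreover have "a * b \<in> spanN B1" using spanN_cong[OF r1 spanN.diff[OF spanN_add]] bs by blast
    moreover have "b * a \<in> spanN B1" using spanN_cong[OF r2 spanN.diff[OF spanN_add]] bs by blast
    ultimately show ?thesis using that by (auto simp: B0_def)
  qed
  have s2: "h * x \<in> spanN B" if "h \<in> {a, b, c'}" "x \<in> B1" for h x
  proof -
    have bs: "1 \<in> spanN B" "a \<in> spanN B" "b \<in> spanN B" "c' \<in> spanN B" "a * c' \<in> spanN B"
      "b * c' \<in> spanN B" "c' * a \<in> spanN B" "c' * b \<in> spanN B" "a * (c' * b) \<in> spanN B"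
      "c' * (a * c') \<in> spanN B" "c' * (b * c') \<in> spanN B"
      by (intro spanN.base; simp add: B_def)+
    moreover have "a * a \<in> spanN B" "a * (a * c') \<in> spanN B"
      using spanN_cong[OF A2] spanN_cong[OF sq[OF A2 F(3)]] bs by blast+
    moreover have "b * b \<in> spanN B" "b * (b * c') \<in> spanN B"
      using spanN_cong[OF B2] spanN_cong[OF sq[OF B2 F(3)]] bs by blast+
    moreover have "c' * c' \<in> spanN B" "c' * (c' * a) \<in> spanN B" "c' * (c' * b) \<in> spanN B"
      using spanN_cong[OF C2] spanN_cong[OF sq[OF C2 F(1)]] spanN_cong[OF sq[OF C2 F(2)]] bs by blast+
    moreover have "a * b \<in> spanN B" using spanN_cong[OF r1 spanN.diff[OF spanN_add]] bs by blast
    moreover have "b * a \<in> spanN B" using spanN_cong[OF r2 spanN.diff[OF spanN_add]] bs by blast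
    moreover have "a * (b * c') \<in> spanN B" using spanN_cong[OF 1 spanN.diff[OF spanN_add]] bs by blast
    moreover have "b * (a * c') \<in> spanN B" using spanN_cong[OF 2 spanN.diff[OF spanN_add]] bs by blast
    moreover have "a * (c' * a) \<in> spanN B" using spanN_cong[OF 3 spanN.diff[OF spanN_add]] bs by blast
    moreover have "b * (c' * b) \<in> spanN B" using spanN_cong[OF 4 spanN.diff[OF spanN_add]] bs by blast
    moreover have "b * (c' * a) \<in> spanN B" using spanN_cong[OF 5] bs by blast
    ultimately show ?thesis using that unfolding B1_def by (elim insertE emptyE; simp only: mult_1_right)
  qed
  have hF: "h \<in> P.F" if "h \<in> {a, b, c'}" for h using that F by blast
  have letter: "f s \<in> {a, b, c'}" if "s \<in> {g i, g j, r}" for s using that by (auto simp: abc)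
  have sub: "1 \<in> B0" "B0 \<subseteq> B1" "B1 \<subseteq> B" by (auto simp: B0_def B1_def B_def)
  have mono: "spanN C \<subseteq> spanN C'" if "C \<subseteq> C'" for C C'
  proof
    show "x \<in> spanN C'" if "x \<in> spanN C" for x
      using that by induction (use \<open>C \<subseteq> C'\<close> in \<open>auto intro: spanN.intros\<close>)
  qed
  consider "u = []" | s where "u = [s]" "s \<in> {g i, g j, r}"
    | s t where "u = [s, t]" "s \<in> {g i, g j, r}" "t \<in> {g i, g j, r}"
    | s t q where "u = [s, t, q]" "s \<in> {g i, g j, r}" "t \<in> {g i, g j, r}" "q \<in> {g i, g j, r}"
    using u by (cases u; cases "tl u"; cases "tl (tl u)"; cases "tl (tl (tl u))") auto
  then have "fword u \<in> spanN B"
  proof cases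
    case 1
    then show ?thesis using sub by (auto simp: fword_Nil intro: spanN.base)
  next
    case (2 s)
    then have "f s \<in> B" using letter[of s] by (auto simp: B_def)
    then show ?thesis using 2 by (auto intro: spanN.base)
  next
    case (3 s t)
    have "f t \<in> B0" using letter[OF 3(3)] by (auto simp: B0_def)
    then have "f s * f t \<in> spanN B" using s1[OF letter[OF 3(2)]] mono[OF sub(3)] by blast
    then show ?thesis using 3(1) fword_split[of s "[t]"] by simp
  next
    case (4 s t q)
    have "f q \<in> B0" using letter[OF 4(4)] by (auto simp: B0_def)
    then have "f t * f q \<in> spanN B1" using s1[OF letter[OF 4(3)]] by blast
    then have "f s * (f t * f q) \<in> spanN B"
      using spanN_mult[of _ B1 "f s" B] hF[OF letter[OF 4(2)]] s2[OF letter[OF 4(2)]] by blast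
    then show ?thesis using 4(1) fword_split[of s "[t, q]"] fword_split[of t "[q]"] by simp
  qed
  then show ?thesis by (simp add: B_def abc)
qed

section \<open>The elements of \<open>K\<^sub>i\<^sub>j\<close> vanish in the presented algebra\<close>

lemma K_parabolic_conj:
  assumes ij: "i \<in> I" "j \<in> I" and p: "p \<in> P.F" "EC p \<in> K_parabolic I m {i, j}"
    and z: "z \<in> L" "cl z \<in> parabolic I m {i, j}"
  shows "\<exists>q\<in>P.F. E p - S z * E q * S (rev z) \<in> H.N"
proof -
  have "EC p \<in> {W_to_Hhat I m (cl z) \<otimes>\<^bsub>H.Q\<^esub> x \<otimes>\<^bsub>H.Q\<^esub> W_to_Hhat I m (inv\<^bsub>W\<^esub> cl z) | x.
      x \<in> Dhat_parabolic I m {i, j}}"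
    using p z unfolding K_parabolic_def Hhat_Q by blast
  moreover have "Dhat_parabolic I m {i, j} \<subseteq> EC ` P.F"
    unfolding Dhat_parabolic_def Hhat_Q using generate_ring_D[of "RP i j"] free_ring_mono[of "RP i j"] by auto
  ultimately obtain q where q: "q \<in> P.F"
    "EC p = W_to_Hhat I m (cl z) \<otimes>\<^bsub>H.Q\<^esub> EC q \<otimes>\<^bsub>H.Q\<^esub> W_to_Hhat I m (inv\<^bsub>W\<^esub> cl z)" by blast
  then have "H.cls (E p) = H.cls (S z * E q * S (rev z))"
    using z by (simp add: inv_W W_to_Hhat_cl EC_def H.cls_mult E_closed)
  then have "E p - S z * E q * S (rev z) \<in> H.N"
    using p q z by (subst (asm) H.cls_eq) (auto simp: E_closed)
  then show ?thesis using q by blast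
qed

lemma act_S: "act e (S [i]) v = T e i v" "act e (S [i, j]) v = T e i (T e j v)"
  by (simp_all add: S_def act_simps)

text \<open>Membership in K gives p = s_i q s_i and p = s_i s_j q' s_j s_i with q, q' in Dhat(W). On
  1 the rightmost letters act as signs. Hence \<open>T e i p\<close> is e q modulo the relations,
  which cancels in the sum over e = 1 and e = -1, while two letters give e e = 1, so
  \<open>T e j (T e i p)\<close> is q' for both signs.\<close>

lemma K_parabolic_T:
  assumes ij: "i \<in> I" "j \<in> I" and p: "p \<in> P.F" "EC p \<in> K_parabolic I m {i, j}"
  shows "TT i p \<in> P.N" "T 1 j (T 1 i p) - T (- 1) j (T (- 1) i p) \<in> P.N"
proof -
  have one: "T e i 1 = of_int e" "T e i (of_int e) = of_int (e * e)" for e i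
    using T_letter(3)[of e i e] by (simp_all add: T_simps)
  have ofF: "of_int e \<in> P.F" for e by simp
  have gp: "cl [i] \<in> parabolic I m {i, j}"
    using parabolic_gen[of i i j] by (simp add: g_cl)
  have "g i \<otimes>\<^bsub>W\<^esub> g j \<in> parabolic I m {i, j}"
    using parabolic_gen[of i i j] parabolic_gen[of j i j] unfolding parabolic_def by (intro generate.eng) simp_all
  then have gp': "cl [i, j] \<in> parabolic I m {i, j}" using mult_W[of "[i]" "[j]"] ij by (simp add: g_cl)
  obtain q where q: "q \<in> P.F" "E p - S [i] * E q * S [i] \<in> H.N"
    using bexE[OF K_parabolic_conj[OF ij p _ gp], unfolded rev.simps append.simps] ij by (metis L_simps(1,2))
  have "T e i p - of_int e * q \<in> P.N" if e: "e * e = 1" for e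
  proof -
    have "act e (S [i] * E q * S [i]) 1 = T e i (act e (E q) (of_int e))"
      by (simp only: act_mult act_S one)
    then have "act e (E p) 1 - T e i (act e (E q) (of_int e)) \<in> P.N"
      using act_cong[OF e q(2), of 1] by simp
    from P.N_trans[OF P.N_sym[OF act_E[OF e p(1), of 1]] this]
    have 1: "p - T e i (act e (E q) (of_int e)) \<in> P.N" by simp
    have "T e i (act e (E q) (of_int e) - q * of_int e) \<in> P.N"
      by (rule T_N[OF act_E[OF e q(1) ofF] ij(1)])
    then have "T e i (act e (E q) (of_int e)) - T e i (q * of_int e) \<in> P.N" by (simp only: T_simps)
    from T_N[OF P.N_trans[OF 1 this] ij(1)]
    have "T e i p - T e i (T e i (q * of_int e)) \<in> P.N" by (simp only: T_simps)
    moreover have "q * of_int e \<in> P.F" using q ofF by (intro free_ring_mult_closed)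
    ultimately have "T e i p - q * of_int e \<in> P.N" by (simp only: T_square[OF e ij(1)])
    moreover have "q * of_int e = of_int e * q" by (rule mult_of_int_commute[symmetric])
    ultimately show ?thesis by simp
  qed
  from P.N_add[OF this[of 1] this[of "- 1"]] show "TT i p \<in> P.N" by (simp add: TT_def)
  obtain q where q: "q \<in> P.F" "E p - S [i, j] * E q * S [j, i] \<in> H.N"
    using bexE[OF K_parabolic_conj[OF ij p _ gp'], unfolded rev.simps append.simps] ij by (metis L_simps(1,2))
  have "T e j (T e i p) - q \<in> P.N" if e: "e * e = 1" for e
  proof -
    have "act e (S [i, j] * E q * S [j, i]) 1 = T e i (T e j (act e (E q) 1))"
      by (simp only: act_mult act_S one e of_int_1)
    then have "act e (E p) 1 - T e i (T e j (act e (E q) 1)) \<in> P.N"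
      using act_cong[OF e q(2), of 1] by simp
    from P.N_trans[OF P.N_sym[OF act_E[OF e p(1), of 1]] this]
    have 1: "p - T e i (T e j (act e (E q) 1)) \<in> P.N" by simp
    have "act e (E q) 1 - q \<in> P.N" using act_E[OF e q(1), of 1] by simp
    from T_N[OF T_N[OF this ij(2)] ij(1)]
    have "T e i (T e j (act e (E q) 1)) - T e i (T e j q) \<in> P.N" by (simp only: T_simps)
    from T_N[OF T_N[OF P.N_trans[OF 1 this] ij(1)] ij(2)]
    have "T e j (T e i p) - T e j (T e i (T e i (T e j q))) \<in> P.N" by (simp only: T_simps)
    moreover have "T e j q \<in> P.F" using T_closed[OF ij(2) q(1)] .
    ultimately show ?thesis by (simp only: T_square[OF e] ij q(1))
  qed
  from P.N_diff[OF this[of 1] this[of "- 1"]]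
  show "T 1 j (T 1 i p) - T (- 1) j (T (- 1) i p) \<in> P.N" by simp
qed

text \<open>The six words listed represent all elements of the symmetric group on three letters, and
  a reflection must be one of odd length. The commuting case below is analogous with four
  words.\<close>

lemma parabolic_braid:
  assumes "i \<in> I" "j \<in> I" "m i j = 3" "t \<in> RP i j"
  shows "t \<in> {g i, g j, c i (g j)}"
proof -
  obtain z where z: "z \<in> lists {i, j}" "t = cl z" using parabolic_words[of t i j] assms by blast
  have br: "cl [i, j, i] = cl [j, i, j]" using cl_braid assms by blast
  have ii: "cl (k # k # y) = cl y" if "k \<in> I" "y \<in> L" for k y
    using cl_cong[OF cl_square[OF that(1)], of "[]" y] that by simp
  have jj: "cl [i, j, i, j] = cl [j, i]" "cl [j, i, j, i] = cl [i, j]" "cl [j, i, j] = cl [i, j, i]"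
    using cl_cong[OF br, of "[i]" "[]"] cl_cong[OF br[symmetric], of "[j]" "[]"] ii[of i "[j, i]"] ii[of j "[i, j]"] ii br assms
    using cl_cong[OF br, of "[]" "[j]"] cl_cong[OF br, of "[j]" "[]"] cl_cong[OF cl_square[of j], of "[j, i]" "[]"]
      cl_cong[OF cl_square[of i], of "[i, j]" "[]"] cl_cong[OF br[symmetric], of "[]" "[i]"] by simp_all
  have L: "\<And>k y. k \<in> {i, j} \<Longrightarrow> cl y \<in> cl ` {[], [i], [j], [i, j], [j, i], [i, j, i]} \<Longrightarrow> y \<in> L \<Longrightarrow>
      cl (k # y) \<in> cl ` {[], [i], [j], [i, j], [j, i], [i, j, i]}"
  proof -
    fix k y assume k: "k \<in> {i, j}" and y: "cl y \<in> cl ` {[], [i], [j], [i, j], [j, i], [i, j, i]}" "y \<in> L"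
    then obtain x where x: "x \<in> {[], [i], [j], [i, j], [j, i], [i, j, i]}" "cl y = cl x" by blast
    have "x \<in> L" using x assms by auto
    then have "cl (k # y) = cl (k # x)" using cl_cong[OF x(2), of "[k]" "[]"] y k assms by auto
    moreover have "cl (k # x) \<in> cl ` {[], [i], [j], [i, j], [j, i], [i, j, i]}"
      using k x(1) ii[of i "[]"] ii[of j "[]"] ii[of i "[j]"] ii[of j "[i]"] ii[of i "[j, i]"] jj assms
      by (elim insertE emptyE; hypsubst; simp)
    ultimately show "cl (k # y) \<in> cl ` {[], [i], [j], [i, j], [j, i], [i, j, i]}" by simp
  qed
  have "cl z \<in> cl ` {[], [i], [j], [i, j], [j, i], [i, j, i]}"
    using z(1)
  proof (induction z)
    case (Cons k z)
    then have "z \<in> L" using L_subset[OF assms(1,2), of z] by simp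
    then show ?case using Cons L by simp
  qed simp
  then obtain x where x: "x \<in> {[], [i], [j], [i, j], [j, i], [i, j, i]}" "t = cl x" using z by auto
  have "odd (length x)" using x assms by (intro reflection_odd) auto
  then show ?thesis using x assms by (auto simp: g_cl c_cl)
qed

lemma parabolic_comm:
  assumes "i \<in> I" "j \<in> I" "m i j = 2" "t \<in> RP i j"
  shows "t \<in> {g i, g j}"
proof -
  obtain z where z: "z \<in> lists {i, j}" "t = cl z" using parabolic_words[of t i j] assms by blast
  have ii: "cl (k # k # y) = cl y" if "k \<in> I" "y \<in> L" for k y
    using cl_cong[OF cl_square[OF that(1)], of "[]" y] that by simp
  have iji: "cl [i, j, i] = cl [j]" using c_comm[OF assms(1-3)] c_cl[of i "[j]"] assms by (simp add: g_cl)
  have ji: "cl [j, i] = cl [i, j]" using cl_cong[OF iji, of "[i]" "[]"] ii[of i "[j, i]"] assms by simp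
  have jij: "cl [j, i, j] = cl [i]"
    using cl_cong[OF ji, of "[]" "[j]"] cl_cong[OF cl_square[of j], of "[i]" "[]"] assms by simp
  have L: "cl (k # y) \<in> cl ` {[], [i], [j], [i, j]}"
    if k: "k \<in> {i, j}" and y: "cl y \<in> cl ` {[], [i], [j], [i, j]}" "y \<in> L" for k y
  proof -
    obtain x where x: "x \<in> {[], [i], [j], [i, j]}" "cl y = cl x" using y by blast
    have "x \<in> L" using x assms by auto
    then have "cl (k # y) = cl (k # x)" using cl_cong[OF x(2), of "[k]" "[]"] y k assms by auto
    moreover have "cl (k # x) \<in> cl ` {[], [i], [j], [i, j]}"
      using k x(1) ii[of i "[]"] ii[of j "[]"] ii[of i "[j]"] ji jij assms
      by (elim insertE emptyE; hypsubst; simp)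
    ultimately show ?thesis by simp
  qed
  have "cl z \<in> cl ` {[], [i], [j], [i, j]}"
    using z(1)
  proof (induction z)
    case (Cons k z)
    then have "z \<in> L" using L_subset[OF assms(1,2), of z] by simp
    then show ?case using Cons L by simp
  qed simp
  then obtain x where x: "x \<in> {[], [i], [j], [i, j]}" "t = cl x" using z by auto
  have "odd (length x)" using x assms by (intro reflection_odd) auto
  then show ?thesis using x by (auto simp: g_cl)
qed

lemma TT_cong: "p - q \<in> P.N \<Longrightarrow> TT i p \<in> P.N \<Longrightarrow> i \<in> I \<Longrightarrow> TT i q \<in> P.N"
  using P.N_diff[OF _ TT_N[of "p - q" i], of "TT i p"] by (simp add: TT_linear)

text \<open>\<open>coefficients_braid\<close> for (i, j) and again for (j, i) removes all monomials
  except 1 and \<open>f r\<close>. Both \<open>TT i\<close> and \<open>TT j\<close> kill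
  \<open>f r\<close>, so its coefficient is found from the condition with two generators.\<close>

lemma K_pair_braid:
  assumes ij: "i \<in> I" "j \<in> I" "i \<noteq> j" and 3: "m i j = 3" and pF: "p \<in> P.F"
    and p: "Poly_Mapping.keys p \<subseteq> {u \<in> lists (RP i j). length u \<le> m i j}"
    and K: "EC p \<in> K_parabolic I m {i, j}" "EC p \<in> K_parabolic I m {j, i}"
  shows "\<exists>n. p - of_int n \<in> P.N"
proof -
  note Ti = K_parabolic_T[OF ij(1,2) pF K(1)] and Tj = K_parabolic_T[OF ij(2,1) pF K(2)]
  define r where "r = c i (g j)"
  have r': "r = c j (g i)" using c_braid[OF ij(1,2) 3] by (simp add: r_def)
  have "p \<in> spanN (set [1, f (g i), f (g j), f r, f (g i) * f r, f (g j) * f r, f r * f (g i), f r * f (g j),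
    f (g i) * (f r * f (g j)), f r * (f (g i) * f r), f r * (f (g j) * f r)])"
  proof (rule spanN_words[OF p])
    fix u assume "u \<in> {u \<in> lists (RP i j). length u \<le> m i j}"
    then show "fword u \<in> spanN (set [1, f (g i), f (g j), f r, f (g i) * f r, f (g j) * f r, f r * f (g i), f r * f (g j),
        f (g i) * (f r * f (g j)), f r * (f (g i) * f r), f r * (f (g j) * f r)])"
      using parabolic_braid[OF ij(1,2) 3] 3 by (intro short_words_braid[OF ij 3 r_def]) (auto simp: r_def)
  qed
  from spanN_coeffs[OF this] obtain k :: "nat \<Rightarrow> int" where
    k: "p - (of_int (k 0) + of_int (k 1) * f (g i) + of_int (k 2) * f (g j) + of_int (k 3) * f r
    + of_int (k 4) * (f (g i) * f r) + of_int (k 5) * (f (g j) * f r)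
    + of_int (k 6) * (f r * f (g i)) + of_int (k 7) * (f r * f (g j))
    + of_int (k 8) * (f (g i) * (f r * f (g j)))
    + of_int (k 9) * (f r * (f (g i) * f r)) + of_int (k 10) * (f r * (f (g j) * f r))) \<in> P.N"
    by (auto simp: eval_nat_numeral)
  note 1 = coefficients_braid[OF ij 3 r_def TT_cong[OF k Ti(1) ij(1)]]
  have k': "p - (of_int (k 0) + of_int (k 2) * f (g j) + of_int 0 * f (g i) + of_int (k 3) * f r
    + of_int (k 5) * (f (g j) * f r) + of_int 0 * (f (g i) * f r)
    + of_int (k 7) * (f r * f (g j)) + of_int 0 * (f r * f (g i))
    + of_int 0 * (f (g j) * (f r * f (g i)))
    + of_int (k 10) * (f r * (f (g j) * f r)) + of_int 0 * (f r * (f (g i) * f r))) \<in> P.N"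
    using k unfolding 1 by simp
  have ji: "m j i = 3" using 3 m_sym[of i j] ij by simp
  note 2 = coefficients_braid[OF ij(2,1) ij(3)[symmetric] ji r' TT_cong[OF k' Tj(1) ij(2)]]
  have k'': "p - (of_int (k 0) + of_int (k 3) * f r) \<in> P.N" using k' 2 by simp
  define q where "q = of_int (k 0) + of_int (k 3) * f r"
  have cr: "c i r = g j" "r \<noteq> g i"
    using c_c[of i "g j"] c_braid_neq[OF ij(1,2) 3 ij(3)] ij by (simp_all add: r_def)
  \<comment> \<open>s_i turns D_r into D_j, on which s_j then acts with the defect 1 - e; the values
    at e = 1 and e = -1 differ by -2 times the coefficient \<open>k 3\<close>.\<close>
  have T2: "T e j (T e i q) = of_int (k 0) + of_int (k 3) * (1 - of_int e - f (g j))" if "e = 1 \<or> e = - 1" for e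
    using that cr by (elim disjE; hypsubst; simp add: q_def T_simps T_of_int T_letter T_other mult_2_right algebra_simps)
  have D: "T e j (T e i (p - q)) \<in> P.N" for e
    using T_N[OF T_N[OF k''[folded q_def] ij(1)] ij(2)] .
  have "T 1 j (T 1 i q) - T (- 1) j (T (- 1) i q) \<in> P.N"
  proof -
    have "T 1 j (T 1 i q) - T (- 1) j (T (- 1) i q) = (T 1 j (T 1 i p) - T (- 1) j (T (- 1) i p))
      - (T 1 j (T 1 i (p - q)) - T (- 1) j (T (- 1) i (p - q)))" by (simp add: T_simps)
    then show ?thesis using P.N_diff[OF Ti(2) P.N_diff[OF D D]] by simp
  qed
  then have "of_int (k 3) * of_int (- 2) \<in> P.N" by (simp add: T2 mult_2_right algebra_simps)
  then have "of_int (k 3 * (- 2)) \<in> P.N" by (simp only: of_int_merge)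
  from conjunct1[OF N_chi[OF this]] have "k 3 * (- 2) = 0" by (simp only: chi_of_int of_int_eq_0_iff)
  then have "k 3 = 0" by simp
  then show ?thesis using k'' by (intro exI[of _ "k 0"]) simp
qed

text \<open>The conjugation conditions reduce p to a constant modulo the relations. The counit,
  which is the character with z = 0, makes this constant vanish.\<close>

lemma K_pair_N:
  assumes ij: "i \<in> I" "j \<in> I" "i \<noteq> j" and x: "x \<in> K_pair I m i j"
  shows "\<exists>p\<in>P.N. x = EC p"
proof -
  obtain p where p: "x = EC p" "Poly_Mapping.keys p \<subseteq> {u \<in> lists (RP i j). length u \<le> m i j}"
    using x unfolding K_pair_def Dhat_deg_le by blast
  have pF: "p \<in> P.F" using p by (auto simp: carrier_free_ring)
  have K: "EC p \<in> K_parabolic I m {i, j}" "EC p \<in> K_parabolic I m {j, i}" "counit (EC p) = 0"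
    using x p by (simp_all add: K_pair_def insert_commute)
  note Ti = K_parabolic_T[OF ij(1,2) pF K(1)] and Tj = K_parabolic_T[OF ij(2,1) pF K(2)]
  have chi0: "chi 0 p = 0" using K(3) pF by (simp add: counit_EC chi_E)
  have const: "p \<in> P.N" if "p - of_int k \<in> P.N" for k
  proof -
    have "chi 0 (p - of_int k) = 0" using that N_chi by blast
    then have "k = 0" using chi0 by (simp add: chi_simps chi_of_int)
    then show ?thesis using that by simp
  qed
  from ij have "p \<in> P.N"
  proof (cases rule: m_cases)
    \<comment> \<open>For an infinite bond the degree bound is m = 0, so that p is constant from the
      start.\<close>
    case 1
    have "p \<in> spanN (set [1])"
      by (rule spanN_words[OF p(2)]) (auto simp: 1 fword_Nil intro: spanN.base)
    from spanN_coeffs[OF this] show ?thesis using const by auto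
  next
    case 2
    have "p \<in> spanN (set [1, f (g i), f (g j), f (g i) * f (g j)])"
    proof (rule spanN_words[OF p(2)])
      fix u assume "u \<in> {u \<in> lists (RP i j). length u \<le> m i j}"
      then show "fword u \<in> spanN (set [1, f (g i), f (g j), f (g i) * f (g j)])"
        using parabolic_comm[OF ij(1,2) 2] 2 by (intro short_words_commute[OF ij 2]) auto
    qed
    from spanN_coeffs[OF this] obtain k0 ka kb kab where
      k: "p - (of_int k0 + of_int ka * f (g i) + of_int kb * f (g j) + of_int kab * (f (g i) * f (g j))) \<in> P.N"
      by (auto simp: eval_nat_numeral)
    have 1: "ka = 0" "kab = 0" using coefficients_commute[OF ij 2 TT_cong[OF k Ti(1) ij(1)]] by auto
    have k': "p - (of_int k0 + of_int kb * f (g j) + of_int 0 * f (g i) + of_int 0 * (f (g j) * f (g i))) \<in> P.N"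
      using k 1 by simp
    have "kb = 0"
      using coefficients_commute[OF ij(2,1) ij(3)[symmetric] _ TT_cong[OF k' Tj(1) ij(2)]] 2 m_sym[of i j] ij by simp
    then show ?thesis using const k 1 by simp
  next
    case 3
    show ?thesis using K_pair_braid[OF ij 3 pF p(2) K(1,2)] const by blast
  qed
  then show ?thesis using p(1) by blast
qed

text \<open>The annihilator Z of the module \<open>P\<close> is a two-sided ideal whose image
  contains all K_ij, hence J. An element of Dhat(W) in J therefore sends 1 to 0 in \<open>P\<close>;
  by \<open>act_E\<close> it also sends 1 to its own polynomial.\<close>

lemma EC_J_N:
  assumes "p \<in> P.F" "EC p \<in> J"
  shows "p \<in> P.N"
proof -
  define Z where "Z = {x \<in> H.F. \<forall>v\<in>P.F. act 1 x v \<in> P.N}"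
  have e: "(1::int) * 1 = 1" by simp
  have "ideal Z (free_ring G)"
  proof (rule free_ring_idealI)
    show "y * x \<in> Z" if "x \<in> Z" "y \<in> H.F" for x y
      using that act_N_right by (auto simp: Z_def act_mult)
    show "x * y \<in> Z" if "x \<in> Z" "y \<in> H.F" for x y
      using that act_closed by (auto simp: Z_def act_mult)
  qed (auto simp: Z_def act_simps P.N_zero P.N_diff)
  then have "ideal (H.cls ` Z) H.Q"
    using ring.ring_ideal_imp_quot_ideal[OF free_ring_ring H.N_ideal]
    by (simp add: presented_ring_def presented_class_def[abs_def])
  moreover have "K_pair I m i j \<subseteq> H.cls ` Z" if ij: "i \<in> I" "j \<in> I" "i \<noteq> j" for i j
  proof
    fix x assume "x \<in> K_pair I m i j"
    then obtain p where p: "p \<in> P.N" "x = EC p" using K_pair_N ij by blast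
    have pF: "p \<in> P.F" using P.N_sub p by blast
    have "act 1 (E p) v \<in> P.N" if "v \<in> P.F" for v
      using P.N_add[OF act_E[OF e pF that] P.N_r[OF p(1) that]] by simp
    then show "x \<in> H.cls ` Z" using p pF E_closed by (auto simp: EC_def Z_def)
  qed
  ultimately have "J \<subseteq> H.cls ` Z"
    unfolding J_ideal_def Hhat_Q by (intro ring.genideal_minimal[OF H.Q_ring]) auto
  then obtain z where z: "z \<in> Z" "EC p = H.cls z" using assms by blast
  then have "E p - z \<in> H.N" using assms E_closed by (simp add: EC_def H.cls_eq Z_def)
  then have "act 1 (E p) 1 - act 1 z 1 \<in> P.N" using act_cong[OF e, of "E p" z 1] by simp
  moreover have "act 1 z 1 \<in> P.N" using z by (simp add: Z_def)
  ultimately have "act 1 (E p) 1 \<in> P.N" using P.N_add by fastforce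
  moreover have "act 1 (E p) 1 - p \<in> P.N" using act_E[OF e assms(1), of 1] by simp
  ultimately show ?thesis using P.N_diff by fastforce
qed

text \<open>The first isomorphism theorem for the map from the free ring on the reflections to H(W):
  the image is D(W), and the kernel is the relator ideal by \<open>rels_J\<close> in one direction
  and \<open>EC_J_N\<close> in the other.\<close>

lemma presentation_D_algebra: "has_presentation (D_algebra I m) R (D_refl I m) rels"
proof -
  define h where "h p = H_proj I m (EC p)" for p
  have Hring: "ring (H_algebra I m)"
    unfolding H_algebra_def Hhat_Q by (rule ideal.quotient_is_ring[OF J_ideal])
  have EC_hom: "EC \<in> ring_hom (free_ring R) H.Q"
    by (rule ring_hom_memI) (auto simp: free_ring_simps EC_mult EC_add EC_one)
  have "H_proj I m \<in> ring_hom H.Q (H_algebra I m)"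
    using ideal.rcos_ring_hom[OF J_ideal] by (simp add: H_algebra_def Hhat_Q H_proj_def[abs_def])
  from ring_hom_trans[OF EC_hom this] have h_hom: "h \<in> ring_hom (free_ring R) (H_algebra I m)"
    by (simp add: h_def[abs_def] comp_def)
  interpret h: ring_hom_ring "free_ring R" "H_algebra I m" h
    using free_ring_ring Hring h_hom by (intro ring_hom_ringI2)
  have "p \<in> a_kernel (free_ring R) (H_algebra I m) h \<longleftrightarrow> p \<in> P.N" for p
  proof
    assume p: "p \<in> a_kernel (free_ring R) (H_algebra I m) h"
    then have "p \<in> P.F" "H_proj I m (EC p) = J" by (auto simp: a_kernel_def' h_def H_algebra_def FactRing_def)
    moreover from this have "EC p \<in> J"
      using ideal.rcos_const_imp_mem[OF J_ideal, of "EC p"] by (simp add: H_proj_def Hhat_Q)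
    ultimately show "p \<in> P.N" using EC_J_N by blast
  next
    have "rels \<subseteq> a_kernel (free_ring R) (H_algebra I m) h"
    proof
      fix r assume r: "r \<in> rels"
      then have "EC r \<in> J" "r \<in> P.F" using rels_J rels_closed by auto
      then show "r \<in> a_kernel (free_ring R) (H_algebra I m) h"
        using abelian_subgroup.a_rcos_const[OF abelian_subgroupI3[OF ideal.axioms(1)[OF J_ideal]
            ring.is_abelian_group[OF H.Q_ring]]] by (auto simp: a_kernel_def' h_def H_algebra_def FactRing_def H_proj_def Hhat_Q)
    qed
    then have "P.N \<subseteq> a_kernel (free_ring R) (H_algebra I m) h"
      unfolding relator_ideal_def by (intro ring.genideal_minimal[OF free_ring_ring] h.kernel_is_ideal)
    then show "p \<in> P.N \<Longrightarrow> p \<in> a_kernel (free_ring R) (H_algebra I m) h" by blast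
  qed
  then have ker: "a_kernel (free_ring R) (H_algebra I m) h = P.N" by blast
  have img: "(H_algebra I m)\<lparr>carrier := h ` carrier (free_ring R)\<rparr> = D_algebra I m"
    unfolding D_algebra_def Dhat_algebra_def Hhat_Q using generate_ring_D[of R] by (simp add: h_def image_image)
  have "(\<lambda>U. the_elem (h ` U)) \<in> ring_iso (presented_ring R rels) (D_algebra I m)"
    using h.FactRing_iso_set_aux unfolding ker img presented_ring_def .
  moreover have "the_elem (h ` presented_class R rels (fword [s])) = D_refl I m s" if "s \<in> R" for s
  proof -
    have "the_elem (h ` presented_class R rels (fword [s])) = h (fword [s])"
      unfolding presented_class_def ker[symmetric] by (rule h.the_elem_simp[OF f_closed[OF that]])
    then show ?thesis by (simp only: h_def D_refl_def EC_letter[OF that])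
  qed
  ultimately show ?thesis unfolding has_presentation_def by (intro bexI[rotated] ballI)
qed

end

theorem proposition1p31:
  fixes I :: "'i set" and m :: "'i \<Rightarrow> 'i \<Rightarrow> nat"
  assumes "coxeter_matrix I m"
    and "\<forall>i \<in> I. \<forall>j \<in> I. i \<noteq> j \<longrightarrow> m i j \<in> {0, 2, 3}"
  shows "has_presentation (D_algebra I m) (reflections I m) (D_refl I m)
    ({fword [s, s] - fword [s] | s. s \<in> reflections I m} \<union>
     {fword [s, s'] - fword [s', s] | s s'. compatible I m s s' \<and> cox_order I m s s' = 2} \<union>
     {fword [s, s'] -
        (fword [s \<otimes>\<^bsub>cox_group I m\<^esub> s' \<otimes>\<^bsub>cox_group I m\<^esub> s, s]
         + fword [s', s \<otimes>\<^bsub>cox_group I m\<^esub> s' \<otimes>\<^bsub>cox_group I m\<^esub> s]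
         - fword [s \<otimes>\<^bsub>cox_group I m\<^esub> s' \<otimes>\<^bsub>cox_group I m\<^esub> s])
       | s s'. compatible I m s s' \<and> cox_order I m s s' = 3})"
proof -
  interpret simply_laced I m using assms by unfold_locales
  show ?thesis using presentation_D_algebra unfolding rels_def rel1_def rel2_def rel3_def .
qed

end
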